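(* Let $r,s$ be fixed with $1\le s\le r/2$, and let $W$ be the weight matrix of the $s$-th auxiliary graph of $H^r(n,p)$. If $n^{r-s}p(1-p)\to \infty$, then the empirical distribution of the eigenvalues of $W-\mathbb{E}(W)$ follows the Semicircle Law centered at $0$ with radius $2\sqrt{\binom{r-s}{s}\binom{n-s}{r-s}p(1-p)}$.
   Context: $H^r(n,p)$ is the random $r$-uniform hypergraph on $V=[n]$, each $r$-subset being an edge independently with probability $p=p(n)$. $W$ is the $\binom{n}{s}\times\binom{n}{s}$ matrix indexed by $s$-subsets of $[n]$ with $W(S,T)$ equal to the number of edges of $H^r(n,p)$ containing $S\cup T$ if $S\cap T=\emptyset$, and $0$ otherwise. Semicircle Law: let $F(x)$ have density $(2/\pi)\sqrt{1-x^2}$ on $[-1,1]$ and $0$ elsewhere. For an $N\times N$ Hermitian $A$, $F(A,x)=\frac1N|\{\text{eigenvalues of }A\text{ less than }x\}|$; the eigenvalues of $A$ follow the Semicircle Law centered at $c$ with radius $R$ if $F(\frac1R(A-cI),x)\to F(x)$ in probability as $N\to\infty$. *)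

theory Defs
  imports "HOL-Probability.Probability" "Jordan_Normal_Form.Schur_Decomposition"
begin

definition semicircle_density :: "real \<Rightarrow> real" where
  "semicircle_density x = (if \<bar>x\<bar> \<le> 1 then 2 / pi * sqrt (1 - x\<^sup>2) else 0)"

definition semicircle_cdf :: "real \<Rightarrow> real" where
  "semicircle_cdf = cdf (density lborel (\<lambda>x. ennreal (semicircle_density x)))"

text \<open>
  The proportion of eigenvalues less than \<open>x\<close> of a Hermitian matrix, counted with multiplicity.
  The sum ranges over the real eigenvalues only, which for Hermitian matrices are all of them.
\<close>

definition empirical_eigenvalue_cdf :: "complex mat \<Rightarrow> real \<Rightarrow> real" where
  "empirical_eigenvalue_cdf A x =
     (\<Sum>t | eigenvalue A (complex_of_real t) \<and> t < x.
        real (Polynomial.order (complex_of_real t) (char_poly A))) / real (dim_row A)"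

text \<open>
  Convergence in probability, for every real \<open>x\<close>, of the normalised empirical distribution.
  The \<open>n\<close>-th random matrix is the function \<open>A n\<close> on the probability space \<open>\<Omega> n\<close>; the
  definition is meant for Hermitian matrices whose dimension tends to infinity with \<open>n\<close>.
\<close>

definition follows_semicircle_law ::
    "(nat \<Rightarrow> 'a pmf) \<Rightarrow> (nat \<Rightarrow> 'a \<Rightarrow> complex mat) \<Rightarrow> (nat \<Rightarrow> real) \<Rightarrow> (nat \<Rightarrow> real) \<Rightarrow> bool" where
  "follows_semicircle_law \<Omega> A c R \<longleftrightarrow>
     (\<forall>x. \<forall>\<epsilon>>0.
       (\<lambda>n. measure_pmf.prob (\<Omega> n)
          {\<omega>. \<bar>empirical_eigenvalue_cdf
                 (complex_of_real (1 / R n) \<cdot>\<^sub>m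
                    (A n \<omega> - complex_of_real (c n) \<cdot>\<^sub>m 1\<^sub>m (dim_row (A n \<omega>)))) x
               - semicircle_cdf x\<bar> > \<epsilon>})
       \<longlonglongrightarrow> 0)"

text \<open>A hypergraph on \<open>{1..n}\<close> is represented by its set of edges.\<close>

definition random_hypergraph :: "nat \<Rightarrow> nat \<Rightarrow> real \<Rightarrow> nat set set pmf" where
  "random_hypergraph r n p =
     map_pmf (\<lambda>h. {e. h e})
       (Pi_pmf {e. e \<subseteq> {1..n} \<and> card e = r} False (\<lambda>_. bernoulli_pmf p))"

definition aux_weight :: "nat set set \<Rightarrow> nat set \<Rightarrow> nat set \<Rightarrow> nat" where
  "aux_weight E S T = (if S \<inter> T = {} then card {e \<in> E. S \<union> T \<subseteq> e} else 0)"

text \<open>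
  An enumeration of the \<open>s\<close>-subsets of \<open>{1..n}\<close>, used to index matrices by these sets.
  The eigenvalues do not depend on the order of the enumeration.
\<close>

definition s_subsets :: "nat \<Rightarrow> nat \<Rightarrow> nat set list" where
  "s_subsets n s = filter (\<lambda>S. card S = s) (map set (List.subseqs [1..<Suc n]))"

definition weight_matrix :: "nat \<Rightarrow> nat \<Rightarrow> nat set set \<Rightarrow> complex mat" where
  "weight_matrix s n E =
     Matrix.mat (n choose s) (n choose s)
       (\<lambda>(i, j). of_nat (aux_weight E (s_subsets n s ! i) (s_subsets n s ! j)))"

definition expected_weight_matrix :: "nat \<Rightarrow> nat \<Rightarrow> nat \<Rightarrow> real \<Rightarrow> complex mat" where
  "expected_weight_matrix r s n p =
     Matrix.mat (n choose s) (n choose s)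
       (\<lambda>(i, j). measure_pmf.expectation (random_hypergraph r n p)
                   (\<lambda>E. weight_matrix s n E $$ (i, j)))"

lemma set_s_subsets: "set (s_subsets n s) = {S. S \<subseteq> {1..n} \<and> card S = s}"
proof -
  have "set (map set (List.subseqs [1..<Suc n])) = Pow {1..n}"
    using subseqs_powset[of "[1..<Suc n]"] by (simp only: set_map set_upt atLeastLessThanSuc_atLeastAtMost)
  then show ?thesis
    unfolding s_subsets_def set_filter by auto
qed

lemma distinct_s_subsets: "distinct (s_subsets n s)"
  unfolding s_subsets_def by (intro distinct_filter distinct_set_subseqs) simp

lemma length_s_subsets: "length (s_subsets n s) = n choose s"
  using distinct_card[OF distinct_s_subsets, of n s] n_subsets[of "{1..n}" s]
  by (simp add: set_s_subsets)

lemma hermitian_centred_weight_matrix: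
  "mat_adjoint (weight_matrix s n E - expected_weight_matrix r s n p) =
     weight_matrix s n E - expected_weight_matrix r s n p" (is "mat_adjoint ?M = ?M")
proof -
  have sym: "aux_weight E S T = aux_weight E T S" for E S T
    by (simp add: aux_weight_def Int_commute Un_commute)
  have real: "cnj (measure_pmf.expectation P (\<lambda>E. of_nat (f E))) =
      measure_pmf.expectation P (\<lambda>E. of_nat (f E))" for P and f :: "nat set set \<Rightarrow> nat"
    using integral_complex_of_real[of "measure_pmf P" "\<lambda>E. real (f E)"] by simp
  show ?thesis
    by (rule eq_matI)
       (auto simp: mat_adjoint_def mat_of_rows_def weight_matrix_def expected_weight_matrix_def
             real intro: arg_cong2[where f = "(-)"] simp: sym)
qed

end

theory Submission
  imports Defs
begin

text \<open>
  The centred weight matrix is \<open>M = \<Sum>e. \<xi> e * A e\<close>, where the \<open>\<xi> e\<close> are independent centred Bernoulli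
  variables and \<open>A e\<close> is the adjacency matrix of disjoint \<open>s\<close>-subsets of the edge \<open>e\<close>. The proof is by
  the method of moments, with \<open>v = p (1 - p)\<close>, \<open>N\<close> the dimension, \<open>D\<close> the number of pairs \<open>(e, T)\<close> with
  \<open>A e S T = 1\<close> for a given \<open>S\<close>, and \<open>\<rho> = v D\<close>. The trace of \<open>M ^ k\<close> is a sum over closed walks of
  products of \<open>\<xi>\<close>'s; only walks traversing each edge at least twice survive in expectation, and a walk
  with \<open>d\<close> distinct edges has weight at most \<open>v ^ d\<close>, while there are \<open>O(N D ^ d)\<close> such walks. Hence walks
  with an edge of multiplicity three or more are negligible. In the others the first edge is paired
  with exactly one later step, which gives
    \<open>E tr M ^ (k + 2) \<approx> v (\<Sum>i\<le>k. E (\<Sum>e. tr (A e * M ^ i * A e * M ^ (k - i))))\<close>.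
  Off-diagonal entries of the powers of \<open>M\<close> contribute little to the sum over \<open>e\<close>, since two distinct
  \<open>s\<close>-sets lie in few common edges and the Frobenius norm of \<open>M ^ i\<close> is controlled by \<open>tr M ^ (2 i)\<close>; the
  diagonal part is \<open>D / N\<close> times \<open>tr M ^ i * tr M ^ (k - i)\<close> up to lower order. Pairs of walks sharing
  an edge are rarer than all pairs by a factor \<open>N\<close>, so normalised traces concentrate, and the limiting
  moments satisfy the Catalan recursion. Finally indicator functions of half-lines are squeezed
  between polynomials whose semicircle integrals are arbitrarily close.
\<close>

section \<open>Products of centred Bernoulli variables\<close>

text \<open>Entries of \<open>M\<close> fed by a common edge are dependent, so independence is
  available only between hyperedges; hence walks are words recording the edge used at every step.
  The scaling is \<open>v ^ d * D ^ d = \<rho> ^ d\<close>: with all multiplicities at least two,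
  \<open>2 * d \<le> k\<close>, and \<open>1 \<le> \<rho>\<close> bounds this by
  \<open>sqrt \<rho> ^ k\<close>. A multiplicity of three or more loses a factor
  \<open>sqrt \<rho>\<close>, which tends to infinity because \<open>D\<close> has order
  \<open>n ^ (r - s)\<close>. Expanding only the first edge takes the place of classifying tree-like
  walks: the resulting identity closes up among the moments. The obstacle is a diagonal entry of one
  power times an off-diagonal entry of the other, since the rarity of common edges helps only the
  second factor. A weighted inequality between a product and two squares charges the off-diagonal
  square \<open>1 / \<eta>\<close> and the other one \<open>\<eta>\<close>; with \<open>D2\<close>
  bounding the edges through two distinct vertices, \<open>\<eta> = sqrt (D2 / D)\<close> balances
  the costs. The radius is \<open>2 * sqrt \<rho>\<close> because the Catalan numbers are the even
  moments of the semicircle law on \<open>[-2, 2]\<close>.\<close>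

lemma expectation_prod_Pi_pmf_finite:
  fixes f :: "'a \<Rightarrow> 'b \<Rightarrow> real"
  assumes "finite A" and fin: "\<And>x. x \<in> A \<Longrightarrow> finite (set_pmf (P x))"
  shows "measure_pmf.expectation (Pi_pmf A dflt P) (\<lambda>h. \<Prod>x\<in>A. f x (h x)) =
           (\<Prod>x\<in>A. measure_pmf.expectation (P x) (f x))"
proof -
  let ?Q = "Pi_pmf A dflt P"
  have "finite (set_pmf ?Q)"
    using assms by (auto simp: set_Pi_pmf)
  then have int: "integrable ?Q g" for g :: "('a \<Rightarrow> 'b) \<Rightarrow> real"
    by (rule integrable_measure_pmf_finite)
  have "prob_space.indep_vars (measure_pmf ?Q) (\<lambda>_. borel) (\<lambda>x h. f x (h x)) A"
    using prob_space.indep_vars_compose2[OF prob_space_measure_pmf indep_vars_Pi_pmf[OF \<open>finite A\<close>, of dflt P],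
        where Y = f and N = "\<lambda>_. borel"] by simp
  then have "measure_pmf.expectation ?Q (\<lambda>h. \<Prod>x\<in>A. f x (h x)) =
      (\<Prod>x\<in>A. measure_pmf.expectation ?Q (\<lambda>h. f x (h x)))"
    using int \<open>finite A\<close> by (intro prob_space.indep_vars_lebesgue_integral[OF prob_space_measure_pmf]) auto
  also have "\<dots> = (\<Prod>x\<in>A. measure_pmf.expectation (map_pmf (\<lambda>h. h x) ?Q) (f x))"
    by simp
  also have "\<dots> = (\<Prod>x\<in>A. measure_pmf.expectation (P x) (f x))"
    using \<open>finite A\<close> by (intro prod.cong refl) (simp add: Pi_pmf_component)
  finally show ?thesis .
qed

lemma prod_list_map_eq_prod_count:
  fixes f :: "'a \<Rightarrow> 'b::comm_monoid_mult"
  assumes "finite A" "set xs \<subseteq> A"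
  shows "prod_list (map f xs) = (\<Prod>x\<in>A. f x ^ count_list xs x)"
  using assms(2)
proof (induction xs)
  case (Cons y xs)
  then have "(\<Prod>x\<in>A. f x ^ count_list (y # xs) x) =
      (\<Prod>x\<in>A. (if x = y then f y else 1) * f x ^ count_list xs x)"
    by (intro prod.cong) auto
  also have "\<dots> = f y * (\<Prod>x\<in>A. f x ^ count_list xs x)"
    using Cons assms(1) by (simp add: prod.distrib)
  finally show ?case
    using Cons by simp
qed simp

text \<open>Matrices are functions on a vertex set rather than arrays, so the combinatorics of walks
  is free of enumerations; \<open>pow_mat_of_function\<close> translates back once the vertices are
  listed.\<close>

primrec mpow :: "'v set \<Rightarrow> ('v \<Rightarrow> 'v \<Rightarrow> real) \<Rightarrow> nat \<Rightarrow> 'v \<Rightarrow> 'v \<Rightarrow> real" where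
  "mpow V X 0 = (\<lambda>S T. of_bool (S = T))"
| "mpow V X (Suc k) = (\<lambda>S T. \<Sum>U\<in>V. X S U * mpow V X k U T)"

definition mtrace :: "'v set \<Rightarrow> ('v \<Rightarrow> 'v \<Rightarrow> real) \<Rightarrow> real" where
  "mtrace V X = (\<Sum>S\<in>V. X S S)"

lemma mpow_add:
  assumes "finite V" "S \<in> V"
  shows "mpow V X (i + j) S T = (\<Sum>U\<in>V. mpow V X i S U * mpow V X j U T)"
  using assms(2)
proof (induction i arbitrary: S)
  case 0
  then show ?case
    using assms(1) by (simp add: of_bool_def if_distrib[of "\<lambda>x. x * _"] cong: if_cong)
next
  case (Suc i)
  have "mpow V X (Suc i + j) S T = (\<Sum>R\<in>V. \<Sum>U\<in>V. X S R * (mpow V X i R U * mpow V X j U T))"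
    using Suc by (simp add: sum_distrib_left)
  also have "\<dots> = (\<Sum>U\<in>V. \<Sum>R\<in>V. X S R * (mpow V X i R U * mpow V X j U T))"
    by (rule sum.swap)
  finally show ?case
    by (simp add: sum_distrib_right mult.assoc)
qed

lemma mpow_Suc_right:
  assumes "finite V" "S \<in> V" "T \<in> V"
  shows "mpow V X (Suc k) S T = (\<Sum>U\<in>V. mpow V X k S U * X U T)"
proof -
  have one: "mpow V X (Suc 0) U T = X U T" for U
    using assms by (simp add: of_bool_def if_distrib[of "\<lambda>x. _ * x"] cong: if_cong)
  show ?thesis
    using mpow_add[OF assms(1,2), of X k "Suc 0" T] unfolding one by simp
qed

lemma mpow_sym:
  assumes "finite V" "\<And>S T. S \<in> V \<Longrightarrow> T \<in> V \<Longrightarrow> X S T = X T S" "S \<in> V" "T \<in> V"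
  shows "mpow V X k S T = mpow V X k T S"
  using assms(3,4)
proof (induction k arbitrary: S T)
  case (Suc k)
  have "mpow V X (Suc k) S T = (\<Sum>U\<in>V. mpow V X k S U * X U T)"
    by (rule mpow_Suc_right[OF assms(1) Suc.prems])
  also have "\<dots> = (\<Sum>U\<in>V. X T U * mpow V X k U S)"
    using Suc assms(2) by (intro sum.cong refl) (simp add: mult.commute)
  finally show ?case
    by simp
qed auto

lemma mpow_scale: "mpow V (\<lambda>S T. c * X S T) k S T = c ^ k * mpow V X k S T"
  by (induction k arbitrary: S) (simp_all add: sum_distrib_left mult_ac)

text \<open>This turns the Frobenius norm of a power into an even moment, so that the errors of the
  recursion are controlled by the moments themselves.\<close>

lemma mtrace_mpow_double:
  assumes "finite V" "\<And>S T. S \<in> V \<Longrightarrow> T \<in> V \<Longrightarrow> X S T = X T S"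
  shows "mtrace V (mpow V X (i + i)) = (\<Sum>S\<in>V. \<Sum>T\<in>V. (mpow V X i S T)\<^sup>2)"
  unfolding mtrace_def power2_eq_square
proof (rule sum.cong)
  fix S assume S: "S \<in> V"
  show "mpow V X (i + i) S S = (\<Sum>T\<in>V. mpow V X i S T * mpow V X i S T)"
    unfolding mpow_add[OF assms(1) S] 
    by (intro sum.cong refl arg_cong2[of _ _ _ _ "(*)"]) (rule mpow_sym[OF assms _ S])
qed simp

section \<open>Central moments of a Bernoulli variable, and their products over lists of
  edges\<close>

definition bmoment :: "real \<Rightarrow> nat \<Rightarrow> real" where
  "bmoment p j = p * (1 - p) ^ j + (1 - p) * (- p) ^ j"

lemma bmoment_simps [simp]:
  "bmoment p 0 = 1" "bmoment p (Suc 0) = 0" "bmoment p 2 = p * (1 - p)"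
  by (simp_all add: bmoment_def algebra_simps power2_eq_square)

text \<open>A centred Bernoulli variable takes values in \<open>[-1, 1]\<close>, so from the second
  one on its moments are at most the variance. Taking out \<open>p * (1 - p)\<close> leaves a convex
  combination of powers of \<open>p\<close> and \<open>1 - p\<close>.\<close>

lemma abs_bmoment_le:
  assumes "0 \<le> p" "p \<le> 1" "2 \<le> j"
  shows "\<bar>bmoment p j\<bar> \<le> p * (1 - p)"
proof -
  obtain i where j: "j = Suc (Suc i)"
    using le_Suc_ex[OF assms(3)] by (auto simp: numeral_2_eq_2)
  have "\<bar>bmoment p j\<bar> \<le> \<bar>p * (1 - p) ^ j\<bar> + \<bar>(1 - p) * (- p) ^ j\<bar>"
    unfolding bmoment_def by (rule abs_triangle_ineq)
  also have "\<dots> = p * (1 - p) * ((1 - p) * (1 - p) ^ i + p * p ^ i)"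
    using assms by (simp add: abs_mult power_abs j) (simp add: algebra_simps)
  also have "\<dots> \<le> p * (1 - p) * ((1 - p) * 1 + p * 1)"
    using assms by (intro mult_left_mono add_mono power_le_one) auto
  finally show ?thesis
    by simp
qed

text \<open>By independence this is the expectation of the product of the centred variables along
  the list, see \<open>E_prod_\<xi>\<close>.\<close>

definition edge_weight :: "real \<Rightarrow> 'e list \<Rightarrow> real" where
  "edge_weight p es = (\<Prod>e\<in>set es. bmoment p (count_list es e))"

lemma edge_weight_eq_prod:
  assumes "finite A" "set es \<subseteq> A"
  shows "edge_weight p es = (\<Prod>e\<in>A. bmoment p (count_list es e))"
  unfolding edge_weight_def using assms
  by (intro prod.mono_neutral_left) auto

text \<open>An edge occurring once would contribute the first central moment, which is zero, as a
  factor.\<close>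

lemma count_list_ge_2_of_edge_weight:
  assumes "edge_weight p es \<noteq> 0" "e \<in> set es"
  shows "2 \<le> count_list es e"
proof -
  have "bmoment p (count_list es e) \<noteq> 0"
    using assms by (auto simp: edge_weight_def)
  moreover have "count_list es e \<noteq> 0"
    using assms(2) by (simp add: count_list_0_iff)
  ultimately show ?thesis
    by (metis bmoment_simps(2) One_nat_def less_2_cases_iff not_less)
qed

lemma length_eq_sum_count_list: "length es = (\<Sum>e\<in>set es. count_list es e)"
  using sum_list_map_eq_sum_count[of "\<lambda>_. 1" es] by (simp add: sum_list_triv)

lemma card_le_of_edge_weight:
  assumes "edge_weight p es \<noteq> 0"
  shows "2 * card (set es) \<le> length es"
proof -
  have "(\<Sum>e\<in>set es. 2) \<le> (\<Sum>e\<in>set es. count_list es e)"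
    using count_list_ge_2_of_edge_weight[OF assms] by (rule sum_mono)
  then show ?thesis
    by (simp add: length_eq_sum_count_list[of es] mult.commute)
qed

text \<open>The strictness is what later gains a factor \<open>sqrt \<rho>\<close> over
  \<open>card_le_of_edge_weight\<close>.\<close>

lemma card_less_of_edge_weight:
  assumes "edge_weight p es \<noteq> 0" "e \<in> set es" "3 \<le> count_list es e"
  shows "2 * card (set es) < length es"
proof -
  have "(\<Sum>e\<in>set es. 2) < (\<Sum>e\<in>set es. count_list es e)"
    using count_list_ge_2_of_edge_weight[OF assms(1)] assms(2,3)
    by (intro sum_strict_mono_ex1) (auto intro!: bexI[of _ e])
  then show ?thesis
    by (simp add: length_eq_sum_count_list[of es] mult.commute)
qed

lemma abs_edge_weight_le:
  assumes "0 \<le> p" "p \<le> 1"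
  shows "\<bar>edge_weight p es\<bar> \<le> (p * (1 - p)) ^ card (set es)"
proof (cases "edge_weight p es = 0")
  case False
  have "\<bar>edge_weight p es\<bar> = (\<Prod>e\<in>set es. \<bar>bmoment p (count_list es e)\<bar>)"
    by (simp add: edge_weight_def abs_prod)
  also have "\<dots> \<le> (\<Prod>e\<in>set es. p * (1 - p))"
    using assms count_list_ge_2_of_edge_weight[OF False]
    by (intro prod_mono) (auto intro: abs_bmoment_le)
  finally show ?thesis
    by simp
qed (use assms in simp)

text \<open>Consequently walks without a common edge have covariance zero.\<close>

lemma edge_weight_append_disjoint:
  assumes "set es \<inter> set fs = {}"
  shows "edge_weight p (es @ fs) = edge_weight p es * edge_weight p fs"
proof -
  have "edge_weight p (es @ fs) =
      (\<Prod>e\<in>set es. bmoment p (count_list (es @ fs) e)) *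
      (\<Prod>e\<in>set fs. bmoment p (count_list (es @ fs) e))"
    unfolding edge_weight_def set_append using assms by (intro prod.union_disjoint) auto
  also have "(\<Prod>e\<in>set es. bmoment p (count_list (es @ fs) e)) = edge_weight p es"
    unfolding edge_weight_def using assms
    by (intro prod.cong refl arg_cong[of _ _ "bmoment p"]) (auto simp: count_list_0_iff)
  also have "(\<Prod>e\<in>set fs. bmoment p (count_list (es @ fs) e)) = edge_weight p fs"
    unfolding edge_weight_def using assms
    by (intro prod.cong refl arg_cong[of _ _ "bmoment p"]) (auto simp: count_list_0_iff)
  finally show ?thesis .
qed

lemma count_list_eq_card: "count_list xs x = card {i. i < length xs \<and> xs ! i = x}"
  by (simp add: count_list_eq_length_filter length_filter_conv_card eq_commute)

text \<open>The power \<open>\<rho> ^ d\<close> may be padded to \<open>sqrt \<rho> ^ k\<close>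
  because \<open>1 \<le> \<rho>\<close>. The factor \<open>inverse D ^ d\<close> is kept apart: it
  is summed against the number of walks with \<open>d\<close> distinct edges.\<close>

lemma scaled_power_le:
  fixes \<rho> D v :: real
  assumes "0 < D" "\<rho> = v * D" "1 \<le> \<rho>" "2 * d \<le> k"
  shows "v ^ d \<le> sqrt \<rho> ^ k * inverse D ^ d"
proof -
  have "v ^ d = \<rho> ^ d * inverse D ^ d"
    using assms by (simp add: power_mult_distrib field_simps)
  also have "\<rho> ^ d = sqrt \<rho> ^ (2 * d)"
    using assms by (simp add: power_mult)
  also have "sqrt \<rho> ^ (2 * d) \<le> sqrt \<rho> ^ k"
    using assms by (intro power_increasing) auto
  finally show ?thesis
    using assms by simp
qed

text \<open>
  The first edge of a list with non-vanishing weight is paired with exactly one later occurrence,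
  except on lists with an edge of multiplicity at least three; those have few distinct edges.
\<close>

lemma edge_weight_Cons_approx:
  fixes p D \<rho> :: real and es :: "'e list"
  assumes p: "0 \<le> p" "p \<le> 1" and D: "0 < D" and \<rho>: "\<rho> = p * (1 - p) * D" "1 \<le> \<rho>"
  shows "\<bar>edge_weight p (e # es) -
      (\<Sum>i<length es. of_bool (es ! i = e) * (p * (1 - p) * edge_weight p (take i es @ drop (Suc i) es)))\<bar>
    \<le> real (length es + 1) * (sqrt \<rho> ^ length es * inverse D ^ card (set (e # es)))"
    (is "\<bar>_ - ?sum\<bar> \<le> _ * ?K")
proof -
  define v where "v = p * (1 - p)"
  let ?del = "\<lambda>i. take i es @ drop (Suc i) es"
  let ?c = "count_list es e"
  have v01: "0 \<le> v" using p by (simp add: v_def)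
  have K0: "0 \<le> ?K" using D \<rho> by simp
  have split: "es = take i es @ es ! i # drop (Suc i) es" if "i < length es" for i
    using that by (rule id_take_nth_drop)
  have count_del: "count_list es a = count_list (?del i) a + of_bool (es ! i = a)"
    if "i < length es" for i a
    using arg_cong[OF split[OF that], of "\<lambda>l. count_list l a"] by simp
  have len_del: "length es = Suc (length (?del i))" if "i < length es" for i
    using that by simp
  have set_del: "set es = insert (es ! i) (set (?del i))" if "i < length es" for i
    using arg_cong[OF split[OF that], of set] by simp
  \<comment> \<open>The cases are the multiplicities of \<open>e\<close> in the tail: for 0 and 1
    the approximation is an identity, for 2 or more the weight and the sum are small
    separately.\<close>
  consider "?c = 0" | "?c = 1" | "2 \<le> ?c" by linarith
  then show ?thesis
  proof cases
    case 1
    then have "e \<notin> set es" by (simp add: count_list_0_iff)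
    then have "edge_weight p (e # es) = 0"
      using 1 by (auto simp: edge_weight_def intro!: prod_zero)
    moreover have "?sum = 0"
      using \<open>e \<notin> set es\<close> by (intro sum.neutral) (auto simp: in_set_conv_nth)
    ultimately show ?thesis using K0 by simp
  next
    case 2
    then obtain j where j: "{i. i < length es \<and> es ! i = e} = {j}"
      unfolding count_list_eq_card by (auto simp: card_1_singleton_iff)
    then have j': "j < length es" "es ! j = e" by auto
    have notin: "e \<notin> set (?del j)"
      using count_del[OF j'(1), of e] 2 j' by (simp add: count_list_0_iff)
    have "edge_weight p (e # es) = (\<Prod>a\<in>insert e (set (?del j)). bmoment p (count_list (e # es) a))"
      unfolding edge_weight_def using set_del[OF j'(1)] j' by simp
    also have "\<dots> = bmoment p (count_list (e # es) e) * (\<Prod>a\<in>set (?del j). bmoment p (count_list (e # es) a))"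
      using notin by (subst prod.insert) auto
    also have "count_list (e # es) e = 2" using 2 by simp
    also have "(\<Prod>a\<in>set (?del j). bmoment p (count_list (e # es) a)) = edge_weight p (?del j)"
      unfolding edge_weight_def
    proof (rule prod.cong)
      fix a assume "a \<in> set (?del j)"
      then have "a \<noteq> e" using notin by blast
      then show "bmoment p (count_list (e # es) a) = bmoment p (count_list (?del j) a)"
        using count_del[OF j'(1), of a] j' by (simp del: count_list_append)
    qed simp
    finally have eq: "edge_weight p (e # es) = p * (1 - p) * edge_weight p (?del j)"
      by simp
    have "?sum = (\<Sum>i\<in>{i. i < length es \<and> es ! i = e}. p * (1 - p) * edge_weight p (?del i))"
      by (intro sum.mono_neutral_cong_right) auto
    then have "?sum = edge_weight p (e # es)"
      using eq by (simp add: j)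
    then show ?thesis using K0 by simp
  next
    case 3
    then have e_in: "e \<in> set es" by (metis count_notin not_numeral_le_zero)
    have 1: "\<bar>edge_weight p (e # es)\<bar> \<le> ?K"
    proof (cases "edge_weight p (e # es) = 0")
      case False
      have "2 * card (set (e # es)) < length (e # es)"
        using 3 by (intro card_less_of_edge_weight[OF False, of e]) auto
      then have "v ^ card (set (e # es)) \<le> ?K"
        using D \<rho> by (intro scaled_power_le) (auto simp: v_def)
      then show ?thesis
        using abs_edge_weight_le[OF p, of "e # es"] by (simp add: v_def)
    qed (use K0 in simp)
    have 2: "\<bar>of_bool (es ! i = e) * (p * (1 - p) * edge_weight p (?del i))\<bar> \<le> ?K"
      if i: "i < length es" for i
    proof (cases "es ! i = e \<and> edge_weight p (?del i) \<noteq> 0")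
      case True
      have "count_list (?del i) e \<noteq> 0"
        using count_del[OF i, of e] 3 True by (simp del: count_list_append)
      then have "e \<in> set (?del i)" by (simp only: count_list_0_iff simp_thms)
      then have sets: "set (?del i) = set (e # es)"
        using set_del[OF i] True e_in by auto
      have "2 * card (set (?del i)) \<le> length (?del i)"
        using True by (intro card_le_of_edge_weight[of p]) auto
      then have le: "2 * card (set (e # es)) \<le> length es"
        unfolding sets using len_del[OF i] by linarith
      have "\<bar>p * (1 - p) * edge_weight p (?del i)\<bar> = v * \<bar>edge_weight p (?del i)\<bar>"
        using p by (simp add: abs_mult v_def)
      \<comment> \<open>Deleting one of several occurrences of \<open>e\<close> leaves the set of
        edges unchanged, so the weight alone supplies the full power of \<open>v\<close> and the
        extra factor \<open>v \<le> 1\<close> can be given away.\<close>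
      also have "\<dots> \<le> 1 * v ^ card (set (e # es))"
        using abs_edge_weight_le[OF p, of "?del i"] v01 p sets
        by (intro mult_mono) (auto simp: v_def mult_le_one)
      also have "\<dots> \<le> ?K"
        using scaled_power_le[OF D _ \<rho>(2) le, of v] \<rho>(1) by (simp add: v_def)
      finally show ?thesis
        using True by simp
    qed (use K0 in auto)
    have "\<bar>?sum\<bar> \<le> (\<Sum>i<length es. ?K)"
      using 2 by (intro order_trans[OF sum_abs] sum_mono) simp
    then have "\<bar>?sum\<bar> \<le> real (length es) * ?K" by simp
    then show ?thesis using 1 by (simp add: algebra_simps)
  qed
qed

section \<open>Closed walks and traces\<close>

text \<open>
  \<open>inc\<close> is incidence of a vertex (an \<open>s\<close>-subset) with an edge (an \<open>r\<close>-subset), \<open>B\<close> bounds the number of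
  vertices in an edge, and \<open>D\<close> bounds the number of edges at a vertex. A word lists pairs of an edge
  and the vertex reached through it, so that the starting vertex of a walk is not part of the word.
\<close>

locale random_edge_matrix =
  fixes V :: "'v set" and Es :: "'e set" and inc :: "'v \<Rightarrow> 'e \<Rightarrow> bool"
    and A :: "'e \<Rightarrow> 'v \<Rightarrow> 'v \<Rightarrow> real" and p D :: real and B :: nat
  assumes finite_V: "finite V" and finite_Es: "finite Es"
    and A_01: "A e S T = 0 \<or> A e S T = 1"
    and A_sym: "A e S T = A e T S"
    and A_inc: "A e S T \<noteq> 0 \<Longrightarrow> inc S e \<and> inc T e"
    and card_vertices_of_edge: "e \<in> Es \<Longrightarrow> card {S \<in> V. inc S e} \<le> B"
    and card_edges_of_vertex: "S \<in> V \<Longrightarrow> real (card {e \<in> Es. inc S e}) \<le> D"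
    and p_nonneg: "0 \<le> p" and p_le_1: "p \<le> 1"
    and one_le_rho: "1 \<le> p * (1 - p) * D"
begin

definition \<rho> :: real where "\<rho> = p * (1 - p) * D"

definition \<Omega> :: "('e \<Rightarrow> bool) pmf" where "\<Omega> = Pi_pmf Es False (\<lambda>_. bernoulli_pmf p)"

abbreviation \<E> :: "(('e \<Rightarrow> bool) \<Rightarrow> real) \<Rightarrow> real" where
  "\<E> f \<equiv> measure_pmf.expectation \<Omega> f"

definition \<xi> :: "('e \<Rightarrow> bool) \<Rightarrow> 'e \<Rightarrow> real" where "\<xi> h e = of_bool (h e) - p"

definition M :: "('e \<Rightarrow> bool) \<Rightarrow> 'v \<Rightarrow> 'v \<Rightarrow> real" where
  "M h S T = (\<Sum>e\<in>Es. A e S T * \<xi> h e)"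

fun walk :: "'v \<Rightarrow> ('e \<times> 'v) list \<Rightarrow> 'v \<Rightarrow> real" where
  "walk S [] T = of_bool (S = T)"
| "walk S ((e, U) # xs) T = A e S U * walk U xs T"

text \<open>A walk with free end point. It replaces \<open>walk\<close> in upper bounds, which do
  not exploit that a walk closes up and can therefore be summed one step at a time.\<close>

fun steps :: "'v \<Rightarrow> ('e \<times> 'v) list \<Rightarrow> real" where
  "steps S [] = 1"
| "steps S ((e, U) # xs) = A e S U * steps U xs"

definition words :: "nat \<Rightarrow> ('e \<times> 'v) list set" where
  "words k = {xs. set xs \<subseteq> Es \<times> V \<and> length xs = k}"

abbreviation edges :: "('e \<times> 'v) list \<Rightarrow> 'e list" where "edges xs \<equiv> map fst xs"

lemma D_pos: "0 < D"
proof (rule ccontr)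
  assume "\<not> 0 < D"
  then have "p * (1 - p) * D \<le> 0"
    using p_nonneg p_le_1 by (intro mult_nonneg_nonpos) auto
  then show False using one_le_rho by linarith
qed

lemma rho_ge_1: "1 \<le> \<rho>" using one_le_rho by (simp add: \<rho>_def)

lemma A_nonneg: "0 \<le> A e S T" using A_01[of e S T] by auto

lemma A_le_1: "A e S T \<le> 1" using A_01[of e S T] by auto

lemma integrable_\<Omega> [simp]: "integrable \<Omega> (f :: _ \<Rightarrow> real)"
proof (rule integrable_measure_pmf_finite)
  show "finite (set_pmf \<Omega>)"
    unfolding \<Omega>_def using finite_Es by (subst set_Pi_pmf) auto
qed

lemma E_prod_\<xi>:
  assumes "set es \<subseteq> Es"
  shows "\<E> (\<lambda>h. prod_list (map (\<xi> h) es)) = edge_weight p es"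
proof -
  have "\<E> (\<lambda>h. prod_list (map (\<xi> h) es)) =
      \<E> (\<lambda>h. \<Prod>e\<in>Es. (\<lambda>b. (of_bool b - p) ^ count_list es e) (h e))"
    by (simp add: prod_list_map_eq_prod_count[OF finite_Es assms] \<xi>_def)
  also have "\<dots> = (\<Prod>e\<in>Es. measure_pmf.expectation (bernoulli_pmf p)
      (\<lambda>b. (of_bool b - p) ^ count_list es e))"
    unfolding \<Omega>_def by (intro expectation_prod_Pi_pmf_finite finite_Es) auto
  also have "\<dots> = (\<Prod>e\<in>Es. bmoment p (count_list es e))"
    using p_nonneg p_le_1 by (intro prod.cong refl) (simp add: bmoment_def)
  finally show ?thesis
    using edge_weight_eq_prod[OF finite_Es assms] by simp
qed

lemma finite_words [simp]: "finite (words k)"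
  unfolding words_def using finite_V finite_Es by (intro finite_lists_length_eq) auto

lemma words_0 [simp]: "words 0 = {[]}" by (auto simp: words_def)

lemma sum_words_Suc:
  fixes f :: "('e \<times> 'v) list \<Rightarrow> real"
  shows "(\<Sum>xs\<in>words (Suc k). f xs) = (\<Sum>e\<in>Es. \<Sum>U\<in>V. \<Sum>xs\<in>words k. f ((e, U) # xs))"
proof -
  have "words (Suc k) = (\<lambda>(x, xs). x # xs) ` ((Es \<times> V) \<times> words k)"
    by (auto simp: words_def length_Suc_conv image_iff)
  then have "(\<Sum>xs\<in>words (Suc k). f xs) = (\<Sum>(x, xs)\<in>(Es \<times> V) \<times> words k. f (x # xs))"
    by (auto intro: sum.reindex_cong[where l = "\<lambda>(x, xs). x # xs"] simp: inj_on_def)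
  also have "\<dots> = (\<Sum>x\<in>Es \<times> V. \<Sum>xs\<in>words k. f (x # xs))"
    by (simp add: sum.cartesian_product)
  also have "\<dots> = (\<Sum>e\<in>Es. \<Sum>U\<in>V. \<Sum>xs\<in>words k. f ((e, U) # xs))"
    using sum.cartesian_product[of "\<lambda>e U. \<Sum>xs\<in>words k. f ((e, U) # xs)" V Es] by simp
  finally show ?thesis .
qed

lemma sum_words_add:
  fixes f :: "('e \<times> 'v) list \<Rightarrow> real"
  shows "(\<Sum>xs\<in>words (i + j). f xs) = (\<Sum>xs\<in>words i. \<Sum>ys\<in>words j. f (xs @ ys))"
proof (induction i arbitrary: f)
  case (Suc i)
  have "(\<Sum>xs\<in>words (Suc i + j). f xs) = (\<Sum>e\<in>Es. \<Sum>U\<in>V. \<Sum>xs\<in>words (i + j). f ((e, U) # xs))"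
    by (simp add: sum_words_Suc)
  also have "\<dots> = (\<Sum>e\<in>Es. \<Sum>U\<in>V. \<Sum>xs\<in>words i. \<Sum>ys\<in>words j. f ((e, U) # xs @ ys))"
    by (simp add: Suc.IH)
  also have "\<dots> = (\<Sum>xs\<in>words (Suc i). \<Sum>ys\<in>words j. f (xs @ ys))"
    by (simp add: sum_words_Suc)
  finally show ?case .
qed simp

lemma walk_nonneg: "0 \<le> walk S xs T"
  by (induction S xs T rule: walk.induct) (auto simp: A_nonneg)

lemma walk_le_steps: "walk S xs T \<le> steps S xs"
  by (induction S xs T rule: walk.induct) (auto simp: A_nonneg mult_left_mono)

lemma walk_append:
  assumes "S \<in> V" "set xs \<subseteq> Es \<times> V"
  shows "walk S (xs @ ys) T = (\<Sum>R\<in>V. walk S xs R * walk R ys T)"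
  using assms
proof (induction xs arbitrary: S)
  case Nil
  then show ?case
    using finite_V by (simp add: of_bool_def if_distrib[of "\<lambda>x. x * _"] cong: if_cong)
next
  case (Cons x xs)
  obtain e U where x: "x = (e, U)" by fastforce
  show ?case
    using Cons by (simp add: x sum_distrib_left mult.assoc)
qed

lemma mpow_M:
  assumes "S \<in> V"
  shows "mpow V (M h) k S T = (\<Sum>xs\<in>words k. walk S xs T * prod_list (map (\<xi> h) (edges xs)))"
  using assms
proof (induction k arbitrary: S)
  case (Suc k)
  have "mpow V (M h) (Suc k) S T = (\<Sum>U\<in>V. \<Sum>e\<in>Es. A e S U * \<xi> h e * mpow V (M h) k U T)"
    by (simp add: M_def sum_distrib_right)
  also have "\<dots> = (\<Sum>e\<in>Es. \<Sum>U\<in>V. A e S U * \<xi> h e * mpow V (M h) k U T)"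
    by (rule sum.swap)
  also have "\<dots> = (\<Sum>xs\<in>words (Suc k). walk S xs T * prod_list (map (\<xi> h) (edges xs)))"
    unfolding sum_words_Suc using Suc.IH
    by (intro sum.cong refl) (simp add: sum_distrib_left mult_ac)
  finally show ?case .
qed simp

lemma E_mpow_mult:
  assumes "S \<in> V" "T \<in> V"
  shows "\<E> (\<lambda>h. mpow V (M h) i S S' * mpow V (M h) j T T') =
    (\<Sum>xs\<in>words i. \<Sum>ys\<in>words j. walk S xs S' * walk T ys T' * edge_weight p (edges (xs @ ys)))"
proof -
  have "\<E> (\<lambda>h. mpow V (M h) i S S' * mpow V (M h) j T T') =
      \<E> (\<lambda>h. \<Sum>xs\<in>words i. \<Sum>ys\<in>words j.
        walk S xs S' * walk T ys T' * prod_list (map (\<xi> h) (edges (xs @ ys))))"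
    by (simp add: mpow_M assms sum_product mult_ac)
  also have "\<dots> = (\<Sum>xs\<in>words i. \<Sum>ys\<in>words j.
        walk S xs S' * walk T ys T' * \<E> (\<lambda>h. prod_list (map (\<xi> h) (edges (xs @ ys)))))"
    by (simp add: Bochner_Integration.integral_sum del: prod_list.append map_append)
  also have "\<dots> = (\<Sum>xs\<in>words i. \<Sum>ys\<in>words j. walk S xs S' * walk T ys T' * edge_weight p (edges (xs @ ys)))"
    by (intro sum.cong refl arg_cong2[of _ _ _ _ "(*)"] E_prod_\<xi>) (auto simp: words_def)
  finally show ?thesis .
qed

lemma E_mpow:
  assumes "S \<in> V"
  shows "\<E> (\<lambda>h. mpow V (M h) k S T) = (\<Sum>xs\<in>words k. walk S xs T * edge_weight p (edges xs))"
proof -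
  have "\<E> (\<lambda>h. mpow V (M h) k S T) =
      (\<Sum>xs\<in>words k. walk S xs T * \<E> (\<lambda>h. prod_list (map (\<xi> h) (edges xs))))"
    by (simp add: mpow_M assms Bochner_Integration.integral_sum)
  also have "\<dots> = (\<Sum>xs\<in>words k. walk S xs T * edge_weight p (edges xs))"
    by (intro sum.cong refl arg_cong2[of _ _ _ _ "(*)"] E_prod_\<xi>) (auto simp: words_def)
  finally show ?thesis .
qed

text \<open>
  Every edge not seen before costs a factor \<open>1 / D\<close>, which pays for the at most \<open>D\<close> choices
  of an edge at the current vertex; an edge seen before is one of boundedly many.
\<close>

lemma sum_steps_le:
  assumes "S \<in> V" "finite F" "card F + k \<le> m"
  shows "(\<Sum>xs\<in>words k. steps S xs * inverse D ^ card (set (edges xs) - F)) \<le> (real B * (real m + 1)) ^ k"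
  using assms
\<comment> \<open>\<open>F\<close> collects the edges seen so far. It grows by at most one element
  per step, so \<open>card F + k \<le> m\<close> is preserved and \<open>m\<close> bounds the number
  of old edges throughout.\<close>
proof (induction k arbitrary: S F)
  case (Suc k)
  let ?K = "(real B * (real m + 1)) ^ k"
  let ?d = "\<lambda>e. if e \<in> F then 1 else inverse D"
  have "(\<Sum>xs\<in>words (Suc k). steps S xs * inverse D ^ card (set (edges xs) - F)) =
      (\<Sum>e\<in>Es. \<Sum>U\<in>V. A e S U * ?d e *
        (\<Sum>xs\<in>words k. steps U xs * inverse D ^ card (set (edges xs) - insert e F)))"
    unfolding sum_words_Suc sum_distrib_left
  proof (intro sum.cong refl)
    fix e U xs assume "e \<in> Es" "U \<in> V" "xs \<in> words k"
    let ?X = "set (edges xs) - insert e F"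
    have eq: "set (edges ((e, U) # xs)) - F = (if e \<in> F then ?X else insert e ?X)"
      by auto
    have "inverse D ^ card (set (edges ((e, U) # xs)) - F) = ?d e * inverse D ^ card ?X"
      unfolding eq by (subst card_insert_disjoint | simp)+
    then show "steps S ((e, U) # xs) * inverse D ^ card (set (edges ((e, U) # xs)) - F) =
        A e S U * ?d e * (steps U xs * inverse D ^ card ?X)"
      by simp
  qed
  also have "\<dots> \<le> (\<Sum>e\<in>Es. \<Sum>U\<in>V. A e S U * ?d e * ?K)"
  proof (intro sum_mono mult_left_mono)
    fix e U assume "U \<in> V"
    then show "(\<Sum>xs\<in>words k. steps U xs * inverse D ^ card (set (edges xs) - insert e F)) \<le> ?K"
      using Suc.prems by (intro Suc.IH) (auto simp: card_insert_if)
  qed (auto simp: A_nonneg D_pos less_imp_le)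
  also have "\<dots> \<le> (\<Sum>e\<in>Es. of_bool (inc S e) * (real B * ?d e * ?K))"
  proof (rule sum_mono)
    fix e assume e: "e \<in> Es"
    have "(\<Sum>U\<in>V. A e S U) \<le> (\<Sum>U\<in>V. of_bool (inc S e) * of_bool (inc U e))"
    proof (rule sum_mono)
      fix U show "A e S U \<le> of_bool (inc S e) * of_bool (inc U e)"
        using A_inc[of e S U] A_le_1[of e S U] by (cases "A e S U = 0") auto
    qed
    also have "\<dots> = of_bool (inc S e) * real (card {U \<in> V. inc U e})"
      using finite_V by (simp add: sum_distrib_left[symmetric] of_bool_def sum.If_cases Int_def)
    also have "\<dots> \<le> of_bool (inc S e) * real B"
      using card_vertices_of_edge[OF e] by (intro mult_left_mono) auto
    finally have "(\<Sum>U\<in>V. A e S U) * (?d e * ?K) \<le> of_bool (inc S e) * real B * (?d e * ?K)"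
      using D_pos by (intro mult_right_mono) (auto simp: less_imp_le)
    then show "(\<Sum>U\<in>V. A e S U * ?d e * ?K) \<le> of_bool (inc S e) * (real B * ?d e * ?K)"
      by (simp add: sum_distrib_right mult_ac)
  qed
  also have "\<dots> = real B * ?K * (\<Sum>e\<in>Es. of_bool (inc S e) * ?d e)"
    by (simp add: sum_distrib_left mult_ac)
  also have "\<dots> \<le> real B * ?K * (real m + 1)"
  proof (rule mult_left_mono)
    have "(\<Sum>e\<in>Es. of_bool (inc S e) * ?d e) \<le>
        (\<Sum>e\<in>Es. of_bool (e \<in> F) + inverse D * of_bool (inc S e))"
      using D_pos by (intro sum_mono) auto
    also have "\<dots> = real (card {e \<in> Es. e \<in> F}) + inverse D * real (card {e \<in> Es. inc S e})"
      using finite_Es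
      by (simp add: sum.distrib sum_distrib_left[symmetric] of_bool_def sum.If_cases Int_def)
    also have "\<dots> \<le> real m + inverse D * D"
    proof (intro add_mono mult_left_mono card_edges_of_vertex)
      have "card {e \<in> Es. e \<in> F} \<le> card F"
        using Suc.prems by (intro card_mono) auto
      then show "real (card {e \<in> Es. e \<in> F}) \<le> real m"
        using Suc.prems by simp
    qed (use Suc.prems D_pos in auto)
    finally show "(\<Sum>e\<in>Es. of_bool (inc S e) * ?d e) \<le> real m + 1"
      using D_pos by simp
  qed auto
  finally show ?case
    by (simp add: mult_ac)
qed simp

end

section \<open>Expected traces and the pairing of the first edge\<close>

lemma sum_reorder4:
  fixes f :: "'a \<Rightarrow> 'b \<Rightarrow> 'c \<Rightarrow> 'd \<Rightarrow> real"
  shows "(\<Sum>a\<in>A. \<Sum>b\<in>B. \<Sum>c\<in>C. \<Sum>d\<in>D. f a b c d) = (\<Sum>d\<in>D. \<Sum>b\<in>B. \<Sum>a\<in>A. \<Sum>c\<in>C. f a b c d)"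
proof -
  have "(\<Sum>a\<in>A. \<Sum>b\<in>B. \<Sum>c\<in>C. \<Sum>d\<in>D. f a b c d) = (\<Sum>a\<in>A. \<Sum>b\<in>B. \<Sum>d\<in>D. \<Sum>c\<in>C. f a b c d)"
    by (intro sum.cong refl sum.swap)
  also have "\<dots> = (\<Sum>a\<in>A. \<Sum>d\<in>D. \<Sum>b\<in>B. \<Sum>c\<in>C. f a b c d)"
    by (intro sum.cong refl sum.swap)
  also have "\<dots> = (\<Sum>d\<in>D. \<Sum>a\<in>A. \<Sum>b\<in>B. \<Sum>c\<in>C. f a b c d)"
    by (rule sum.swap)
  also have "\<dots> = (\<Sum>d\<in>D. \<Sum>b\<in>B. \<Sum>a\<in>A. \<Sum>c\<in>C. f a b c d)"
    by (intro sum.cong refl sum.swap)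
  finally show ?thesis .
qed

context random_edge_matrix
begin

text \<open>Written out, this is the sum over \<open>e\<close> of the trace of
  \<open>A e * X * A e * Y\<close>.\<close>

definition edge_form :: "('v \<Rightarrow> 'v \<Rightarrow> real) \<Rightarrow> ('v \<Rightarrow> 'v \<Rightarrow> real) \<Rightarrow> real" where
  "edge_form X Y =
     (\<Sum>e\<in>Es. \<Sum>S\<in>V. \<Sum>U\<in>V. \<Sum>T\<in>V. \<Sum>R\<in>V. A e S U * A e T R * (X U T * Y R S))"

text \<open>The constant of \<open>sum_steps_le\<close> for \<open>F = {}\<close> and
  \<open>m = k\<close>. It depends on \<open>B\<close> and \<open>k\<close> only.\<close>

definition walk_bound :: "nat \<Rightarrow> real" where
  "walk_bound k = (real B * (real k + 1)) ^ k"

abbreviation N :: real where "N \<equiv> real (card V)"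

lemma walk_bound_nonneg: "0 \<le> walk_bound k" by (simp add: walk_bound_def)

text \<open>Each starting vertex contributes a bounded amount once the closing condition is dropped,
  so the start accounts for the only factor \<open>N\<close>.\<close>

lemma sum_closed_walks_le:
  "(\<Sum>S\<in>V. \<Sum>xs\<in>words k. walk S xs S * inverse D ^ card (set (edges xs))) \<le> N * walk_bound k"
proof -
  have "(\<Sum>xs\<in>words k. walk S xs S * inverse D ^ card (set (edges xs))) \<le> walk_bound k" if "S \<in> V" for S
  proof -
    have "(\<Sum>xs\<in>words k. walk S xs S * inverse D ^ card (set (edges xs)))
        \<le> (\<Sum>xs\<in>words k. steps S xs * inverse D ^ card (set (edges xs) - {}))"
      using D_pos by (intro sum_mono) (auto intro!: mult_right_mono walk_le_steps)
    also have "\<dots> \<le> walk_bound k"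
      unfolding walk_bound_def by (intro sum_steps_le that) auto
    finally show ?thesis .
  qed
  then have "(\<Sum>S\<in>V. \<Sum>xs\<in>words k. walk S xs S * inverse D ^ card (set (edges xs))) \<le> (\<Sum>S\<in>V. walk_bound k)"
    by (rule sum_mono)
  then show ?thesis by simp
qed

lemma E_mtrace_mpow:
  "\<E> (\<lambda>h. mtrace V (mpow V (M h) k)) = (\<Sum>S\<in>V. \<Sum>xs\<in>words k. walk S xs S * edge_weight p (edges xs))"
  by (simp add: mtrace_def Bochner_Integration.integral_sum E_mpow)

lemma abs_edge_weight_le_rho:
  "\<bar>edge_weight p es\<bar> \<le> sqrt \<rho> ^ length es * inverse D ^ card (set es)"
proof (cases "edge_weight p es = 0")
  case True
  then show ?thesis using D_pos rho_ge_1 by simp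
next
  case False
  have "\<bar>edge_weight p es\<bar> \<le> (p * (1 - p)) ^ card (set es)"
    using p_nonneg p_le_1 by (rule abs_edge_weight_le)
  also have "\<dots> \<le> sqrt \<rho> ^ length es * inverse D ^ card (set es)"
    using D_pos rho_ge_1 card_le_of_edge_weight[OF False] by (intro scaled_power_le) (auto simp: \<rho>_def)
  finally show ?thesis .
qed

lemma abs_E_mtrace_mpow_le:
  "\<bar>\<E> (\<lambda>h. mtrace V (mpow V (M h) k))\<bar> \<le> sqrt \<rho> ^ k * (N * walk_bound k)"
proof -
  have "\<bar>\<E> (\<lambda>h. mtrace V (mpow V (M h) k))\<bar>
      \<le> (\<Sum>S\<in>V. \<Sum>xs\<in>words k. \<bar>walk S xs S * edge_weight p (edges xs)\<bar>)"
    unfolding E_mtrace_mpow by (intro order_trans[OF sum_abs] sum_mono order_refl)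
  also have "\<dots> \<le> (\<Sum>S\<in>V. \<Sum>xs\<in>words k. sqrt \<rho> ^ k * (walk S xs S * inverse D ^ card (set (edges xs))))"
  proof (intro sum_mono)
    fix S xs assume "xs \<in> words k"
    then have "length (edges xs) = k" by (simp add: words_def)
    then show "\<bar>walk S xs S * edge_weight p (edges xs)\<bar>
        \<le> sqrt \<rho> ^ k * (walk S xs S * inverse D ^ card (set (edges xs)))"
      using mult_left_mono[OF abs_edge_weight_le_rho[of "edges xs"] walk_nonneg[of S xs S]]
      by (simp add: abs_mult walk_nonneg mult_ac)
  qed
  also have "\<dots> = sqrt \<rho> ^ k * (\<Sum>S\<in>V. \<Sum>xs\<in>words k. walk S xs S * inverse D ^ card (set (edges xs)))"
    by (simp add: sum_distrib_left)
  also have "\<dots> \<le> sqrt \<rho> ^ k * (N * walk_bound k)"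
    using rho_ge_1 by (intro mult_left_mono sum_closed_walks_le) auto
  finally show ?thesis .
qed

lemma E_edge_form:
  "\<E> (\<lambda>h. edge_form (mpow V (M h) i) (mpow V (M h) j)) =
    (\<Sum>e\<in>Es. \<Sum>S\<in>V. \<Sum>U\<in>V. \<Sum>T\<in>V. \<Sum>R\<in>V. \<Sum>ys\<in>words i. \<Sum>zs\<in>words j.
      A e S U * A e T R * (walk U ys T * walk R zs S * edge_weight p (edges (ys @ zs))))"
proof -
  have "\<E> (\<lambda>h. edge_form (mpow V (M h) i) (mpow V (M h) j)) =
    (\<Sum>e\<in>Es. \<Sum>S\<in>V. \<Sum>U\<in>V. \<Sum>T\<in>V. \<Sum>R\<in>V.
      A e S U * A e T R * \<E> (\<lambda>h. mpow V (M h) i U T * mpow V (M h) j R S))"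
    by (simp add: edge_form_def Bochner_Integration.integral_sum)
  also have "\<dots> = (\<Sum>e\<in>Es. \<Sum>S\<in>V. \<Sum>U\<in>V. \<Sum>T\<in>V. \<Sum>R\<in>V. \<Sum>ys\<in>words i. \<Sum>zs\<in>words j.
      A e S U * A e T R * (walk U ys T * walk R zs S * edge_weight p (edges (ys @ zs))))"
    by (intro sum.cong refl) (simp add: E_mpow_mult sum_distrib_left)
  finally show ?thesis .
qed

text \<open>
  If the first edge is paired with step \<open>i\<close> of the remaining walk, the walk splits there into a walk
  of length \<open>i\<close> and one of length \<open>j\<close>, and the two paired edges turn into the form.
\<close>

lemma sum_paired_walks:
  "(\<Sum>S\<in>V. \<Sum>e\<in>Es. \<Sum>U\<in>V. \<Sum>xs\<in>words (i + Suc j). A e S U * walk U xs S *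
      (of_bool (edges xs ! i = e) * edge_weight p (take i (edges xs) @ drop (Suc i) (edges xs)))) =
    \<E> (\<lambda>h. edge_form (mpow V (M h) i) (mpow V (M h) j))" (is "?lhs = _")
proof -
  let ?w = "\<lambda>ys zs. edge_weight p (edges (ys @ zs))"
  have inner: "(\<Sum>xs\<in>words (i + Suc j). A e S U * walk U xs S *
      (of_bool (edges xs ! i = e) * edge_weight p (take i (edges xs) @ drop (Suc i) (edges xs)))) =
      (\<Sum>T\<in>V. \<Sum>R\<in>V. \<Sum>ys\<in>words i. \<Sum>zs\<in>words j.
        A e S U * A e T R * (walk U ys T * walk R zs S * ?w ys zs))" (is "?l = ?r")
    if "U \<in> V" "e \<in> Es" for S U e
  proof -
    have "?l = (\<Sum>ys\<in>words i. \<Sum>e'\<in>Es. \<Sum>R\<in>V. \<Sum>zs\<in>words j.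
        A e S U * walk U (ys @ (e', R) # zs) S * (of_bool (e' = e) * ?w ys zs))"
      unfolding sum_words_add sum_words_Suc
      by (intro sum.cong refl) (auto simp: words_def nth_append)
    also have "\<dots> = (\<Sum>ys\<in>words i. \<Sum>e'\<in>Es. if e' = e then (\<Sum>R\<in>V. \<Sum>zs\<in>words j.
        A e S U * walk U (ys @ (e, R) # zs) S * ?w ys zs) else 0)"
      by (intro sum.cong refl) auto
    also have "\<dots> = (\<Sum>ys\<in>words i. \<Sum>R\<in>V. \<Sum>zs\<in>words j.
        A e S U * walk U (ys @ (e, R) # zs) S * ?w ys zs)"
      using finite_Es that by simp
    \<comment> \<open>\<open>T\<close> is the vertex before the paired step and \<open>R\<close> the
      one after it; \<open>T\<close> is not a letter of its own in the word and has to be introduced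
      by \<open>walk_append\<close>.\<close>
    also have "\<dots> = (\<Sum>ys\<in>words i. \<Sum>R\<in>V. \<Sum>zs\<in>words j. \<Sum>T\<in>V.
        A e S U * A e T R * (walk U ys T * walk R zs S * ?w ys zs))"
    proof (intro sum.cong refl)
      fix ys R zs assume "ys \<in> words i"
      then have "walk U (ys @ (e, R) # zs) S = (\<Sum>T\<in>V. walk U ys T * walk T ((e, R) # zs) S)"
        using that by (intro walk_append) (auto simp: words_def)
      then show "A e S U * walk U (ys @ (e, R) # zs) S * ?w ys zs =
          (\<Sum>T\<in>V. A e S U * A e T R * (walk U ys T * walk R zs S * ?w ys zs))"
        by (simp add: sum_distrib_left sum_distrib_right mult_ac)
    qed
    also have "\<dots> = ?r"
      by (rule sum_reorder4)
    finally show ?thesis .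
  qed
  have "?lhs = (\<Sum>S\<in>V. \<Sum>e\<in>Es. \<Sum>U\<in>V. \<Sum>T\<in>V. \<Sum>R\<in>V. \<Sum>ys\<in>words i. \<Sum>zs\<in>words j.
        A e S U * A e T R * (walk U ys T * walk R zs S * ?w ys zs))"
    by (intro sum.cong refl inner)
  also have "\<dots> = \<E> (\<lambda>h. edge_form (mpow V (M h) i) (mpow V (M h) j))"
    unfolding E_edge_form by (rule sum.swap)
  finally show ?thesis .
qed

text \<open>This sums \<open>edge_weight_Cons_approx\<close> over all closed walks. The error
  carries \<open>sqrt \<rho> ^ Suc k\<close>, one power below the natural size of the trace, and so
  becomes \<open>O(1 / sqrt \<rho>)\<close> after normalisation.\<close>

lemma E_mtrace_expansion:
  "\<bar>\<E> (\<lambda>h. mtrace V (mpow V (M h) (Suc (Suc k)))) -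
      p * (1 - p) * (\<Sum>i\<le>k. \<E> (\<lambda>h. edge_form (mpow V (M h) i) (mpow V (M h) (k - i))))\<bar>
    \<le> real (k + 2) * sqrt \<rho> ^ Suc k * (N * walk_bound (Suc (Suc k)))"
proof -
  let ?v = "p * (1 - p)"
  let ?del = "\<lambda>i es. take i es @ drop (Suc i) es"
  let ?main = "\<lambda>e es. (\<Sum>i<length es. of_bool (es ! i = e) * (?v * edge_weight p (?del i es)))"
  let ?mainK = "\<lambda>e xs. (\<Sum>i\<le>k. of_bool (edges xs ! i = e) * (?v * edge_weight p (?del i (edges xs))))"
  have main: "?mainK e xs = ?main e (edges xs)" if "xs \<in> words (Suc k)" for e xs
    using that by (simp add: words_def lessThan_Suc_atMost)
  have form: "\<E> (\<lambda>h. edge_form (mpow V (M h) i) (mpow V (M h) (k - i))) =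
      (\<Sum>S\<in>V. \<Sum>e\<in>Es. \<Sum>U\<in>V. \<Sum>xs\<in>words (Suc k). A e S U * walk U xs S *
      (of_bool (edges xs ! i = e) * edge_weight p (?del i (edges xs))))" if "i \<le> k" for i
    using sum_paired_walks[of i "k - i"] that by simp
  have "?v * (\<Sum>i\<le>k. \<E> (\<lambda>h. edge_form (mpow V (M h) i) (mpow V (M h) (k - i)))) =
      (\<Sum>i\<le>k. \<Sum>S\<in>V. \<Sum>e\<in>Es. \<Sum>U\<in>V. \<Sum>xs\<in>words (Suc k). A e S U * walk U xs S *
      (of_bool (edges xs ! i = e) * (?v * edge_weight p (?del i (edges xs)))))"
    by (simp add: form sum_distrib_left mult_ac)
  also have "\<dots> = (\<Sum>S\<in>V. \<Sum>i\<le>k. \<Sum>e\<in>Es. \<Sum>U\<in>V. \<Sum>xs\<in>words (Suc k). A e S U * walk U xs S *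
      (of_bool (edges xs ! i = e) * (?v * edge_weight p (?del i (edges xs)))))"
    by (rule sum.swap)
  also have "\<dots> = (\<Sum>S\<in>V. \<Sum>e\<in>Es. \<Sum>i\<le>k. \<Sum>U\<in>V. \<Sum>xs\<in>words (Suc k). A e S U * walk U xs S *
      (of_bool (edges xs ! i = e) * (?v * edge_weight p (?del i (edges xs)))))"
    by (intro sum.cong refl sum.swap)
  also have "\<dots> = (\<Sum>S\<in>V. \<Sum>e\<in>Es. \<Sum>U\<in>V. \<Sum>i\<le>k. \<Sum>xs\<in>words (Suc k). A e S U * walk U xs S *
      (of_bool (edges xs ! i = e) * (?v * edge_weight p (?del i (edges xs)))))"
    by (intro sum.cong refl sum.swap)
  also have "\<dots> = (\<Sum>S\<in>V. \<Sum>e\<in>Es. \<Sum>U\<in>V. \<Sum>xs\<in>words (Suc k). \<Sum>i\<le>k. A e S U * walk U xs S *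
      (of_bool (edges xs ! i = e) * (?v * edge_weight p (?del i (edges xs)))))"
    by (intro sum.cong refl sum.swap)
  also have "\<dots> = (\<Sum>S\<in>V. \<Sum>e\<in>Es. \<Sum>U\<in>V. \<Sum>xs\<in>words (Suc k). A e S U * walk U xs S * ?main e (edges xs))"
    by (intro sum.cong refl) (simp only: main[symmetric] sum_distrib_left)
  finally have forms: "?v * (\<Sum>i\<le>k. \<E> (\<lambda>h. edge_form (mpow V (M h) i) (mpow V (M h) (k - i)))) =
      (\<Sum>S\<in>V. \<Sum>e\<in>Es. \<Sum>U\<in>V. \<Sum>xs\<in>words (Suc k). A e S U * walk U xs S * ?main e (edges xs))" .
  have trace: "\<E> (\<lambda>h. mtrace V (mpow V (M h) (Suc (Suc k)))) =
      (\<Sum>S\<in>V. \<Sum>e\<in>Es. \<Sum>U\<in>V. \<Sum>xs\<in>words (Suc k). A e S U * walk U xs S * edge_weight p (e # edges xs))"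
    unfolding E_mtrace_mpow sum_words_Suc[of _ "Suc k"] by simp
  have "\<bar>\<E> (\<lambda>h. mtrace V (mpow V (M h) (Suc (Suc k)))) -
      ?v * (\<Sum>i\<le>k. \<E> (\<lambda>h. edge_form (mpow V (M h) i) (mpow V (M h) (k - i))))\<bar> =
      \<bar>\<Sum>S\<in>V. \<Sum>e\<in>Es. \<Sum>U\<in>V. \<Sum>xs\<in>words (Suc k). A e S U * walk U xs S *
        (edge_weight p (e # edges xs) - ?main e (edges xs))\<bar>"
    unfolding forms trace by (simp only: sum_subtractf right_diff_distrib)
  also have "\<dots> \<le> (\<Sum>S\<in>V. \<Sum>e\<in>Es. \<Sum>U\<in>V. \<Sum>xs\<in>words (Suc k). \<bar>A e S U * walk U xs S *
        (edge_weight p (e # edges xs) - ?main e (edges xs))\<bar>)"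
    by (intro order_trans[OF sum_abs] sum_mono) simp
  also have "\<dots> \<le> (\<Sum>S\<in>V. \<Sum>e\<in>Es. \<Sum>U\<in>V. \<Sum>xs\<in>words (Suc k).
      real (k + 2) * sqrt \<rho> ^ Suc k * (walk S ((e, U) # xs) S * inverse D ^ card (set (edges ((e, U) # xs)))))"
  proof (intro sum_mono)
    fix S e U xs assume xs: "xs \<in> words (Suc k)"
    then have len: "length (edges xs) = Suc k" by (simp add: words_def)
    have "\<bar>edge_weight p (e # edges xs) - ?main e (edges xs)\<bar>
        \<le> real (k + 2) * (sqrt \<rho> ^ Suc k * inverse D ^ card (set (e # edges xs)))"
      using edge_weight_Cons_approx[OF p_nonneg p_le_1 D_pos \<rho>_def rho_ge_1, of e "edges xs"]
      unfolding len by simp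
    from mult_left_mono[OF this, of "A e S U * walk U xs S"]
    show "\<bar>A e S U * walk U xs S * (edge_weight p (e # edges xs) - ?main e (edges xs))\<bar>
        \<le> real (k + 2) * sqrt \<rho> ^ Suc k *
          (walk S ((e, U) # xs) S * inverse D ^ card (set (edges ((e, U) # xs))))"
      by (simp add: abs_mult walk_nonneg A_nonneg mult_ac)
  qed
  also have "\<dots> = real (k + 2) * sqrt \<rho> ^ Suc k *
      (\<Sum>S\<in>V. \<Sum>xs\<in>words (Suc (Suc k)). walk S xs S * inverse D ^ card (set (edges xs)))"
    unfolding sum_words_Suc[of _ "Suc k"] by (simp only: sum_distrib_left)
  also have "\<dots> \<le> real (k + 2) * sqrt \<rho> ^ Suc k * (N * walk_bound (Suc (Suc k)))"
    using rho_ge_1 by (intro mult_left_mono sum_closed_walks_le) auto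
  finally show ?thesis .
qed

end

section \<open>Covariances of traces\<close>

context random_edge_matrix
begin

lemma sum_A_le:
  assumes "e \<in> Es"
  shows "(\<Sum>S\<in>V. \<Sum>T\<in>V. A e S T) \<le> real B ^ 2"
proof -
  let ?I = "\<Sum>S\<in>V. of_bool (inc S e) :: real"
  have "?I = real (card {S \<in> V. inc S e})"
    using finite_V by (simp add: of_bool_def sum.If_cases Int_def)
  then have I: "?I \<le> real B" "0 \<le> ?I"
    using card_vertices_of_edge[OF assms] by auto
  have "A e S T \<le> of_bool (inc S e) * of_bool (inc T e)" for S T
    using A_inc[of e S T] A_le_1[of e S T] by (cases "A e S T = 0") auto
  then have "(\<Sum>S\<in>V. \<Sum>T\<in>V. A e S T) \<le> (\<Sum>S\<in>V. \<Sum>T\<in>V. of_bool (inc S e) * of_bool (inc T e))"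
    by (intro sum_mono)
  also have "\<dots> = ?I * ?I" by (simp only: sum_product)
  also have "\<dots> \<le> real B * real B" using I by (intro mult_mono) auto
  finally show ?thesis by (simp add: power2_eq_square)
qed

text \<open>This is cyclicity of the trace for single walks: cutting the word before position
  \<open>b\<close> and exchanging the two pieces moves the starting point, while \<open>g\<close>
  sees only the set of letters.\<close>

lemma sum_closed_walks_rotate:
  assumes "b < l"
  shows "(\<Sum>T\<in>V. \<Sum>ys\<in>words l. walk T ys T * (of_bool (edges ys ! b \<in> F) * g (set ys))) =
         (\<Sum>T\<in>V. \<Sum>ys\<in>words l. walk T ys T * (of_bool (edges ys ! 0 \<in> F) * g (set ys)))"
proof -
  obtain j where l: "l = b + Suc j"
    using assms less_iff_Suc_add by auto
  have cyc: "(\<Sum>T\<in>V. walk T (us @ zs) T) = (\<Sum>T\<in>V. walk T (zs @ us) T)"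
    if "us \<in> words b" "zs \<in> words (Suc j)" for us zs
  proof -
    have "(\<Sum>T\<in>V. walk T (us @ zs) T) = (\<Sum>T\<in>V. \<Sum>R\<in>V. walk T us R * walk R zs T)"
      using that by (intro sum.cong refl walk_append) (auto simp: words_def)
    also have "\<dots> = (\<Sum>R\<in>V. \<Sum>T\<in>V. walk R zs T * walk T us R)"
      by (subst sum.swap) (simp add: mult.commute)
    also have "\<dots> = (\<Sum>R\<in>V. walk R (zs @ us) R)"
      using that by (intro sum.cong refl walk_append[symmetric]) (auto simp: words_def)
    finally show ?thesis .
  qed
  have "(\<Sum>T\<in>V. \<Sum>ys\<in>words l. walk T ys T * (of_bool (edges ys ! b \<in> F) * g (set ys))) =
      (\<Sum>ys\<in>words l. (\<Sum>T\<in>V. walk T ys T) * (of_bool (edges ys ! b \<in> F) * g (set ys)))"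
    by (subst sum.swap) (simp add: sum_distrib_right)
  also have "\<dots> = (\<Sum>us\<in>words b. \<Sum>zs\<in>words (Suc j). (\<Sum>T\<in>V. walk T (us @ zs) T) *
      (of_bool (edges (us @ zs) ! b \<in> F) * g (set (us @ zs))))"
    unfolding l sum_words_add ..
  also have "\<dots> = (\<Sum>us\<in>words b. \<Sum>zs\<in>words (Suc j). (\<Sum>T\<in>V. walk T (zs @ us) T) *
      (of_bool (edges (zs @ us) ! 0 \<in> F) * g (set (zs @ us))))"
  proof (intro sum.cong refl)
    fix us zs assume *: "us \<in> words b" "zs \<in> words (Suc j)"
    then have "edges (us @ zs) ! b = edges (zs @ us) ! 0"
      by (auto simp: words_def nth_append)
    then show "(\<Sum>T\<in>V. walk T (us @ zs) T) * (of_bool (edges (us @ zs) ! b \<in> F) * g (set (us @ zs))) =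
      (\<Sum>T\<in>V. walk T (zs @ us) T) * (of_bool (edges (zs @ us) ! 0 \<in> F) * g (set (zs @ us)))"
      using cyc[OF *] by (simp only: set_append Un_commute)
  qed
  also have "\<dots> = (\<Sum>zs\<in>words (Suc j). \<Sum>us\<in>words b. (\<Sum>T\<in>V. walk T (zs @ us) T) *
      (of_bool (edges (zs @ us) ! 0 \<in> F) * g (set (zs @ us))))"
    by (rule sum.swap)
  also have "\<dots> = (\<Sum>ys\<in>words (Suc j + b). (\<Sum>T\<in>V. walk T ys T) * (of_bool (edges ys ! 0 \<in> F) * g (set ys)))"
    unfolding sum_words_add ..
  also have "Suc j + b = l" using l by simp
  also have "(\<Sum>ys\<in>words l. (\<Sum>T\<in>V. walk T ys T) * (of_bool (edges ys ! 0 \<in> F) * g (set ys))) =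
      (\<Sum>T\<in>V. \<Sum>ys\<in>words l. walk T ys T * (of_bool (edges ys ! 0 \<in> F) * g (set ys)))"
    by (subst sum.swap) (simp add: sum_distrib_right)
  finally show ?thesis .
qed

text \<open>The factor 2 stands for the two terms of a covariance, \<open>l\<close> for the position
  of a shared edge in the second walk, and \<open>walk_bound k\<close> for the first walk; the rest
  comes from \<open>sum_anchored_walks_le\<close>.\<close>

definition cov_bound :: "nat \<Rightarrow> nat \<Rightarrow> real" where
  "cov_bound k l = 2 * real k * real l * real B ^ 2 * walk_bound k * (real B * (real (k + l) + 1)) ^ (l - 1)"

text \<open>After rotation the first step uses one of at most \<open>k\<close> edges, and its two
  end points have at most \<open>B ^ 2\<close> choices inside that edge; the other
  \<open>l - 1\<close> steps fall under \<open>sum_steps_le\<close>. No factor \<open>N\<close>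
  arises, since the anchored edge fixes the place of the walk.\<close>

lemma sum_anchored_walks_le:
  assumes "b < l" "finite F" "F \<subseteq> Es" "card F \<le> k"
  shows "(\<Sum>T\<in>V. \<Sum>ys\<in>words l. walk T ys T *
      (of_bool (edges ys ! b \<in> F) * inverse D ^ card (set (edges ys) - F)))
    \<le> real k * real B ^ 2 * (real B * (real (k + l) + 1)) ^ (l - 1)"
proof -
  let ?K = "(real B * (real (k + l) + 1)) ^ (l - 1)"
  obtain m where l: "l = Suc m" using assms(1) by (cases l) auto
  have "(\<Sum>T\<in>V. \<Sum>ys\<in>words l. walk T ys T *
      (of_bool (edges ys ! b \<in> F) * inverse D ^ card (set (edges ys) - F))) =
      (\<Sum>T\<in>V. \<Sum>ys\<in>words l. walk T ys T *
      (of_bool (edges ys ! 0 \<in> F) * inverse D ^ card (set (edges ys) - F)))"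
    using sum_closed_walks_rotate[OF assms(1), of F "\<lambda>Y. inverse D ^ card (fst ` Y - F)"] by simp
  also have "\<dots> = (\<Sum>T\<in>V. \<Sum>e\<in>Es. \<Sum>U\<in>V. of_bool (e \<in> F) * A e T U *
      (\<Sum>ys\<in>words m. walk U ys T * inverse D ^ card (set (edges ys) - F)))"
    unfolding l sum_words_Suc sum_distrib_left
  proof (intro sum.cong refl)
    fix T e U ys
    show "walk T ((e, U) # ys) T * (of_bool (edges ((e, U) # ys) ! 0 \<in> F) *
        inverse D ^ card (set (edges ((e, U) # ys)) - F)) =
      of_bool (e \<in> F) * A e T U * (walk U ys T * inverse D ^ card (set (edges ys) - F))"
      by (cases "e \<in> F") auto
  qed
  also have "\<dots> \<le> (\<Sum>T\<in>V. \<Sum>e\<in>Es. \<Sum>U\<in>V. of_bool (e \<in> F) * A e T U * ?K)"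
  proof (intro sum_mono mult_left_mono)
    fix T U assume "U \<in> V"
    have "(\<Sum>ys\<in>words m. walk U ys T * inverse D ^ card (set (edges ys) - F))
        \<le> (\<Sum>ys\<in>words m. steps U ys * inverse D ^ card (set (edges ys) - F))"
      using D_pos by (intro sum_mono mult_right_mono walk_le_steps) auto
    also have "\<dots> \<le> (real B * (real (k + l) + 1)) ^ m"
      using assms \<open>U \<in> V\<close> l by (intro sum_steps_le) auto
    finally show "(\<Sum>ys\<in>words m. walk U ys T * inverse D ^ card (set (edges ys) - F)) \<le> ?K"
      using l by simp
  qed (auto simp: A_nonneg)
  also have "\<dots> = (\<Sum>e\<in>Es. \<Sum>T\<in>V. \<Sum>U\<in>V. of_bool (e \<in> F) * A e T U * ?K)"
    by (rule sum.swap)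
  also have "\<dots> = (\<Sum>e\<in>Es. of_bool (e \<in> F) * ((\<Sum>T\<in>V. \<Sum>U\<in>V. A e T U) * ?K))"
    by (simp add: sum_distrib_left sum_distrib_right mult.assoc)
  also have "\<dots> \<le> (\<Sum>e\<in>Es. of_bool (e \<in> F) * (real B ^ 2 * ?K))"
    by (intro sum_mono mult_left_mono mult_right_mono sum_A_le) auto
  also have "\<dots> = real (card F) * (real B ^ 2 * ?K)"
    using finite_Es assms(3) by (simp add: sum_distrib_right[symmetric] of_bool_def sum.If_cases Int_absorb1)
  also have "\<dots> \<le> real k * (real B ^ 2 * ?K)"
    using assms(4) by (intro mult_right_mono) auto
  finally show ?thesis by (simp add: mult.assoc)
qed

text \<open>Without a shared edge the difference is zero. Otherwise some position \<open>b\<close>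
  witnesses the sharing, so the sum of indicators is at least 1, and each of the two terms is
  bounded through the number of distinct edges in the union.\<close>

lemma abs_edge_weight_cov_le:
  assumes "xs \<in> words k" "ys \<in> words l"
  shows "\<bar>edge_weight p (edges (xs @ ys)) - edge_weight p (edges xs) * edge_weight p (edges ys)\<bar>
    \<le> (\<Sum>b<l. of_bool (edges ys ! b \<in> set (edges xs))) *
       (2 * sqrt \<rho> ^ (k + l) * inverse D ^ card (set (edges xs)) *
        inverse D ^ card (set (edges ys) - set (edges xs)))"
proof (cases "set (edges xs) \<inter> set (edges ys) = {}")
  case True
  then show ?thesis
    using edge_weight_append_disjoint[OF True] D_pos rho_ge_1
    by (auto intro!: mult_nonneg_nonneg sum_nonneg)
next
  case False
  let ?X = "set (edges xs)" and ?Y = "set (edges ys)"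
  let ?K = "2 * sqrt \<rho> ^ (k + l) * inverse D ^ card ?X * inverse D ^ card (?Y - ?X)"
  have len: "length (edges xs) = k" "length (edges ys) = l"
    using assms by (simp_all add: words_def)
  have "card (?X \<union> ?Y) = card ?X + card (?Y - ?X)"
    by (subst card_Un_disjoint[symmetric]) auto
  then have split: "inverse D ^ card (?X \<union> ?Y) = inverse D ^ card ?X * inverse D ^ card (?Y - ?X)"
    by (simp add: power_add)
  have 1: "\<bar>edge_weight p (edges (xs @ ys))\<bar> \<le> ?K / 2"
    using abs_edge_weight_le_rho[of "edges (xs @ ys)"] len split by simp
  have 2: "\<bar>edge_weight p (edges xs) * edge_weight p (edges ys)\<bar> \<le> ?K / 2"
  proof (cases "edge_weight p (edges xs) * edge_weight p (edges ys) = 0")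
    case True
    show ?thesis unfolding True using D_pos rho_ge_1 by simp
  next
    case nz: False
    then have c: "2 * card ?X \<le> k" "2 * card ?Y \<le> l"
      using card_le_of_edge_weight[of p "edges xs"] card_le_of_edge_weight[of p "edges ys"] len by auto
    let ?v = "p * (1 - p)"
    have v: "0 \<le> ?v" "?v \<le> 1" using p_nonneg p_le_1 by (auto simp: mult_le_one)
    have "\<bar>edge_weight p (edges xs) * edge_weight p (edges ys)\<bar> \<le> ?v ^ card ?X * ?v ^ card ?Y"
      unfolding abs_mult using v p_nonneg p_le_1 by (intro mult_mono abs_edge_weight_le) auto
    also have "\<dots> = ?v ^ (card ?X + card ?Y)" by (simp add: power_add)
    \<comment> \<open>The product of the weights has the larger exponent
      \<open>card ?X + card ?Y\<close>; as \<open>?v \<le> 1\<close>, it can be lowered to match the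
      joint weight.\<close>
    also have "\<dots> \<le> ?v ^ card (?X \<union> ?Y)"
      using v card_Un_le[of ?X ?Y] by (intro power_decreasing) auto
    also have "\<dots> \<le> sqrt \<rho> ^ (k + l) * inverse D ^ card (?X \<union> ?Y)"
      using D_pos rho_ge_1 c card_Un_le[of ?X ?Y] by (intro scaled_power_le) (auto simp: \<rho>_def)
    finally show ?thesis using split by simp
  qed
  have "\<bar>edge_weight p (edges (xs @ ys)) - edge_weight p (edges xs) * edge_weight p (edges ys)\<bar> \<le> 1 * ?K"
    using 1 2 by linarith
  also have "\<dots> \<le> (\<Sum>b<l. of_bool (edges ys ! b \<in> ?X)) * ?K"
  proof (rule mult_right_mono)
    obtain b where b: "b < l" "edges ys ! b \<in> ?X"
      using False len(2) by (metis disjoint_iff in_set_conv_nth)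
    have "of_bool (edges ys ! b \<in> ?X) \<le> (\<Sum>b<l. of_bool (edges ys ! b \<in> ?X) :: real)"
      using b by (intro member_le_sum) auto
    then show "1 \<le> (\<Sum>b<l. of_bool (edges ys ! b \<in> ?X) :: real)" using b by simp
  qed (use D_pos rho_ge_1 in simp)
  finally show ?thesis .
qed

text \<open>
  Two walks contribute to the covariance only if they share an edge; rotating the second one so that
  it starts there makes its starting vertex one of boundedly many instead of \<open>N\<close>.
\<close>

lemma cov_mtrace_le:
  "\<bar>\<E> (\<lambda>h. mtrace V (mpow V (M h) k) * mtrace V (mpow V (M h) l)) -
      \<E> (\<lambda>h. mtrace V (mpow V (M h) k)) * \<E> (\<lambda>h. mtrace V (mpow V (M h) l))\<bar>
    \<le> sqrt \<rho> ^ (k + l) * N * cov_bound k l"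
proof -
  let ?w = "\<lambda>xs. edge_weight p (edges xs)"
  let ?d = "\<lambda>xs. inverse D ^ card (set (edges xs))"
  let ?d' = "\<lambda>xs ys. inverse D ^ card (set (edges ys) - set (edges xs))"
  let ?K = "real k * real B ^ 2 * (real B * (real (k + l) + 1)) ^ (l - 1)"
  have "\<E> (\<lambda>h. mtrace V (mpow V (M h) k) * mtrace V (mpow V (M h) l)) =
      (\<Sum>S\<in>V. \<Sum>T\<in>V. \<Sum>xs\<in>words k. \<Sum>ys\<in>words l. walk S xs S * walk T ys T * ?w (xs @ ys))"
    by (simp add: mtrace_def sum_product Bochner_Integration.integral_sum E_mpow_mult)
  also have "\<dots> = (\<Sum>S\<in>V. \<Sum>xs\<in>words k. \<Sum>T\<in>V. \<Sum>ys\<in>words l. walk S xs S * walk T ys T * ?w (xs @ ys))"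
    by (intro sum.cong refl sum.swap)
  finally have 1: "\<E> (\<lambda>h. mtrace V (mpow V (M h) k) * mtrace V (mpow V (M h) l)) = \<dots>" .
  have "\<E> (\<lambda>h. mtrace V (mpow V (M h) k)) * \<E> (\<lambda>h. mtrace V (mpow V (M h) l)) =
      (\<Sum>S\<in>V. \<Sum>T\<in>V. \<Sum>xs\<in>words k. \<Sum>ys\<in>words l. walk S xs S * walk T ys T * (?w xs * ?w ys))"
    unfolding E_mtrace_mpow by (simp add: sum_product mult_ac)
  also have "\<dots> = (\<Sum>S\<in>V. \<Sum>xs\<in>words k. \<Sum>T\<in>V. \<Sum>ys\<in>words l. walk S xs S * walk T ys T * (?w xs * ?w ys))"
    by (intro sum.cong refl sum.swap)
  finally have 2: "\<E> (\<lambda>h. mtrace V (mpow V (M h) k)) * \<E> (\<lambda>h. mtrace V (mpow V (M h) l)) = \<dots>" .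
  have "\<bar>\<E> (\<lambda>h. mtrace V (mpow V (M h) k) * mtrace V (mpow V (M h) l)) -
      \<E> (\<lambda>h. mtrace V (mpow V (M h) k)) * \<E> (\<lambda>h. mtrace V (mpow V (M h) l))\<bar> =
      \<bar>\<Sum>S\<in>V. \<Sum>xs\<in>words k. \<Sum>T\<in>V. \<Sum>ys\<in>words l. walk S xs S * walk T ys T * (?w (xs @ ys) - ?w xs * ?w ys)\<bar>"
    unfolding 1 2 by (simp only: sum_subtractf right_diff_distrib)
  also have "\<dots> \<le> (\<Sum>S\<in>V. \<Sum>xs\<in>words k. \<Sum>T\<in>V. \<Sum>ys\<in>words l.
      \<bar>walk S xs S * walk T ys T * (?w (xs @ ys) - ?w xs * ?w ys)\<bar>)"
    by (intro order_trans[OF sum_abs] sum_mono order_refl)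
  also have "\<dots> \<le> (\<Sum>S\<in>V. \<Sum>xs\<in>words k. \<Sum>T\<in>V. \<Sum>ys\<in>words l. \<Sum>b<l.
      2 * sqrt \<rho> ^ (k + l) * (walk S xs S * ?d xs *
        (walk T ys T * (of_bool (edges ys ! b \<in> set (edges xs)) * ?d' xs ys))))"
  proof (intro sum_mono)
    fix S xs T ys assume "xs \<in> words k" "ys \<in> words l"
    from mult_left_mono[OF abs_edge_weight_cov_le[OF this] mult_nonneg_nonneg[OF walk_nonneg[of S xs S] walk_nonneg[of T ys T]]]
    show "\<bar>walk S xs S * walk T ys T * (?w (xs @ ys) - ?w xs * ?w ys)\<bar> \<le> (\<Sum>b<l.
      2 * sqrt \<rho> ^ (k + l) * (walk S xs S * ?d xs *
        (walk T ys T * (of_bool (edges ys ! b \<in> set (edges xs)) * ?d' xs ys))))"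
      by (simp only: abs_mult abs_of_nonneg[OF walk_nonneg] sum_distrib_left sum_distrib_right mult_ac)
  qed
  also have "\<dots> = (\<Sum>S\<in>V. \<Sum>xs\<in>words k. \<Sum>T\<in>V. \<Sum>b<l. \<Sum>ys\<in>words l.
      2 * sqrt \<rho> ^ (k + l) * (walk S xs S * ?d xs *
        (walk T ys T * (of_bool (edges ys ! b \<in> set (edges xs)) * ?d' xs ys))))"
    by (intro sum.cong refl sum.swap)
  also have "\<dots> = (\<Sum>S\<in>V. \<Sum>xs\<in>words k. \<Sum>b<l. \<Sum>T\<in>V. \<Sum>ys\<in>words l.
      2 * sqrt \<rho> ^ (k + l) * (walk S xs S * ?d xs *
        (walk T ys T * (of_bool (edges ys ! b \<in> set (edges xs)) * ?d' xs ys))))"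
    by (intro sum.cong refl sum.swap)
  also have "\<dots> = (\<Sum>S\<in>V. \<Sum>xs\<in>words k. \<Sum>b<l. 2 * sqrt \<rho> ^ (k + l) * (walk S xs S * ?d xs *
      (\<Sum>T\<in>V. \<Sum>ys\<in>words l. walk T ys T * (of_bool (edges ys ! b \<in> set (edges xs)) * ?d' xs ys))))"
    by (simp only: sum_distrib_left)
  also have "\<dots> \<le> (\<Sum>S\<in>V. \<Sum>xs\<in>words k. \<Sum>b<l. 2 * sqrt \<rho> ^ (k + l) * (walk S xs S * ?d xs * ?K))"
  proof (intro sum_mono mult_left_mono sum_anchored_walks_le)
    fix xs assume "xs \<in> words k"
    then show "set (edges xs) \<subseteq> Es" "card (set (edges xs)) \<le> k"
      using card_length[of "edges xs"] by (auto simp: words_def)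
  qed (use D_pos rho_ge_1 walk_nonneg in auto)
  also have "\<dots> = real l * (2 * sqrt \<rho> ^ (k + l)) * ?K * (\<Sum>S\<in>V. \<Sum>xs\<in>words k. walk S xs S * ?d xs)"
    by (simp add: sum_distrib_left mult_ac)
  also have "\<dots> \<le> real l * (2 * sqrt \<rho> ^ (k + l)) * ?K * (N * walk_bound k)"
    using rho_ge_1 by (intro mult_left_mono sum_closed_walks_le) auto
  finally show ?thesis
    by (simp add: cov_bound_def mult_ac)
qed

end

section \<open>The moment recursion\<close>

text \<open>The square of the Frobenius norm.\<close>

definition frob :: "'v set \<Rightarrow> ('v \<Rightarrow> 'v \<Rightarrow> real) \<Rightarrow> real" where
  "frob V X = (\<Sum>S\<in>V. \<Sum>T\<in>V. (X S T)\<^sup>2)"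

lemma abs_mult_le_weighted:
  fixes x y \<eta> :: real
  assumes "0 < \<eta>"
  shows "\<bar>x * y\<bar> \<le> (x\<^sup>2 / \<eta> + \<eta> * y\<^sup>2) / 2"
proof -
  have "0 \<le> (\<bar>x\<bar> - \<eta> * \<bar>y\<bar>)\<^sup>2" by simp
  then have "2 * \<eta> * \<bar>x * y\<bar> \<le> x\<^sup>2 + \<eta>\<^sup>2 * y\<^sup>2"
    by (simp add: power2_diff power_mult_distrib abs_mult algebra_simps)
  then show ?thesis
    using assms by (simp add: field_simps power2_eq_square)
qed

text \<open>
  \<open>D0\<close> is the number of edges joining two adjacent vertices, \<open>D2\<close> bounds the number of edges common to
  two distinct vertices, and \<open>\<delta>\<close> is the proportion of vertices not adjacent to a given one.
\<close>

locale mixing_edge_matrix = random_edge_matrix +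
  fixes adj :: "'a \<Rightarrow> 'a \<Rightarrow> bool" and D0 D2 \<delta> :: real
  assumes sum_A_edges: "S \<in> V \<Longrightarrow> T \<in> V \<Longrightarrow> (\<Sum>e\<in>Es. A e S T) = D0 * of_bool (adj S T)"
    and adj_sym: "adj S T = adj T S"
    and card_not_adj: "S \<in> V \<Longrightarrow> real (card {T \<in> V. \<not> adj S T}) \<le> \<delta> * real (card V)"
    and card_common_edges:
      "S \<in> V \<Longrightarrow> T \<in> V \<Longrightarrow> S \<noteq> T \<Longrightarrow> real (card {e \<in> Es. inc S e \<and> inc T e}) \<le> D2"
    and D0_nonneg: "0 \<le> D0" and D2_nonneg: "0 \<le> D2" and V_nonempty: "V \<noteq> {}"
begin

lemma N_pos: "0 < N" using finite_V V_nonempty by (simp add: card_gt_0_iff)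

lemma delta_nonneg: "0 \<le> \<delta>"
proof -
  obtain S where "S \<in> V" using V_nonempty by blast
  from card_not_adj[OF this] have "0 \<le> \<delta> * N" by linarith
  then show ?thesis using N_pos by (simp add: zero_le_mult_iff)
qed

text \<open>Interchanging the sums counts the edges through a pair of vertices: at most
  \<open>D2\<close> for distinct vertices, which carry the weight \<open>1 / \<eta>\<close>, and at
  most \<open>D\<close> for any pair, which pays for the weight \<open>\<eta>\<close>.\<close>

lemma sum_inc_quadratic_le:
  assumes "0 < \<eta>"
  shows "(\<Sum>e\<in>Es. \<Sum>U\<in>V. \<Sum>T\<in>V. of_bool (inc U e) * of_bool (inc T e) *
      ((of_bool (U \<noteq> T) / \<eta> + \<eta>) * (Z U T)\<^sup>2)) \<le> (D2 / \<eta> + \<eta> * D) * frob V Z"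
proof -
  let ?c = "\<lambda>U T. real (card {e \<in> Es. inc U e \<and> inc T e})"
  have c: "(\<Sum>e\<in>Es. of_bool (inc U e) * of_bool (inc T e)) = ?c U T" for U T
    using finite_Es by (simp add: of_bool_conj[symmetric] Int_def del: of_bool_conj)
  have "(\<Sum>e\<in>Es. \<Sum>U\<in>V. \<Sum>T\<in>V. of_bool (inc U e) * of_bool (inc T e) *
      ((of_bool (U \<noteq> T) / \<eta> + \<eta>) * (Z U T)\<^sup>2)) =
      (\<Sum>U\<in>V. \<Sum>e\<in>Es. \<Sum>T\<in>V. of_bool (inc U e) * of_bool (inc T e) *
      ((of_bool (U \<noteq> T) / \<eta> + \<eta>) * (Z U T)\<^sup>2))"
    by (rule sum.swap)
  also have "\<dots> = (\<Sum>U\<in>V. \<Sum>T\<in>V. \<Sum>e\<in>Es. of_bool (inc U e) * of_bool (inc T e) *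
      ((of_bool (U \<noteq> T) / \<eta> + \<eta>) * (Z U T)\<^sup>2))"
    by (intro sum.cong refl sum.swap)
  also have "\<dots> = (\<Sum>U\<in>V. \<Sum>T\<in>V. ?c U T * ((of_bool (U \<noteq> T) / \<eta> + \<eta>) * (Z U T)\<^sup>2))"
    by (simp only: sum_distrib_right[symmetric] c)
  also have "\<dots> \<le> (\<Sum>U\<in>V. \<Sum>T\<in>V. (D2 / \<eta> + \<eta> * D) * (Z U T)\<^sup>2)"
  proof (intro sum_mono)
    fix U T assume UT: "U \<in> V" "T \<in> V"
    have "card {e \<in> Es. inc U e \<and> inc T e} \<le> card {e \<in> Es. inc U e}"
      using finite_Es by (intro card_mono) auto
    then have cD: "?c U T \<le> D" using card_edges_of_vertex[OF UT(1)] by linarith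
    have "?c U T * (of_bool (U \<noteq> T) / \<eta>) \<le> D2 / \<eta>"
      using card_common_edges[OF UT] assms D2_nonneg
      by (cases "U = T") (auto intro: divide_right_mono)
    moreover have "?c U T * \<eta> \<le> \<eta> * D" using cD assms by (simp add: mult.commute)
    ultimately have "?c U T * (of_bool (U \<noteq> T) / \<eta> + \<eta>) \<le> D2 / \<eta> + \<eta> * D"
      by (simp only: distrib_left)
    from mult_right_mono[OF this, of "(Z U T)\<^sup>2"]
    show "?c U T * ((of_bool (U \<noteq> T) / \<eta> + \<eta>) * (Z U T)\<^sup>2) \<le> (D2 / \<eta> + \<eta> * D) * (Z U T)\<^sup>2"
      by (simp only: mult.assoc zero_le_power2 simp_thms)
  qed
  finally show ?thesis by (simp add: frob_def sum_distrib_left)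
qed

text \<open>In each of the two summands two of the four vertices do not occur in the square; they
  range freely over the edge and cost \<open>B ^ 2\<close>, and \<open>sum_inc_quadratic_le\<close>
  bounds the remaining pair.\<close>

lemma sum_quadruples_le:
  assumes "0 < \<eta>"
  defines "w \<equiv> \<lambda>U T. of_bool (U \<noteq> T) / \<eta> + \<eta>"
  shows "(\<Sum>e\<in>Es. \<Sum>S\<in>V. \<Sum>U\<in>V. \<Sum>T\<in>V. \<Sum>R\<in>V.
      of_bool (inc S e) * of_bool (inc U e) * of_bool (inc T e) * of_bool (inc R e) *
      (w U T * (X U T)\<^sup>2 + w R S * (Y R S)\<^sup>2))
    \<le> real B ^ 2 * (D2 / \<eta> + \<eta> * D) * (frob V X + frob V Y)"
proof -
  define q where "q = (\<lambda>Z e. \<Sum>U\<in>V. \<Sum>T\<in>V. of_bool (inc U e) * of_bool (inc T e) * (w U T * (Z U T)\<^sup>2) :: real)"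
  define I where "I = (\<lambda>e. \<Sum>S\<in>V. of_bool (inc S e) :: real)"
  have I_eq: "(\<Sum>S\<in>V. of_bool (inc S e)) = I e" for e
    by (simp only: I_def)
  have q0: "0 \<le> q Z e" for Z e
    unfolding q_def w_def using assms(1) by (intro sum_nonneg mult_nonneg_nonneg) auto
  have I: "0 \<le> I e" "e \<in> Es \<Longrightarrow> I e \<le> real B" for e
    using finite_V card_vertices_of_edge[of e] by (auto simp: I_def of_bool_def sum.If_cases Int_def)
  have 1: "(\<Sum>S\<in>V. \<Sum>U\<in>V. \<Sum>T\<in>V. \<Sum>R\<in>V.
      of_bool (inc S e) * of_bool (inc U e) * of_bool (inc T e) * of_bool (inc R e) *
      (w U T * (X U T)\<^sup>2)) = I e * I e * q X e" for e
  proof -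
    have "(\<Sum>S\<in>V. \<Sum>U\<in>V. \<Sum>T\<in>V. \<Sum>R\<in>V.
      of_bool (inc S e) * of_bool (inc U e) * of_bool (inc T e) * of_bool (inc R e) * (w U T * (X U T)\<^sup>2)) =
      (\<Sum>S\<in>V. of_bool (inc S e) * (\<Sum>U\<in>V. \<Sum>T\<in>V. of_bool (inc U e) * of_bool (inc T e) *
        (w U T * (X U T)\<^sup>2) * I e))"
      unfolding I_def by (simp only: sum_distrib_left sum_distrib_right mult_ac)
    also have "\<dots> = (\<Sum>S\<in>V. of_bool (inc S e) * (q X e * I e))"
      unfolding q_def by (simp only: sum_distrib_right)
    also have "\<dots> = I e * (q X e * I e)"
      by (simp only: sum_distrib_right[symmetric] I_def)
    finally show ?thesis by (simp only: mult_ac)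
  qed
  have 2: "(\<Sum>S\<in>V. \<Sum>U\<in>V. \<Sum>T\<in>V. \<Sum>R\<in>V.
      of_bool (inc S e) * of_bool (inc U e) * of_bool (inc T e) * of_bool (inc R e) *
      (w R S * (Y R S)\<^sup>2)) = I e * I e * q Y e" for e
  proof -
    have "(\<Sum>S\<in>V. \<Sum>U\<in>V. \<Sum>T\<in>V. \<Sum>R\<in>V.
      of_bool (inc S e) * of_bool (inc U e) * of_bool (inc T e) * of_bool (inc R e) * (w R S * (Y R S)\<^sup>2)) =
      (\<Sum>S\<in>V. of_bool (inc S e) * (\<Sum>U\<in>V. of_bool (inc U e) * (\<Sum>T\<in>V. of_bool (inc T e) *
        (\<Sum>R\<in>V. of_bool (inc R e) * (w R S * (Y R S)\<^sup>2)))))"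
      by (simp only: sum_distrib_left mult_ac)
    also have "\<dots> = I e * I e * (\<Sum>S\<in>V. \<Sum>R\<in>V. of_bool (inc R e) * of_bool (inc S e) * (w R S * (Y R S)\<^sup>2))"
      unfolding sum_distrib_right[symmetric] I_eq by (simp only: sum_distrib_left mult_ac)
    also have "(\<Sum>S\<in>V. \<Sum>R\<in>V. of_bool (inc R e) * of_bool (inc S e) * (w R S * (Y R S)\<^sup>2)) = q Y e"
      unfolding q_def by (rule sum.swap)
    finally show ?thesis .
  qed
  have "(\<Sum>e\<in>Es. \<Sum>S\<in>V. \<Sum>U\<in>V. \<Sum>T\<in>V. \<Sum>R\<in>V.
      of_bool (inc S e) * of_bool (inc U e) * of_bool (inc T e) * of_bool (inc R e) *
      (w U T * (X U T)\<^sup>2 + w R S * (Y R S)\<^sup>2)) = (\<Sum>e\<in>Es. I e * I e * q X e + I e * I e * q Y e)"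
    by (simp only: distrib_left sum.distrib 1 2)
  also have "\<dots> \<le> (\<Sum>e\<in>Es. real B * real B * q X e + real B * real B * q Y e)"
    using I q0 by (intro sum_mono add_mono mult_right_mono mult_mono) auto
  also have "\<dots> = real B ^ 2 * ((\<Sum>e\<in>Es. q X e) + (\<Sum>e\<in>Es. q Y e))"
    by (simp add: sum.distrib sum_distrib_left power2_eq_square distrib_left)
  also have "\<dots> \<le> real B ^ 2 * ((D2 / \<eta> + \<eta> * D) * frob V X + (D2 / \<eta> + \<eta> * D) * frob V Y)"
    unfolding q_def w_def by (intro mult_left_mono add_mono sum_inc_quadratic_le assms(1)) auto
  finally show ?thesis by (simp only: distrib_left[symmetric] mult.assoc)
qed

text \<open>Outside the terms with \<open>T = U\<close> and \<open>R = S\<close> at least one of the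
  two entries is off-diagonal. Its square receives the weight \<open>1 / \<eta>\<close> and the
  other square, possibly of a diagonal entry, the weight \<open>\<eta>\<close>; the function
  \<open>w\<close> dominates both choices.\<close>

lemma edge_form_off_diagonal_le:
  assumes "0 < \<eta>"
  shows "\<bar>edge_form X Y - (\<Sum>e\<in>Es. \<Sum>S\<in>V. \<Sum>U\<in>V. A e S U * (X U U * Y S S))\<bar>
    \<le> real B ^ 2 * (D2 / \<eta> + \<eta> * D) * (frob V X + frob V Y) / 2"
proof -
  define w where "w = (\<lambda>U T :: 'a. of_bool (U \<noteq> T) / \<eta> + \<eta>)"
  let ?a = "\<lambda>e S U T R. A e S U * A e T R * (X U T * Y R S)"
  let ?i = "\<lambda>e S U T R. of_bool (inc S e) * of_bool (inc U e) * of_bool (inc T e) * of_bool (inc R e) :: real"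
  have diag: "(\<Sum>T\<in>V. \<Sum>R\<in>V. of_bool (T = U \<and> R = S) * ?a e S U T R) = A e S U * (X U U * Y S S)"
    if "S \<in> V" "U \<in> V" for e S U
  proof -
    have "(\<Sum>T\<in>V. \<Sum>R\<in>V. of_bool (T = U \<and> R = S) * ?a e S U T R) =
        (\<Sum>T\<in>V. if T = U then (\<Sum>R\<in>V. if R = S then ?a e S U U S else 0) else 0)"
      by (intro sum.cong refl) (auto intro!: sum.cong sum.neutral)
    also have "\<dots> = A e S U * A e U S * (X U U * Y S S)"
      using that finite_V by simp
    also have "A e S U * A e U S = A e S U"
      using A_01[of e S U] by (auto simp: A_sym[of e U S])
    finally show ?thesis .
  qed
  have term_le: "\<bar>?a e S U T R - of_bool (T = U \<and> R = S) * ?a e S U T R\<bar>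
      \<le> ?i e S U T R * (w U T * (X U T)\<^sup>2 + w R S * (Y R S)\<^sup>2) / 2" for e S U T R
  proof -
    have w: "\<eta> \<le> w U T" "0 \<le> w U T" "T \<noteq> U \<Longrightarrow> 1 / \<eta> \<le> w U T" for U T
      using assms by (auto simp: w_def)
    consider "?a e S U T R - of_bool (T = U \<and> R = S) * ?a e S U T R = 0"
      | "T \<noteq> U" "A e S U * A e T R \<noteq> 0" | "R \<noteq> S" "A e S U * A e T R \<noteq> 0"
      by (cases "A e S U * A e T R = 0") auto
    then show ?thesis
    proof cases
      case 1
      show ?thesis unfolding 1 using w by (auto intro!: mult_nonneg_nonneg add_nonneg_nonneg)
    next
      case 2
      then have "?i e S U T R = 1" "A e S U * A e T R = 1"
        using A_inc[of e S U] A_inc[of e T R] A_01[of e S U] A_01[of e T R] by auto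
      moreover have "\<bar>X U T * Y R S\<bar> \<le> (w U T * (X U T)\<^sup>2 + w R S * (Y R S)\<^sup>2) / 2"
        using abs_mult_le_weighted[OF assms, of "X U T" "Y R S"]
          mult_right_mono[OF w(3)[OF 2(1)], of "(X U T)\<^sup>2"] mult_right_mono[OF w(1)[of R S], of "(Y R S)\<^sup>2"]
        by simp
      ultimately show ?thesis using 2 by simp
    next
      case 3
      then have "?i e S U T R = 1" "A e S U * A e T R = 1"
        using A_inc[of e S U] A_inc[of e T R] A_01[of e S U] A_01[of e T R] by auto
      moreover have "\<bar>X U T * Y R S\<bar> \<le> (w U T * (X U T)\<^sup>2 + w R S * (Y R S)\<^sup>2) / 2"
        using abs_mult_le_weighted[OF assms, of "Y R S" "X U T"]
          mult_right_mono[OF w(3)[OF 3(1)[symmetric]], of "(Y R S)\<^sup>2"] mult_right_mono[OF w(1)[of U T], of "(X U T)\<^sup>2"]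
        by (simp add: mult.commute)
      ultimately show ?thesis using 3 by simp
    qed
  qed
  have "(\<Sum>e\<in>Es. \<Sum>S\<in>V. \<Sum>U\<in>V. A e S U * (X U U * Y S S)) =
      (\<Sum>e\<in>Es. \<Sum>S\<in>V. \<Sum>U\<in>V. \<Sum>T\<in>V. \<Sum>R\<in>V. of_bool (T = U \<and> R = S) * ?a e S U T R)"
    by (intro sum.cong refl diag[symmetric])
  then have "\<bar>edge_form X Y - (\<Sum>e\<in>Es. \<Sum>S\<in>V. \<Sum>U\<in>V. A e S U * (X U U * Y S S))\<bar> =
      \<bar>\<Sum>e\<in>Es. \<Sum>S\<in>V. \<Sum>U\<in>V. \<Sum>T\<in>V. \<Sum>R\<in>V. ?a e S U T R - of_bool (T = U \<and> R = S) * ?a e S U T R\<bar>"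
    unfolding edge_form_def by (simp only: sum_subtractf)
  also have "\<dots> \<le> (\<Sum>e\<in>Es. \<Sum>S\<in>V. \<Sum>U\<in>V. \<Sum>T\<in>V. \<Sum>R\<in>V.
      ?i e S U T R * (w U T * (X U T)\<^sup>2 + w R S * (Y R S)\<^sup>2) / 2)"
    by (intro order_trans[OF sum_abs] sum_mono term_le)
  also have "\<dots> = (\<Sum>e\<in>Es. \<Sum>S\<in>V. \<Sum>U\<in>V. \<Sum>T\<in>V. \<Sum>R\<in>V.
      ?i e S U T R * (w U T * (X U T)\<^sup>2 + w R S * (Y R S)\<^sup>2)) / 2"
    by (simp only: sum_divide_distrib)
  also have "\<dots> \<le> real B ^ 2 * (D2 / \<eta> + \<eta> * D) * (frob V X + frob V Y) / 2"
    unfolding w_def by (intro divide_right_mono sum_quadruples_le assms) auto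
  finally show ?thesis .
qed

lemma sum_diag_sq_le_frob: "(\<Sum>S\<in>V. (X S S)\<^sup>2) \<le> frob V X"
  unfolding frob_def using finite_V by (intro sum_mono member_le_sum) auto

text \<open>Summed over the edges, \<open>A\<close> becomes \<open>D0\<close> times adjacency.
  Completing adjacency to all pairs produces the product of the traces; the added pairs are bounded
  by squares of diagonal entries, each vertex being in at most \<open>\<delta> * N\<close> such
  pairs in either role.\<close>

lemma edge_form_diagonal_le:
  "\<bar>(\<Sum>e\<in>Es. \<Sum>S\<in>V. \<Sum>U\<in>V. A e S U * (X U U * Y S S)) - D0 * (mtrace V X * mtrace V Y)\<bar>
    \<le> D0 * \<delta> * N * (frob V X + frob V Y) / 2"
proof -
  let ?n = "\<lambda>S U. of_bool (\<not> adj S U) :: real"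
  have n: "(\<Sum>U\<in>V. ?n S U) \<le> \<delta> * N" if "S \<in> V" for S
    using card_not_adj[OF that] finite_V by (simp add: Int_def)
  have "(\<Sum>e\<in>Es. \<Sum>S\<in>V. \<Sum>U\<in>V. A e S U * (X U U * Y S S)) =
      (\<Sum>S\<in>V. \<Sum>e\<in>Es. \<Sum>U\<in>V. A e S U * (X U U * Y S S))"
    by (rule sum.swap)
  also have "\<dots> = (\<Sum>S\<in>V. \<Sum>U\<in>V. \<Sum>e\<in>Es. A e S U * (X U U * Y S S))"
    by (intro sum.cong refl sum.swap)
  also have "\<dots> = (\<Sum>S\<in>V. \<Sum>U\<in>V. D0 * of_bool (adj S U) * (X U U * Y S S))"
    by (intro sum.cong refl) (simp add: sum_distrib_right[symmetric] sum_A_edges)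
  finally have diag: "(\<Sum>e\<in>Es. \<Sum>S\<in>V. \<Sum>U\<in>V. A e S U * (X U U * Y S S)) = \<dots>" .
  have "\<dots> - D0 * (mtrace V X * mtrace V Y) =
      (\<Sum>S\<in>V. \<Sum>U\<in>V. D0 * of_bool (adj S U) * (X U U * Y S S)) - (\<Sum>S\<in>V. \<Sum>U\<in>V. D0 * (X U U * Y S S))"
    unfolding mtrace_def by (subst mult.commute[of "sum _ _"]) (simp add: sum_product sum_distrib_left mult_ac)
  also have "\<dots> = (\<Sum>S\<in>V. \<Sum>U\<in>V. - (D0 * (?n S U * (X U U * Y S S))))"
    unfolding sum_subtractf[symmetric] by (intro sum.cong refl) auto
  finally have "\<bar>(\<Sum>e\<in>Es. \<Sum>S\<in>V. \<Sum>U\<in>V. A e S U * (X U U * Y S S)) - D0 * (mtrace V X * mtrace V Y)\<bar> =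
      \<bar>\<Sum>S\<in>V. \<Sum>U\<in>V. - (D0 * (?n S U * (X U U * Y S S)))\<bar>"
    unfolding diag by (simp only:)
  also have "\<dots> \<le> (\<Sum>S\<in>V. \<Sum>U\<in>V. D0 / 2 * (?n S U * (X U U)\<^sup>2) + D0 / 2 * (?n S U * (Y S S)\<^sup>2))"
  proof (intro order_trans[OF sum_abs] sum_mono)
    fix S U
    have "D0 * \<bar>X U U * Y S S\<bar> \<le> D0 * (((X U U)\<^sup>2 / 1 + 1 * (Y S S)\<^sup>2) / 2)"
      by (intro mult_left_mono abs_mult_le_weighted D0_nonneg) simp
    then show "\<bar>- (D0 * (?n S U * (X U U * Y S S)))\<bar>
        \<le> D0 / 2 * (?n S U * (X U U)\<^sup>2) + D0 / 2 * (?n S U * (Y S S)\<^sup>2)"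
      using D0_nonneg by (cases "adj S U") (auto simp: abs_mult algebra_simps)
  qed
  also have "\<dots> = D0 / 2 * (\<Sum>S\<in>V. \<Sum>U\<in>V. ?n S U * (X U U)\<^sup>2) + D0 / 2 * (\<Sum>S\<in>V. \<Sum>U\<in>V. ?n S U * (Y S S)\<^sup>2)"
    by (simp only: sum.distrib sum_distrib_left)
  also have "(\<Sum>S\<in>V. \<Sum>U\<in>V. ?n S U * (X U U)\<^sup>2) = (\<Sum>U\<in>V. (\<Sum>S\<in>V. ?n U S) * (X U U)\<^sup>2)"
    by (subst sum.swap) (simp only: sum_distrib_right adj_sym)
  also have "(\<Sum>S\<in>V. \<Sum>U\<in>V. ?n S U * (Y S S)\<^sup>2) = (\<Sum>S\<in>V. (\<Sum>U\<in>V. ?n S U) * (Y S S)\<^sup>2)"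
    by (simp only: sum_distrib_right)
  also have "D0 / 2 * (\<Sum>U\<in>V. (\<Sum>S\<in>V. ?n U S) * (X U U)\<^sup>2) + D0 / 2 * (\<Sum>S\<in>V. (\<Sum>U\<in>V. ?n S U) * (Y S S)\<^sup>2)
      \<le> D0 / 2 * (\<Sum>U\<in>V. \<delta> * N * (X U U)\<^sup>2) + D0 / 2 * (\<Sum>S\<in>V. \<delta> * N * (Y S S)\<^sup>2)"
    using D0_nonneg n by (intro add_mono mult_left_mono sum_mono mult_right_mono) auto
  also have "\<dots> = D0 / 2 * (\<delta> * N) * (\<Sum>S\<in>V. (X S S)\<^sup>2) + D0 / 2 * (\<delta> * N) * (\<Sum>S\<in>V. (Y S S)\<^sup>2)"
    by (simp only: sum_distrib_left mult.assoc)
  also have "\<dots> \<le> D0 / 2 * (\<delta> * N) * frob V X + D0 / 2 * (\<delta> * N) * frob V Y"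
    using D0_nonneg delta_nonneg by (intro add_mono mult_left_mono sum_diag_sq_le_frob) auto
  finally show ?thesis by (simp add: field_simps)
qed


lemma edge_form_approx:
  assumes "0 < \<eta>"
  shows "\<bar>edge_form X Y - D0 * (mtrace V X * mtrace V Y)\<bar>
    \<le> (real B ^ 2 * (D2 / \<eta> + \<eta> * D) + D0 * \<delta> * N) / 2 * (frob V X + frob V Y)"
proof -
  have "\<bar>edge_form X Y - D0 * (mtrace V X * mtrace V Y)\<bar>
      \<le> real B ^ 2 * (D2 / \<eta> + \<eta> * D) * (frob V X + frob V Y) / 2 + D0 * \<delta> * N * (frob V X + frob V Y) / 2"
    using edge_form_off_diagonal_le[OF assms, of X Y] edge_form_diagonal_le[of X Y] by linarith
  then show ?thesis by (simp add: distrib_right add_divide_distrib)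
qed

section \<open>Moments of the normalised matrix\<close>

definition \<tau> :: "nat \<Rightarrow> ('b \<Rightarrow> bool) \<Rightarrow> real" where
  "\<tau> k h = mtrace V (mpow V (\<lambda>S T. inverse (sqrt \<rho>) * M h S T) k) / N"

text \<open>The coefficient of \<open>edge_form_approx\<close> divided by \<open>D\<close>. Its
  first part is the cost of off-diagonal entries, the second that of non-adjacent pairs.\<close>

definition form_error :: "real \<Rightarrow> real" where
  "form_error \<eta> = (real B ^ 2 * (D2 / D / \<eta> + \<eta>) + D0 * N / D * \<delta>) / 2"

lemma M_sym: "M h S T = M h T S" unfolding M_def by (simp add: A_sym)

lemma \<tau>_eq: "\<tau> k h = mtrace V (mpow V (M h) k) / (sqrt \<rho> ^ k * N)"
  by (simp only: \<tau>_def mtrace_def mpow_scale sum_distrib_left[symmetric]) (simp add: power_inverse divide_simps)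

lemma frob_mpow: "frob V (mpow V (\<lambda>S T. inverse (sqrt \<rho>) * M h S T) i) = N * \<tau> (i + i) h"
proof -
  have "N * \<tau> (i + i) h = mtrace V (mpow V (\<lambda>S T. inverse (sqrt \<rho>) * M h S T) (i + i))"
    using N_pos by (simp add: \<tau>_def)
  also have "\<dots> = frob V (mpow V (\<lambda>S T. inverse (sqrt \<rho>) * M h S T) i)"
    unfolding frob_def by (intro mtrace_mpow_double finite_V) (simp add: M_sym)
  finally show ?thesis by simp
qed

lemma abs_E_\<tau>_le: "\<bar>\<E> (\<tau> k)\<bar> \<le> walk_bound k"
proof -
  have pos: "0 < sqrt \<rho> ^ k * N" using rho_ge_1 N_pos by simp
  have "\<E> (\<tau> k) = \<E> (\<lambda>h. mtrace V (mpow V (M h) k)) / (sqrt \<rho> ^ k * N)"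
    by (simp add: \<tau>_eq[abs_def])
  then have "\<bar>\<E> (\<tau> k)\<bar> = \<bar>\<E> (\<lambda>h. mtrace V (mpow V (M h) k))\<bar> / (sqrt \<rho> ^ k * N)"
    using pos by (simp only: abs_div_pos)
  also have "\<dots> \<le> walk_bound k"
    using abs_E_mtrace_mpow_le[of k] pos by (subst pos_divide_le_eq) (auto simp: mult_ac)
  finally show ?thesis .
qed

lemma cov_\<tau>_le: "\<bar>\<E> (\<lambda>h. \<tau> k h * \<tau> l h) - \<E> (\<tau> k) * \<E> (\<tau> l)\<bar> \<le> cov_bound k l / N"
proof -
  let ?t = "\<lambda>k h. mtrace V (mpow V (M h) k)"
  let ?c = "sqrt \<rho> ^ k * N * (sqrt \<rho> ^ l * N)"
  have pos: "0 < ?c" using rho_ge_1 N_pos by simp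
  have "\<E> (\<lambda>h. \<tau> k h * \<tau> l h) - \<E> (\<tau> k) * \<E> (\<tau> l) =
      (\<E> (\<lambda>h. ?t k h * ?t l h) - \<E> (?t k) * \<E> (?t l)) / ?c"
    by (simp add: \<tau>_eq[abs_def] diff_divide_distrib)
  then have "\<bar>\<E> (\<lambda>h. \<tau> k h * \<tau> l h) - \<E> (\<tau> k) * \<E> (\<tau> l)\<bar> =
      \<bar>\<E> (\<lambda>h. ?t k h * ?t l h) - \<E> (?t k) * \<E> (?t l)\<bar> / ?c"
    using pos by (simp only: abs_div_pos)
  also have "\<dots> \<le> sqrt \<rho> ^ (k + l) * N * cov_bound k l / ?c"
    using pos cov_mtrace_le[of k l] by (intro divide_right_mono) auto
  also have "\<dots> = cov_bound k l / N"
    using rho_ge_1 N_pos by (auto simp: power_add field_simps)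
  finally show ?thesis .
qed

lemma E_\<tau>_0: "\<E> (\<tau> 0) = 1"
  using N_pos by (simp add: \<tau>_eq[abs_def] mtrace_def)

lemma E_\<tau>_1: "\<E> (\<tau> (Suc 0)) = 0"
proof -
  have "\<E> (\<lambda>h. mtrace V (mpow V (M h) (Suc 0))) = 0"
    unfolding E_mtrace_mpow sum_words_Suc by (simp add: edge_weight_def)
  then show ?thesis by (simp add: \<tau>_eq[abs_def] del: mpow.simps)
qed

text \<open>The estimate holds for every outcome \<open>h\<close>, with even moments on the right;
  taking expectations therefore leaves only quantities already bounded by
  \<open>abs_E_\<tau>_le\<close>.\<close>

lemma edge_form_\<tau>_approx:
  assumes "0 < \<eta>"
  shows "\<bar>edge_form (mpow V (M h) i) (mpow V (M h) j) / (D * N * sqrt \<rho> ^ (i + j)) - D0 * N / D * (\<tau> i h * \<tau> j h)\<bar>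
    \<le> form_error \<eta> * (\<tau> (i + i) h + \<tau> (j + j) h)"
proof -
  let ?c = "inverse (sqrt \<rho>)"
  let ?X = "\<lambda>k. mpow V (\<lambda>S T. ?c * M h S T) k"
  have DN: "0 < D * N" using D_pos N_pos by simp
  have "edge_form (?X i) (?X j) = ?c ^ (i + j) * edge_form (mpow V (M h) i) (mpow V (M h) j)"
    by (simp add: edge_form_def mpow_scale sum_distrib_left power_add mult_ac)
  then have form: "edge_form (mpow V (M h) i) (mpow V (M h) j) / (D * N * sqrt \<rho> ^ (i + j)) =
      edge_form (?X i) (?X j) / (D * N)"
    by (simp add: field_simps)
  have tr: "D0 * N / D * (\<tau> i h * \<tau> j h) = D0 * (mtrace V (?X i) * mtrace V (?X j)) / (D * N)"
    using N_pos by (simp add: \<tau>_def field_simps)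
  have "\<bar>edge_form (?X i) (?X j) / (D * N) - D0 * (mtrace V (?X i) * mtrace V (?X j)) / (D * N)\<bar> =
      \<bar>edge_form (?X i) (?X j) - D0 * (mtrace V (?X i) * mtrace V (?X j))\<bar> / (D * N)"
    using DN by (simp only: diff_divide_distrib[symmetric] abs_div_pos)
  also have "\<dots> \<le> (real B ^ 2 * (D2 / \<eta> + \<eta> * D) + D0 * \<delta> * N) / 2 * (N * \<tau> (i + i) h + N * \<tau> (j + j) h) / (D * N)"
    using edge_form_approx[OF assms, of "?X i" "?X j"] DN
    unfolding frob_mpow by (intro divide_right_mono) auto
  also have "\<dots> = form_error \<eta> * (\<tau> (i + i) h + \<tau> (j + j) h)"
    using D_pos N_pos assms by (simp add: form_error_def field_simps)
  finally show ?thesis unfolding form tr .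
qed

text \<open>The error terms come, in this order, from walks with an edge of multiplicity three or
  more, from replacing the form by traces, from replacing \<open>D0 * N / D\<close> by 1, and from
  replacing the expectation of a product of two moments by the product of their
  expectations.\<close>

theorem moment_recursion_error:
  assumes "0 < \<eta>"
  shows "\<bar>\<E> (\<tau> (Suc (Suc k))) - (\<Sum>i\<le>k. \<E> (\<tau> i) * \<E> (\<tau> (k - i)))\<bar>
    \<le> real (k + 2) * walk_bound (Suc (Suc k)) / sqrt \<rho> +
      (\<Sum>i\<le>k. form_error \<eta> * (walk_bound (i + i) + walk_bound (k - i + (k - i))) +
        (\<bar>D0 * N / D - 1\<bar> * (walk_bound i * walk_bound (k - i) + cov_bound i (k - i) / N) +
         cov_bound i (k - i) / N))"
proof -
  let ?c = "D * N * sqrt \<rho> ^ k"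
  let ?f = "\<lambda>i. \<E> (\<lambda>h. edge_form (mpow V (M h) i) (mpow V (M h) (k - i)))"
  have sq: "0 < sqrt \<rho>" using rho_ge_1 by simp
  have pos: "0 < ?c" "0 < sqrt \<rho> ^ Suc (Suc k) * N" using sq D_pos N_pos by simp_all
  \<comment> \<open>Two of the factors \<open>sqrt \<rho>\<close> absorb the variance
    \<open>p * (1 - p)\<close> and leave \<open>1 / D\<close>, the normalisation of the
    form.\<close>
  have cc: "p * (1 - p) / (sqrt \<rho> ^ Suc (Suc k) * N) = 1 / ?c"
  proof -
    have eq: "sqrt \<rho> ^ Suc (Suc k) = p * (1 - p) * D * sqrt \<rho> ^ k"
      using rho_ge_1 by (simp add: \<rho>_def power2_eq_square[symmetric] mult.assoc[symmetric])
    have nz: "p * (1 - p) \<noteq> 0" using one_le_rho by auto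
    show ?thesis unfolding eq using nz by (simp add: mult_ac)
  qed
  have "\<bar>\<E> (\<tau> (Suc (Suc k))) - (\<Sum>i\<le>k. ?f i / ?c)\<bar> =
      \<bar>\<E> (\<lambda>h. mtrace V (mpow V (M h) (Suc (Suc k)))) - p * (1 - p) * (\<Sum>i\<le>k. ?f i)\<bar> / (sqrt \<rho> ^ Suc (Suc k) * N)"
  proof -
    have "\<E> (\<tau> (Suc (Suc k))) - (\<Sum>i\<le>k. ?f i / ?c) =
        \<E> (\<lambda>h. mtrace V (mpow V (M h) (Suc (Suc k)))) / (sqrt \<rho> ^ Suc (Suc k) * N) - (\<Sum>i\<le>k. ?f i) * (1 / ?c)"
      by (simp add: \<tau>_eq[abs_def] sum_divide_distrib del: mpow.simps power_Suc)
    also have "\<dots> = (\<E> (\<lambda>h. mtrace V (mpow V (M h) (Suc (Suc k)))) - p * (1 - p) * (\<Sum>i\<le>k. ?f i)) / (sqrt \<rho> ^ Suc (Suc k) * N)"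
      unfolding cc[symmetric] by (simp add: diff_divide_distrib mult_ac del: mpow.simps power_Suc)
    finally show ?thesis using pos(2) by (simp only: abs_div_pos)
  qed
  also have "\<dots> \<le> real (k + 2) * sqrt \<rho> ^ Suc k * (N * walk_bound (Suc (Suc k))) / (sqrt \<rho> ^ Suc (Suc k) * N)"
    using pos(2) E_mtrace_expansion[of k] by (intro divide_right_mono) auto
  also have "\<dots> = real (k + 2) * walk_bound (Suc (Suc k)) / sqrt \<rho>"
    using sq N_pos by (simp add: field_simps)
  finally have 1: "\<bar>\<E> (\<tau> (Suc (Suc k))) - (\<Sum>i\<le>k. ?f i / ?c)\<bar>
      \<le> real (k + 2) * walk_bound (Suc (Suc k)) / sqrt \<rho>" .
  have fe: "0 \<le> form_error \<eta>"
    unfolding form_error_def using assms D0_nonneg D2_nonneg D_pos N_pos delta_nonneg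
    by (auto intro!: add_nonneg_nonneg mult_nonneg_nonneg divide_nonneg_nonneg)
  have 2: "\<bar>?f i / ?c - \<E> (\<tau> i) * \<E> (\<tau> (k - i))\<bar>
      \<le> form_error \<eta> * (walk_bound (i + i) + walk_bound (k - i + (k - i))) +
        (\<bar>D0 * N / D - 1\<bar> * (walk_bound i * walk_bound (k - i) + cov_bound i (k - i) / N) +
         cov_bound i (k - i) / N)" if "i \<le> k" for i
  proof -
    let ?j = "k - i" and ?g = "D0 * N / D"
    let ?F = "\<lambda>h. edge_form (mpow V (M h) i) (mpow V (M h) ?j) / ?c"
    let ?ET = "\<E> (\<lambda>h. \<tau> i h * \<tau> ?j h)"
    have "\<bar>?f i / ?c - ?g * ?ET\<bar> = \<bar>\<E> (\<lambda>h. ?F h - ?g * (\<tau> i h * \<tau> ?j h))\<bar>"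
      by simp
    also have "\<dots> \<le> \<E> (\<lambda>h. \<bar>?F h - ?g * (\<tau> i h * \<tau> ?j h)\<bar>)"
      by (rule integral_abs_bound)
    also have "\<dots> \<le> \<E> (\<lambda>h. form_error \<eta> * (\<tau> (i + i) h + \<tau> (?j + ?j) h))"
      using edge_form_\<tau>_approx[OF assms, of _ i ?j] that by (intro integral_mono) auto
    also have "\<dots> = form_error \<eta> * (\<E> (\<tau> (i + i)) + \<E> (\<tau> (?j + ?j)))"
      by simp
    also have "\<dots> \<le> form_error \<eta> * (walk_bound (i + i) + walk_bound (?j + ?j))"
      by (intro mult_left_mono add_mono fe abs_le_D1[OF abs_E_\<tau>_le])
    finally have a: "\<bar>?f i / ?c - ?g * ?ET\<bar> \<le> form_error \<eta> * (walk_bound (i + i) + walk_bound (?j + ?j))" .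
    have b: "\<bar>?ET - \<E> (\<tau> i) * \<E> (\<tau> ?j)\<bar> \<le> cov_bound i ?j / N"
      by (rule cov_\<tau>_le)
    have "\<bar>\<E> (\<tau> i) * \<E> (\<tau> ?j)\<bar> \<le> walk_bound i * walk_bound ?j"
      unfolding abs_mult by (intro mult_mono abs_E_\<tau>_le) (auto simp: walk_bound_nonneg)
    with b have "\<bar>?ET\<bar> \<le> walk_bound i * walk_bound ?j + cov_bound i ?j / N" by linarith
    then have "\<bar>?g - 1\<bar> * \<bar>?ET\<bar> \<le> \<bar>?g - 1\<bar> * (walk_bound i * walk_bound ?j + cov_bound i ?j / N)"
      by (intro mult_left_mono) auto
    then have c: "\<bar>?g * ?ET - ?ET\<bar> \<le> \<bar>?g - 1\<bar> * (walk_bound i * walk_bound ?j + cov_bound i ?j / N)"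
      by (simp only: abs_mult[symmetric] left_diff_distrib mult_1)
    have "\<bar>a - d\<bar> \<le> x + (y + z)" if "\<bar>a - b\<bar> \<le> x" "\<bar>b - c\<bar> \<le> y" "\<bar>c - d\<bar> \<le> z" for a b c d x y z :: real
      using that by linarith
    from this[OF a c b] show ?thesis .
  qed
  have "\<bar>(\<Sum>i\<le>k. ?f i / ?c) - (\<Sum>i\<le>k. \<E> (\<tau> i) * \<E> (\<tau> (k - i)))\<bar>
      \<le> (\<Sum>i\<le>k. \<bar>?f i / ?c - \<E> (\<tau> i) * \<E> (\<tau> (k - i))\<bar>)"
    unfolding sum_subtractf[symmetric] by (rule sum_abs)
  also have "\<dots> \<le> (\<Sum>i\<le>k. form_error \<eta> * (walk_bound (i + i) + walk_bound (k - i + (k - i))) +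
        (\<bar>D0 * N / D - 1\<bar> * (walk_bound i * walk_bound (k - i) + cov_bound i (k - i) / N) +
         cov_bound i (k - i) / N))"
    using 2 by (intro sum_mono) auto
  finally show ?thesis using 1 by linarith
qed

end

section \<open>The semicircle distribution\<close>

fun catalan :: "nat \<Rightarrow> real" where
  "catalan 0 = 1"
| "catalan (Suc n) = (\<Sum>i\<le>n. catalan i * catalan (n - i))"

text \<open>
  The generating function \<open>F\<close> satisfies \<open>F = 1 + X F^2\<close>, so \<open>S = 1 - 2 X F\<close> is the square root of \<open>1 - 4 X\<close>,
  and differentiating gives \<open>(1 - 4 X) S' = - 2 S\<close>.
\<close>

lemma catalan_ratio: "real (n + 2) * catalan (Suc n) = 2 * real (2 * n + 1) * catalan n"
proof -
  define F where "F = Abs_fps catalan"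
  define S where "S = 1 - 2 * fps_X * F"
  have quad: "F = 1 + fps_X * F\<^sup>2"
  proof (rule fps_ext)
    fix n show "fps_nth F n = fps_nth (1 + fps_X * F\<^sup>2) n"
    proof (cases n)
      case (Suc m)
      have "fps_nth (1 + fps_X * F\<^sup>2) (Suc m) = fps_nth (F * F) m"
        by (simp add: power2_eq_square)
      also have "\<dots> = catalan (Suc m)"
        by (simp add: F_def fps_mult_nth atMost_atLeast0)
      finally show ?thesis by (simp add: Suc F_def)
    qed (simp add: F_def)
  qed
  have "S\<^sup>2 = 1 - 4 * fps_X * (F - fps_X * F\<^sup>2)"
    by (simp add: S_def power2_eq_square algebra_simps)
  also have "F - fps_X * F\<^sup>2 = 1"
    using quad by (simp add: algebra_simps)
  finally have sq: "S\<^sup>2 = 1 - 4 * fps_X" by simp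
  have "2 * (S * fps_deriv S) = fps_deriv (S\<^sup>2)"
    by (simp add: power2_eq_square)
  also have "\<dots> = 2 * (- 2)" unfolding sq by (simp add: fps_deriv_mult[of 4, simplified])
  finally have "S * fps_deriv S = - 2" by (subst (asm) mult_cancel_left) simp
  then have "(1 - 4 * fps_X) * fps_deriv S = - 2 * S"
    unfolding sq[symmetric] by (simp add: power2_eq_square algebra_simps)
  \<comment> \<open>The index is shifted by one because \<open>catalan m\<close> sits in the
    coefficient \<open>Suc m\<close> of \<open>S\<close>.\<close>
  then have "fps_nth ((1 - 4 * fps_X) * fps_deriv S) (Suc n) = fps_nth (- 2 * S) (Suc n)" by simp
  moreover have "fps_nth S (Suc m) = - 2 * catalan m" for m
    by (simp add: S_def F_def mult.assoc fps_numeral_fps_const)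
  ultimately show ?thesis
    by (simp add: left_diff_distrib mult.assoc fps_numeral_fps_const algebra_simps)
qed

text \<open>These are the moments of the semicircle law of radius 2, the scale of
  \<open>\<tau>\<close>; the law of radius 1 has them divided by \<open>2 ^ k\<close>, see
  \<open>semicircle_moments\<close>.\<close>

definition semicircle_moment :: "nat \<Rightarrow> real" where
  "semicircle_moment k = (if even k then catalan (k div 2) else 0)"

lemma semicircle_moment_0 [simp]: "semicircle_moment 0 = 1"
  and semicircle_moment_1 [simp]: "semicircle_moment (Suc 0) = 0"
  by (simp_all add: semicircle_moment_def)

text \<open>For even \<open>k\<close> only even \<open>i\<close> contribute, which is the Catalan
  convolution; for odd \<open>k\<close> one of \<open>i\<close> and \<open>k - i\<close> is
  odd.\<close>

lemma semicircle_moment_recursion: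
  "semicircle_moment (Suc (Suc k)) = (\<Sum>i\<le>k. semicircle_moment i * semicircle_moment (k - i))"
proof (cases "even k")
  case True
  then obtain m where k: "k = 2 * m" by (elim evenE)
  have "(\<Sum>i\<le>k. semicircle_moment i * semicircle_moment (k - i)) =
      (\<Sum>i\<in>(\<lambda>j. 2 * j) ` {..m}. semicircle_moment i * semicircle_moment (k - i))"
    by (intro sum.mono_neutral_right) (auto simp: k semicircle_moment_def elim!: evenE)
  also have "\<dots> = (\<Sum>j\<le>m. semicircle_moment (2 * j) * semicircle_moment (k - 2 * j))"
    by (subst sum.reindex) (auto simp: inj_on_def)
  also have "\<dots> = (\<Sum>j\<le>m. catalan j * catalan (m - j))"
  proof (rule sum.cong)
    fix j assume "j \<in> {..m}"
    have "k - 2 * j = 2 * (m - j)" by (simp add: k)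
    then show "semicircle_moment (2 * j) * semicircle_moment (k - 2 * j) = catalan j * catalan (m - j)"
      by (simp add: semicircle_moment_def)
  qed simp
  finally show ?thesis by (simp add: semicircle_moment_def k)
next
  case False
  then have "(\<Sum>i\<le>k. semicircle_moment i * semicircle_moment (k - i)) = 0"
    by (intro sum.neutral) (auto simp: semicircle_moment_def)
  then show ?thesis using False by (simp add: semicircle_moment_def)
qed

section \<open>Moments of the semicircle density\<close>

lemma semicircle_integral_0: "((\<lambda>x. sqrt (1 - x\<^sup>2)) has_integral (pi / 2)) {-1..1::real}"
proof -
  let ?F = "\<lambda>x::real. (x * sqrt (1 - x\<^sup>2) + arcsin x) / 2"
  have "((\<lambda>x. sqrt (1 - x\<^sup>2)) has_integral (?F 1 - ?F (-1))) {-1..1}"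
  \<comment> \<open>\<open>arcsin\<close> and \<open>sqrt (1 - x\<^sup>2)\<close> are not
    differentiable at the end points, hence the version that asks only for continuity there.\<close>
  proof (rule fundamental_theorem_of_calculus_interior)
    show "continuous_on {-1..1} ?F"
      by (intro continuous_intros) auto
    fix x :: real assume x: "x \<in> {-1<..<1}"
    then have pos: "0 < 1 - x\<^sup>2" by (simp add: abs_square_less_1 abs_less_iff)
    have d: "(?F has_real_derivative
        ((1 * sqrt (1 - x\<^sup>2) + x * ((- 2 * x) * (inverse (sqrt (1 - x\<^sup>2)) / 2))) + inverse (sqrt (1 - x\<^sup>2))) / 2) (at x)"
      using x pos by (auto intro!: derivative_eq_intros)
    have eq: "((1 * sqrt (1 - x\<^sup>2) + x * ((- 2 * x) * (inverse (sqrt (1 - x\<^sup>2)) / 2))) + inverse (sqrt (1 - x\<^sup>2))) / 2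
        = sqrt (1 - x\<^sup>2)"
    proof -
      have "inverse (sqrt (1 - x\<^sup>2)) * (1 - x\<^sup>2) = sqrt (1 - x\<^sup>2)"
        using pos by (simp add: real_div_sqrt field_simps)
      then show ?thesis by (simp add: algebra_simps power2_eq_square)
    qed
    show "(?F has_vector_derivative sqrt (1 - x\<^sup>2)) (at x)"
      using DERIV_cong[OF d eq] by (simp only: has_real_derivative_iff_has_vector_derivative)
  qed simp
  then show ?thesis by simp
qed

text \<open>Integration by parts against \<open>(1 - x^2) * sqrt (1 - x^2)\<close>, which vanishes at both end points.\<close>

lemma semicircle_integral_step:
  "((\<lambda>x. (a * x ^ k * (1 - x\<^sup>2) - 3 * x * g x) * sqrt (1 - x\<^sup>2)) has_integral 0) {-1..1::real}"
  if g: "\<And>x. (g has_real_derivative a * x ^ k) (at x)" for g :: "real \<Rightarrow> real"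
proof -
  let ?F = "\<lambda>x::real. g x * ((1 - x\<^sup>2) * sqrt (1 - x\<^sup>2))"
  have cont: "continuous_on {-1..1} g"
    using g by (meson DERIV_isCont continuous_at_imp_continuous_on)
  have "((\<lambda>x. (a * x ^ k * (1 - x\<^sup>2) - 3 * x * g x) * sqrt (1 - x\<^sup>2)) has_integral (?F 1 - ?F (-1))) {-1..1}"
  proof (rule fundamental_theorem_of_calculus_interior)
    show "continuous_on {-1..1} ?F"
      by (intro continuous_intros cont)
    fix x :: real assume x: "x \<in> {-1<..<1}"
    then have pos: "0 < 1 - x\<^sup>2" by (simp add: abs_square_less_1 abs_less_iff)
    have d: "(?F has_real_derivative
        (a * x ^ k * ((1 - x\<^sup>2) * sqrt (1 - x\<^sup>2)) +
          ((- 2 * x) * sqrt (1 - x\<^sup>2) + (- 2 * x) * (inverse (sqrt (1 - x\<^sup>2)) / 2) * (1 - x\<^sup>2)) * g x)) (at x)"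
      using x pos by (auto intro!: derivative_eq_intros g)
    have "inverse (sqrt (1 - x\<^sup>2)) * (1 - x\<^sup>2) = sqrt (1 - x\<^sup>2)"
      using pos by (simp add: real_div_sqrt field_simps)
    then have "(- 2 * x) * (inverse (sqrt (1 - x\<^sup>2)) / 2) * (1 - x\<^sup>2) = - x * sqrt (1 - x\<^sup>2)"
      by (simp add: mult.assoc)
    then have eq: "a * x ^ k * ((1 - x\<^sup>2) * sqrt (1 - x\<^sup>2)) +
        ((- 2 * x) * sqrt (1 - x\<^sup>2) + (- 2 * x) * (inverse (sqrt (1 - x\<^sup>2)) / 2) * (1 - x\<^sup>2)) * g x =
        (a * x ^ k * (1 - x\<^sup>2) - 3 * x * g x) * sqrt (1 - x\<^sup>2)"
      by (simp only:) (simp add: algebra_simps)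
    show "(?F has_vector_derivative (a * x ^ k * (1 - x\<^sup>2) - 3 * x * g x) * sqrt (1 - x\<^sup>2)) (at x)"
      using DERIV_cong[OF d eq] by (simp only: has_real_derivative_iff_has_vector_derivative)
  qed simp
  then show ?thesis by simp
qed

lemma semicircle_integrable: "(\<lambda>x. x ^ k * sqrt (1 - x\<^sup>2)) integrable_on {-1..1::real}"
  by (intro integrable_continuous_interval continuous_intros)

text \<open>Integration by parts with \<open>g x = x ^ Suc k\<close> relates the integrals for
  \<open>k + 2\<close> and \<open>k\<close> by the factor \<open>(k + 1) / (k + 4)\<close>. After
  scaling by powers of 2 this is the two-term recursion \<open>catalan_ratio\<close>.\<close>

lemma semicircle_integral:
  "integral {-1..1} (\<lambda>x. x ^ k * sqrt (1 - x\<^sup>2)) = pi / 2 * semicircle_moment k / 2 ^ k"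
proof (induction k rule: induct_nat_012)
  case 0
  then show ?case using integral_unique[OF semicircle_integral_0] by simp
next
  case 1
  \<comment> \<open>The constant \<open>g = 1\<close> with derivative 0 leaves only the multiple
    \<open>- 3 * x\<close> of the first moment.\<close>
  have "((\<lambda>x::real. (0 * x ^ 0 * (1 - x\<^sup>2) - 3 * x * 1) * sqrt (1 - x\<^sup>2)) has_integral 0) {-1..1}"
    by (rule semicircle_integral_step) auto
  from has_integral_mult_right[OF this, of "- 1 / 3"]
  have "((\<lambda>x. x * sqrt (1 - x\<^sup>2)) has_integral 0) {-1..1::real}" by simp
  then show ?case by (simp add: integral_unique)
next
  case (ge2 k)
  let ?J = "\<lambda>k. integral {-1..1} (\<lambda>x. x ^ k * sqrt (1 - x\<^sup>2)) :: real"
  have h1: "((\<lambda>x::real. (real (Suc k) * x ^ k * (1 - x\<^sup>2) - 3 * x * x ^ Suc k) * sqrt (1 - x\<^sup>2)) has_integral 0) {-1..1}"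
    by (rule semicircle_integral_step) (use DERIV_pow[of "Suc k"] in simp)
  have h2: "((\<lambda>x::real. real (Suc k) * (x ^ k * sqrt (1 - x\<^sup>2)) - real (k + 4) * (x ^ Suc (Suc k) * sqrt (1 - x\<^sup>2)))
      has_integral (real (Suc k) * ?J k - real (k + 4) * ?J (Suc (Suc k)))) {-1..1}"
    by (intro has_integral_diff has_integral_mult_right integrable_integral semicircle_integrable)
  have eq: "(\<lambda>x::real. (real (Suc k) * x ^ k * (1 - x\<^sup>2) - 3 * x * x ^ Suc k) * sqrt (1 - x\<^sup>2)) =
      (\<lambda>x::real. real (Suc k) * (x ^ k * sqrt (1 - x\<^sup>2)) - real (k + 4) * (x ^ Suc (Suc k) * sqrt (1 - x\<^sup>2)))"
    by (auto simp: fun_eq_iff algebra_simps power2_eq_square)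
  have "real (Suc k) * ?J k - real (k + 4) * ?J (Suc (Suc k)) = 0"
    using has_integral_unique[OF h2 h1[unfolded eq]] .
  then have J: "real (k + 4) * ?J (Suc (Suc k)) = real (Suc k) * ?J k" by simp
  have "real (k + 4) * semicircle_moment (Suc (Suc k)) = 4 * real (Suc k) * semicircle_moment k"
  proof (cases "even k")
    case True
    then obtain m where k: "k = 2 * m" by (elim evenE)
    have "real (k + 4) * semicircle_moment (Suc (Suc k)) = 2 * (real (m + 2) * catalan (Suc m))"
      by (simp add: semicircle_moment_def k del: catalan.simps)
    also have "\<dots> = 4 * real (Suc k) * semicircle_moment k"
      unfolding catalan_ratio by (simp add: semicircle_moment_def k)
    finally show ?thesis .
  qed (simp add: semicircle_moment_def)
  then have "real (k + 4) * (pi / 2 * semicircle_moment (Suc (Suc k)) / 2 ^ Suc (Suc k)) =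
      real (Suc k) * (pi / 2 * semicircle_moment k / 2 ^ k)"
    by (simp add: field_simps)
  with J ge2(1) have "real (k + 4) * ?J (Suc (Suc k)) = real (k + 4) * (pi / 2 * semicircle_moment (Suc (Suc k)) / 2 ^ Suc (Suc k))"
    by simp
  then show ?case by (subst (asm) mult_cancel_left) simp
qed

abbreviation semicircle :: "real measure" where
  "semicircle \<equiv> density lborel (\<lambda>x. ennreal (semicircle_density x))"

lemma semicircle_density_eq:
  "semicircle_density x = indicator {-1..1} x * (2 / pi * sqrt (1 - x\<^sup>2))"
  by (auto simp: semicircle_density_def indicator_def abs_le_iff)

lemma semicircle_density_nonneg: "0 \<le> semicircle_density x"
  unfolding semicircle_density_def by (auto simp: abs_square_le_1)

lemma semicircle_density_le_1: "semicircle_density x \<le> 1"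
proof -
  have "2 / pi * sqrt (1 - x\<^sup>2) \<le> 1 * 1" if "\<bar>x\<bar> \<le> 1"
    using that pi_gt3 by (intro mult_mono) (auto simp: abs_square_le_1)
  then show ?thesis by (simp add: semicircle_density_def)
qed

lemma semicircle_density_measurable [measurable]: "semicircle_density \<in> borel_measurable borel"
  unfolding semicircle_density_eq[abs_def] by measurable

lemma
  fixes f :: "real \<Rightarrow> real"
  assumes "continuous_on UNIV f"
  shows integrable_semicircle: "integrable semicircle f"
    and integral_semicircle: "integral\<^sup>L semicircle f = integral {-1..1} (\<lambda>x. 2 / pi * sqrt (1 - x\<^sup>2) * f x)"
proof -
  have [measurable]: "f \<in> borel_measurable borel"
    using assms by (rule borel_measurable_continuous_onI)
  let ?g = "\<lambda>x. 2 / pi * sqrt (1 - x\<^sup>2) * f x"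
  have eq: "(\<lambda>x. semicircle_density x * f x) = (\<lambda>x. indicator {-1..1} x *\<^sub>R ?g x)"
    by (auto simp: semicircle_density_eq fun_eq_iff)
  have int: "set_integrable lborel {-1..1} ?g"
    by (intro borel_integrable_atLeastAtMost' continuous_intros continuous_on_subset[OF assms]) auto
  show "integrable semicircle f"
    using int by (subst integrable_real_density) (auto simp: semicircle_density_nonneg eq set_integrable_def)
  have "integral\<^sup>L semicircle f = (LINT x:{-1..1}|lborel. ?g x)"
    by (subst integral_real_density) (auto simp: semicircle_density_nonneg eq set_lebesgue_integral_def)
  also have "\<dots> = integral {-1..1} ?g"
    by (rule set_borel_integral_eq_integral[OF int])
  finally show "integral\<^sup>L semicircle f = integral {-1..1} ?g" .
qed

lemma semicircle_moments: "(\<integral>x. x ^ k \<partial>semicircle) = semicircle_moment k / 2 ^ k"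
proof -
  have "(\<integral>x. x ^ k \<partial>semicircle) = integral {-1..1} (\<lambda>x. 2 / pi * (x ^ k * sqrt (1 - x\<^sup>2)))"
    by (subst integral_semicircle) (auto intro!: continuous_intros simp: mult_ac)
  also have "\<dots> = 2 / pi * (pi / 2 * semicircle_moment k / 2 ^ k)"
    unfolding integral_mult_right semicircle_integral ..
  finally show ?thesis by simp
qed

interpretation semicircle: prob_space semicircle
proof
  have "emeasure semicircle (space semicircle) = (\<integral>\<^sup>+x. 1 \<partial>semicircle)" by simp
  also have "\<dots> = ennreal (\<integral>x. (1::real) \<partial>semicircle)"
    using integrable_semicircle[of "\<lambda>_. 1"] nn_integral_eq_integral[of semicircle "\<lambda>_. 1"]
    by (simp del: nn_integral_const integral_const)
  also have "(\<integral>x. (1::real) \<partial>semicircle) = 1"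
    using semicircle_moments[of 0] by (simp only: power_0 semicircle_moment_0 div_by_1)
  finally show "emeasure semicircle (space semicircle) = 1" by simp
qed

section \<open>Polynomial bounds for indicators of half-lines\<close>

lemma AE_semicircle: "AE x in semicircle. \<bar>x\<bar> \<le> 1"
  by (subst AE_density) (auto simp: semicircle_density_def)

text \<open>The density is at most \<open>2 / pi < 1\<close>, so the distribution function is
  1-Lipschitz; this pays for shifting a half-line by the width of a ramp.\<close>

lemma semicircle_interval_le:
  assumes "a \<le> b"
  shows "semicircle_cdf b \<le> semicircle_cdf a + (b - a)"
proof -
  have "semicircle_cdf b = measure semicircle ({..a} \<union> {a<..b})"
    using assms by (simp add: semicircle_cdf_def cdf_def ivl_disj_un)
  also have "\<dots> \<le> semicircle_cdf a + measure semicircle {a<..b}"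
    unfolding semicircle_cdf_def cdf_def by (intro measure_Un_le) auto
  also have "emeasure semicircle {a<..b} \<le> ennreal (b - a)"
  proof -
    have "emeasure semicircle {a<..b} = (\<integral>\<^sup>+x. ennreal (semicircle_density x) * indicator {a<..b} x \<partial>lborel)"
      by (subst emeasure_density) auto
    also have "\<dots> \<le> (\<integral>\<^sup>+x. indicator {a<..b} x \<partial>lborel)"
      by (intro nn_integral_mono) (auto simp: indicator_def semicircle_density_le_1 ennreal_le_1)
    finally show ?thesis using assms by simp
  qed
  then have "measure semicircle {a<..b} \<le> b - a"
    using assms by (simp add: semicircle.emeasure_eq_measure)
  finally show ?thesis by simp
qed


text \<open>
  A Weierstrass approximation on \<open>[-2, 2]\<close> is corrected by \<open>(4 t^2 / 9) ^ K\<close>, which is tiny on \<open>[-1, 1]\<close> but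
  for large \<open>K\<close> dominates any given polynomial outside \<open>[-2, 2]\<close>.
\<close>

lemma semicircle_upper_polynomial:
  fixes f :: "real \<Rightarrow> real"
  assumes cont: "continuous_on UNIV f" and f: "\<And>t. 0 \<le> f t" "\<And>t. f t \<le> 1" and "0 < \<epsilon>"
  obtains P where "real_polynomial_function P" "\<And>t. f t \<le> P t"
    "integral\<^sup>L semicircle P \<le> integral\<^sup>L semicircle f + \<epsilon>"
proof -
  obtain g where g: "real_polynomial_function g" "\<And>t. t \<in> {-2..2} \<Longrightarrow> \<bar>f t - g t\<bar> < \<epsilon> / 4"
    using Stone_Weierstrass_real_polynomial_function[of "{-2..2::real}" f "\<epsilon> / 4"]
      continuous_on_subset[OF cont] \<open>0 < \<epsilon>\<close> by auto
  then obtain a d where gs: "g = (\<lambda>t. \<Sum>i\<le>d. a i * t ^ i)"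
    using real_polynomial_function_iff_sum[of g] by auto
  define C where "C = (\<Sum>i\<le>d. \<bar>a i\<bar>)"
  have C: "0 \<le> C" by (auto simp: C_def intro: sum_nonneg)
  \<comment> \<open>The factor 4/9 lies between 1/4 and 1. Hence \<open>4 / 9 * t\<^sup>2\<close> is
    at most 4/9 on \<open>[-1, 1]\<close> but exceeds 16/9 for \<open>\<bar>t\<bar> > 2\<close>, and
    with \<open>d \<le> K\<close> its power outgrows \<open>1 + C * \<bar>t\<bar> ^ d\<close>
    there.\<close>
  have "\<forall>\<^sub>F K in sequentially. (1 + C) * 2 ^ d < (16 / 9 :: real) ^ K"
  proof -
    obtain K0 where K0: "(1 + C) * 2 ^ d < (16 / 9 :: real) ^ K0"
      using real_arch_pow[of "16 / 9 :: real"] by auto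
    have "(1 + C) * 2 ^ d < (16 / 9 :: real) ^ K" if "K0 \<le> K" for K
      using K0 power_increasing[OF that, of "16 / 9 :: real"] by linarith
    then show ?thesis by (auto simp: eventually_sequentially)
  qed
  moreover have "\<forall>\<^sub>F K in sequentially. (4 / 9 :: real) ^ K < \<epsilon> / 4"
    using \<open>0 < \<epsilon>\<close> by (intro order_tendstoD(2)[OF LIMSEQ_power_zero]) auto
  moreover have "\<forall>\<^sub>F K in sequentially. d \<le> K" by (rule eventually_ge_at_top)
  ultimately have "\<forall>\<^sub>F K in sequentially. (1 + C) * 2 ^ d < (16 / 9 :: real) ^ K \<and>
      (4 / 9 :: real) ^ K < \<epsilon> / 4 \<and> d \<le> K"
    by eventually_elim auto
  then obtain K where K: "(1 + C) * 2 ^ d < (16 / 9 :: real) ^ K" "(4 / 9 :: real) ^ K < \<epsilon> / 4" "d \<le> K"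
    by (auto simp: eventually_sequentially)
  \<comment> \<open>The summand \<open>\<epsilon> / 4\<close> lifts \<open>g\<close> above
    \<open>f\<close> on \<open>[-2, 2]\<close>. On \<open>[-1, 1]\<close> the approximation error,
    this lift and the correction add up to less than \<open>\<epsilon>\<close>.\<close>
  define P where "P = (\<lambda>t. g t + \<epsilon> / 4 + (4 / 9 * (t * t)) ^ K)"
  have pow: "real_polynomial_function (\<lambda>t::real. (4 / 9 * (t * t)) ^ K)"
    by (intro real_polynomial_function_power real_polynomial_function.intros(2,4)
        real_polynomial_function.intros(1)[OF bounded_linear_ident])
  then have P: "real_polynomial_function P"
    unfolding P_def using g(1) by (intro real_polynomial_function.intros(2,3))
  have contP: "continuous_on UNIV P"
    using P by (intro continuous_on_polymonial_function) (simp add: real_polynomial_function_eq)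
  show thesis
  proof (rule that[OF P])
    fix t
    show "f t \<le> P t"
    proof (cases "t \<in> {-2..2}")
      case True
      have "0 \<le> (4 / 9 * (t * t)) ^ K" by (intro zero_le_power) simp
      then show ?thesis
        using g(2)[OF True] unfolding P_def by linarith
    next
      case False
      then have t: "2 < \<bar>t\<bar>" by auto
      have "\<bar>g t\<bar> \<le> (\<Sum>i\<le>d. \<bar>a i\<bar> * \<bar>t\<bar> ^ d)"
        unfolding gs using t
        by (intro order_trans[OF sum_abs] sum_mono) (auto simp: abs_mult power_abs intro!: mult_left_mono power_increasing)
      also have "\<dots> = C * \<bar>t\<bar> ^ d" by (simp add: C_def sum_distrib_right)
      finally have gt: "\<bar>g t\<bar> \<le> C * \<bar>t\<bar> ^ d" .
      define u where "u = \<bar>t\<bar> / 2"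
      have u: "1 < u" "\<bar>t\<bar> = 2 * u" using t by (auto simp: u_def)
      have "1 + C * \<bar>t\<bar> ^ d \<le> (1 + C) * \<bar>t\<bar> ^ d"
        using t by (simp add: distrib_right)
      also have "\<dots> = (1 + C) * 2 ^ d * u ^ d" by (simp add: u power_mult_distrib)
      also have "\<dots> \<le> (16 / 9) ^ K * u ^ (2 * K)"
        using K C u by (intro mult_mono power_increasing) auto
      also have "\<dots> = (16 / 9 * u\<^sup>2) ^ K"
        by (simp only: power_mult_distrib power_mult)
      also have "16 / 9 * u\<^sup>2 = 4 / 9 * (t * t)"
        by (simp add: u_def power_divide power2_eq_square)
      finally show ?thesis
        using gt f(2)[of t] \<open>0 < \<epsilon>\<close> by (simp add: P_def)
    qed
  next
    have "integral\<^sup>L semicircle P \<le> (\<integral>t. f t + \<epsilon> \<partial>semicircle)"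
    proof (rule integral_mono_AE)
      show "AE t in semicircle. P t \<le> f t + \<epsilon>"
        using AE_semicircle
      proof eventually_elim
        case (elim t)
        have "t * t \<le> 1" using elim by (simp add: abs_square_le_1 flip: power2_eq_square)
        then have "(4 / 9 * (t * t)) ^ K \<le> (4 / 9) ^ K" by (intro power_mono) auto
        moreover have "\<bar>f t - g t\<bar> < \<epsilon> / 4" using elim by (intro g) auto
        ultimately show ?case using K(2) unfolding P_def by linarith
      qed
    qed (auto intro!: integrable_semicircle contP cont continuous_intros)
    also have "\<dots> = integral\<^sup>L semicircle f + \<epsilon>"
      using integrable_semicircle[OF cont] semicircle.prob_space by simp
    finally show "integral\<^sup>L semicircle P \<le> integral\<^sup>L semicircle f + \<epsilon>" .
  qed
qed

text \<open>A continuous function between the indicators of the half-lines ending at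
  \<open>x - \<delta>\<close> and at \<open>x\<close>, so that Weierstrass approximation becomes
  applicable.\<close>

definition ramp :: "real \<Rightarrow> real \<Rightarrow> real \<Rightarrow> real" where
  "ramp x \<delta> t = max 0 (min 1 ((x - t) / \<delta>))"

lemma ramp_bounds: "0 \<le> ramp x \<delta> t" "ramp x \<delta> t \<le> 1"
  by (auto simp: ramp_def)

lemma continuous_ramp: "0 < \<delta> \<Longrightarrow> continuous_on UNIV (ramp x \<delta>)"
  unfolding ramp_def by (intro continuous_intros) auto

lemma ramp_le_indicator: "0 < \<delta> \<Longrightarrow> ramp x \<delta> t \<le> of_bool (t < x)"
  by (auto simp: ramp_def divide_nonpos_pos)

lemma indicator_le_ramp: "0 < \<delta> \<Longrightarrow> of_bool (t \<le> x - \<delta>) \<le> ramp x \<delta> t"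
  by (auto simp: ramp_def le_divide_eq)

lemma semicircle_cdf_eq: "semicircle_cdf x = (\<integral>t. indicator {..x} t \<partial>semicircle)"
  by (simp add: semicircle_cdf_def cdf_def)

lemma integral_ramp:
  assumes "0 < \<delta>"
  shows "integral\<^sup>L semicircle (ramp x \<delta>) \<le> semicircle_cdf x"
    and "semicircle_cdf (x - \<delta>) \<le> integral\<^sup>L semicircle (ramp x \<delta>)"
proof -
  have int: "integrable semicircle (\<lambda>t. indicator {..x} t :: real)" for x
    by (simp add: semicircle.emeasure_eq_measure)
  note ir = integrable_semicircle[OF continuous_ramp[OF assms]]
  show "integral\<^sup>L semicircle (ramp x \<delta>) \<le> semicircle_cdf x"
    unfolding semicircle_cdf_eq
  proof (intro integral_mono int ir)
    fix t show "ramp x \<delta> t \<le> indicator {..x} t"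
      using ramp_le_indicator[OF assms, of x t] ramp_bounds(2)[of x \<delta> t]
      by (auto simp: indicator_def split: if_splits)
  qed
  show "semicircle_cdf (x - \<delta>) \<le> integral\<^sup>L semicircle (ramp x \<delta>)"
    unfolding semicircle_cdf_eq
  proof (intro integral_mono int ir)
    fix t show "indicator {..x - \<delta>} t \<le> ramp x \<delta> t"
      using indicator_le_ramp[OF assms, of t x] by (auto simp: indicator_def)
  qed
qed

text \<open>The ramp used falls from 1 to 0 on \<open>[x, x + \<epsilon> / 2]\<close>. One half of
  \<open>\<epsilon>\<close> pays for this shift, the other for the polynomial above the
  ramp.\<close>

lemma semicircle_cdf_upper_polynomial:
  assumes "0 < \<epsilon>"
  obtains P where "real_polynomial_function P" "\<And>t. of_bool (t < x) \<le> P t"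
    "integral\<^sup>L semicircle P \<le> semicircle_cdf x + \<epsilon>"
proof -
  let ?\<delta> = "\<epsilon> / 2"
  have \<delta>: "0 < ?\<delta>" using assms by simp
  obtain P where P: "real_polynomial_function P" "\<And>t. ramp (x + ?\<delta>) ?\<delta> t \<le> P t"
    "integral\<^sup>L semicircle P \<le> integral\<^sup>L semicircle (ramp (x + ?\<delta>) ?\<delta>) + \<epsilon> / 2"
    using semicircle_upper_polynomial[OF continuous_ramp[OF \<delta>] ramp_bounds \<delta>, of "x + ?\<delta>"] by blast
  show thesis
  proof (rule that[OF P(1)])
    show "of_bool (t < x) \<le> P t" for t
      using indicator_le_ramp[OF \<delta>, of t "x + ?\<delta>"] P(2)[of t]
        ramp_bounds(1)[of "x + ?\<delta>" ?\<delta> t] by (cases "t < x") auto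
    show "integral\<^sup>L semicircle P \<le> semicircle_cdf x + \<epsilon>"
      using P(3) integral_ramp(1)[OF \<delta>, of "x + ?\<delta>"] semicircle_interval_le[of x "x + ?\<delta>"] \<delta> by simp
  qed
qed

text \<open>An upper polynomial for \<open>1 - ramp\<close>, subtracted from 1, lies below the ramp
  that ends at \<open>x\<close>.\<close>

lemma semicircle_cdf_lower_polynomial:
  assumes "0 < \<epsilon>"
  obtains P where "real_polynomial_function P" "\<And>t. P t \<le> of_bool (t < x)"
    "semicircle_cdf x - \<epsilon> \<le> integral\<^sup>L semicircle P"
proof -
  let ?\<delta> = "\<epsilon> / 2"
  have \<delta>: "0 < ?\<delta>" using assms by simp
  have cont: "continuous_on UNIV (\<lambda>t. 1 - ramp x ?\<delta> t)"
    by (intro continuous_intros continuous_ramp \<delta>)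
  obtain P where P: "real_polynomial_function P" "\<And>t. 1 - ramp x ?\<delta> t \<le> P t"
    "integral\<^sup>L semicircle P \<le> (\<integral>t. 1 - ramp x ?\<delta> t \<partial>semicircle) + \<epsilon> / 2"
    using semicircle_upper_polynomial[OF cont _ _ \<delta>] ramp_bounds by auto
  have contP: "continuous_on UNIV P"
    using P(1) by (intro continuous_on_polymonial_function) (simp add: real_polynomial_function_eq)
  have i1: "(\<integral>t. 1 - ramp x ?\<delta> t \<partial>semicircle) = 1 - integral\<^sup>L semicircle (ramp x ?\<delta>)"
    using integrable_semicircle[OF continuous_ramp[OF \<delta>]] semicircle.prob_space by simp
  have i2: "(\<integral>t. 1 - P t \<partial>semicircle) = 1 - integral\<^sup>L semicircle P"
    using integrable_semicircle[OF contP] semicircle.prob_space by simp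
  show thesis
  proof (rule that)
    show "real_polynomial_function (\<lambda>t. 1 - P t)"
      using P(1) by (intro real_polynomial_function_diff real_polynomial_function.intros(2))
    show "1 - P t \<le> of_bool (t < x)" for t
      using ramp_le_indicator[OF \<delta>, of x t] P(2)[of t] by linarith
    show "semicircle_cdf x - \<epsilon> \<le> (\<integral>t. 1 - P t \<partial>semicircle)"
      unfolding i2 using P(3) i1 integral_ramp(2)[OF \<delta>, of x] semicircle_interval_le[of "x - ?\<delta>" x] \<delta> by simp
  qed
qed

section \<open>Spectra of Hermitian matrices\<close>

lemma mult_mat_entry:
  fixes A B :: "'a::semiring_0 mat"
  assumes "A \<in> carrier_mat n n" "B \<in> carrier_mat n n" "i < n" "j < n"
  shows "(A * B) $$ (i, j) = (\<Sum>l<n. A $$ (i, l) * B $$ (l, j))"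
  using assms by (simp add: scalar_prod_def atLeast0LessThan)

text \<open>Restricting to \<open>j \<le> i\<close> keeps the claim inductive: entries of the power
  above the diagonal follow no such formula, but in the product they meet zero entries of
  \<open>B\<close>.\<close>

lemma upper_triangular_pow:
  fixes B :: "'a::comm_ring_1 mat"
  assumes B: "B \<in> carrier_mat n n" "upper_triangular B" and "i < n" "j \<le> i"
  shows "(B ^\<^sub>m k) $$ (i, j) = (if i = j then B $$ (i, i) ^ k else 0)"
  using assms(3,4)
proof (induction k arbitrary: i j)
  case 0
  then show ?case using B by auto
next
  case (Suc k)
  have tri: "B $$ (l, j) = 0" if "j < l" "l < n" for l
    using that B by (intro upper_triangularD) auto
  have "(B ^\<^sub>m Suc k) $$ (i, j) = (\<Sum>l<n. (B ^\<^sub>m k) $$ (i, l) * B $$ (l, j))"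
    unfolding pow_mat.simps using B Suc.prems by (intro mult_mat_entry) auto
  also have "\<dots> = (\<Sum>l<n. if l = i then B $$ (i, i) ^ k * B $$ (i, j) else 0)"
  proof (rule sum.cong)
    fix l assume l: "l \<in> {..<n}"
    show "(B ^\<^sub>m k) $$ (i, l) * B $$ (l, j) = (if l = i then B $$ (i, i) ^ k * B $$ (i, j) else 0)"
    proof (cases "l \<le> i")
      case True
      then show ?thesis using Suc.IH[OF Suc.prems(1) True] by simp
    next
      case False
      then show ?thesis using l Suc.prems tri[of l] by simp
    qed
  qed simp
  also have "\<dots> = B $$ (i, i) ^ k * B $$ (i, j)"
    using Suc.prems by simp
  finally show ?case
    using Suc.prems tri[of i] by (cases "i = j") auto
qed

lemma trace_similar_pow:
  fixes A :: "'a::comm_ring_1 mat"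
  assumes A: "A \<in> carrier_mat n n" and wit: "similar_mat_wit A B P Q"
  shows "(\<Sum>i<n. (A ^\<^sub>m k) $$ (i, i)) = (\<Sum>i<n. (B ^\<^sub>m k) $$ (i, i))"
proof -
  note D = similar_mat_witD2[OF A wit]
  have Bk: "B ^\<^sub>m k \<in> carrier_mat n n" using D by simp
  have PB: "P * B ^\<^sub>m k \<in> carrier_mat n n" using D Bk by simp
  have "(\<Sum>i<n. (A ^\<^sub>m k) $$ (i, i)) = (\<Sum>i<n. \<Sum>l<n. (P * B ^\<^sub>m k) $$ (i, l) * Q $$ (l, i))"
    unfolding similar_mat_wit_pow_id[OF wit] using D PB by (intro sum.cong refl mult_mat_entry) auto
  also have "\<dots> = (\<Sum>l<n. \<Sum>i<n. Q $$ (l, i) * (P * B ^\<^sub>m k) $$ (i, l))"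
    by (subst sum.swap) (simp only: mult.commute)
  also have "\<dots> = (\<Sum>l<n. (Q * (P * B ^\<^sub>m k)) $$ (l, l))"
    using D PB by (intro sum.cong refl mult_mat_entry[symmetric]) auto
  also have "Q * (P * B ^\<^sub>m k) = (Q * P) * B ^\<^sub>m k"
    using D Bk by (intro assoc_mult_mat[symmetric, of _ n n _ n _ n]) auto
  also have "\<dots> = B ^\<^sub>m k"
    using D Bk by simp
  finally show ?thesis .
qed

lemma hermitian_eigenvalue_real:
  fixes A :: "complex mat"
  assumes A: "A \<in> carrier_mat n n" and herm: "\<And>i j. i < n \<Longrightarrow> j < n \<Longrightarrow> A $$ (i, j) = cnj (A $$ (j, i))"
    and ev: "eigenvalue A a"
  shows "a \<in> \<real>"
proof -
  obtain v where v: "v \<in> carrier_vec n" "v \<noteq> 0\<^sub>v n" "A *\<^sub>v v = a \<cdot>\<^sub>v v"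
    using ev A by (auto simp: eigenvalue_def eigenvector_def)
  have row: "(\<Sum>j<n. A $$ (i, j) * v $ j) = a * v $ i" if "i < n" for i
    using arg_cong[OF v(3), of "\<lambda>u. u $ i"] that A v(1) by (simp add: scalar_prod_def atLeast0LessThan)
  define q where "q = (\<Sum>i<n. \<Sum>j<n. A $$ (i, j) * v $ j * cnj (v $ i))"
  define w where "w = (\<Sum>i<n. v $ i * cnj (v $ i))"
  have "q = (\<Sum>i<n. a * v $ i * cnj (v $ i))"
    unfolding q_def by (intro sum.cong refl) (simp add: sum_distrib_right[symmetric] row)
  then have q: "q = a * w" by (simp add: w_def sum_distrib_left mult.assoc)
  have "cnj q = (\<Sum>i<n. \<Sum>j<n. A $$ (j, i) * v $ i * cnj (v $ j))"
    unfolding q_def cnj_sum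
  proof (intro sum.cong refl)
    fix i j assume "i \<in> {..<n}" "j \<in> {..<n}"
    then have "cnj (A $$ (i, j)) = A $$ (j, i)" using herm[of j i] by simp
    then show "cnj (A $$ (i, j) * v $ j * cnj (v $ i)) = A $$ (j, i) * v $ i * cnj (v $ j)" by simp
  qed
  also have "\<dots> = q" unfolding q_def by (rule sum.swap)
  finally have cq: "cnj q = q" .
  have cw: "cnj w = w" by (simp add: w_def mult.commute)
  have "w \<noteq> 0"
  proof
    assume "w = 0"
    have "w = complex_of_real (\<Sum>i<n. (cmod (v $ i))\<^sup>2)"
      unfolding w_def of_real_sum by (intro sum.cong refl complex_norm_square[symmetric])
    with \<open>w = 0\<close> have "(\<Sum>i<n. (cmod (v $ i))\<^sup>2) = 0" by (metis of_real_eq_0_iff)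
    then have "v $ i = 0" if "i < n" for i
      using that by (subst (asm) sum_nonneg_eq_0_iff) auto
    then have "v = 0\<^sub>v n" using v(1) by (intro eq_vecI) auto
    with v(2) show False by simp
  qed
  have "cnj a * w = a * w" using cq cw q by (metis complex_cnj_mult)
  then have "cnj a = a" using \<open>w \<noteq> 0\<close> by simp
  then show ?thesis by (simp add: Reals_cnj_iff)
qed

text \<open>The diagonal of a Schur form is a single list that yields both the characteristic
  polynomial and all traces of powers. This links the empirical distribution with the moments; for
  traces of powers the triangular form is as good as a diagonal one.\<close>

lemma hermitian_spectrum:
  fixes A :: "complex mat"
  assumes A: "A \<in> carrier_mat n n" and herm: "\<And>i j. i < n \<Longrightarrow> j < n \<Longrightarrow> A $$ (i, j) = cnj (A $$ (j, i))"
  obtains es :: "real list" where "length es = n"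
    "char_poly A = (\<Prod>e\<leftarrow>es. [:- complex_of_real e, 1:])"
    "\<And>k. (\<Sum>i<n. (A ^\<^sub>m k) $$ (i, i)) = complex_of_real (\<Sum>e\<leftarrow>es. e ^ k)"
proof -
  obtain as where as: "char_poly A = (\<Prod>a\<leftarrow>as. [:- a, 1:])" "length as = n"
    using char_poly_factorized[OF A] by blast
  obtain B P Q where dec: "schur_decomposition A as = (B, P, Q)" by (metis prod_cases3)
  have sch: "similar_mat_wit A B P Q" "upper_triangular B" "diag_mat B = as"
    using schur_decomposition[OF A as(1) dec] by auto
  have B: "B \<in> carrier_mat n n" using similar_mat_witD2[OF A sch(1)] by simp
  have real: "a \<in> \<real>" if "a \<in> set as" for a
  proof (rule hermitian_eigenvalue_real[OF A herm])
    have "poly (char_poly A) a = 0"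
      unfolding as(1) using that by (induction as) auto
    then show "eigenvalue A a" using eigenvalue_root_char_poly[OF A] by simp
  qed
  define es where "es = map Re as"
  have as_eq: "as = map complex_of_real es"
    unfolding es_def using real by (auto simp: map_idI intro!: map_idI[symmetric])
  show thesis
  proof (rule that)
    show "length es = n" using as(2) by (simp add: es_def)
    show "char_poly A = (\<Prod>e\<leftarrow>es. [:- complex_of_real e, 1:])"
      unfolding as(1) as_eq by (simp add: o_def)
    fix k
    have "(\<Sum>i<n. (A ^\<^sub>m k) $$ (i, i)) = (\<Sum>i<n. B $$ (i, i) ^ k)"
      unfolding trace_similar_pow[OF A sch(1)] using B sch(2)
      by (intro sum.cong refl) (simp add: upper_triangular_pow)
    also have "\<dots> = (\<Sum>a\<leftarrow>diag_mat B. a ^ k)"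
      using B by (simp add: diag_mat_def o_def interv_sum_list_conv_sum_set_nat atLeast0LessThan)
    also have "\<dots> = complex_of_real (\<Sum>e\<leftarrow>es. e ^ k)"
      unfolding sch(3) as_eq by (induction es) auto
    finally show "(\<Sum>i<n. (A ^\<^sub>m k) $$ (i, i)) = complex_of_real (\<Sum>e\<leftarrow>es. e ^ k)" .
  qed
qed

lemma order_prod_linear:
  "Polynomial.order (complex_of_real t) (\<Prod>e\<leftarrow>es. [:- complex_of_real e, 1:]) = count_list es t"
proof (induction es)
  case Nil
  then show ?case by (simp add: order_0I)
next
  case (Cons e es)
  let ?q = "\<Prod>e\<leftarrow>es. [:- complex_of_real e, 1:]"
  have nz: "[:- complex_of_real e, 1:] * ?q \<noteq> 0"
    by (intro no_zero_divisors) (auto simp: prod_list_zero_iff)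
  have "Polynomial.order (complex_of_real t) [:- complex_of_real e, 1:] = of_bool (e = t)"
    using order_linear_power[of "complex_of_real t" "- complex_of_real e" 1] by auto
  then show ?case
    using order_mult[OF nz] Cons.IH by simp
qed

lemma empirical_eigenvalue_cdf_eq:
  assumes A: "A \<in> carrier_mat n n" and es: "char_poly A = (\<Prod>e\<leftarrow>es. [:- complex_of_real e, 1:])"
  shows "empirical_eigenvalue_cdf A x = (\<Sum>e\<leftarrow>es. of_bool (e < x)) / real n"
proof -
  have "poly (char_poly A) (complex_of_real t) = 0 \<longleftrightarrow> t \<in> set es" for t
    unfolding es by (induction es) auto
  then have "{t. eigenvalue A (complex_of_real t) \<and> t < x} = {t \<in> set es. t < x}"
    using eigenvalue_root_char_poly[OF A] by auto
  then have "(\<Sum>t | eigenvalue A (complex_of_real t) \<and> t < x. real (Polynomial.order (complex_of_real t) (char_poly A))) =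
      (\<Sum>t | t \<in> set es \<and> t < x. real (count_list es t))"
    by (simp add: es order_prod_linear)
  also have "\<dots> = real (\<Sum>t\<in>set es. count_list es t * of_bool (t < x))"
    unfolding of_nat_sum by (intro sum.mono_neutral_cong_left) auto
  also have "\<dots> = real (\<Sum>e\<leftarrow>es. of_bool (e < x))"
    unfolding sum_list_map_eq_sum_count ..
  also have "\<dots> = (\<Sum>e\<leftarrow>es. of_bool (e < x))"
    by (induction es) auto
  finally show ?thesis
    using A by (simp add: empirical_eigenvalue_cdf_def)
qed

lemma pow_mat_of_function:
  fixes X :: "'v \<Rightarrow> 'v \<Rightarrow> real"
  assumes xs: "distinct xs" and "i < length xs" "j < length xs"
  shows "((Matrix.mat (length xs) (length xs) (\<lambda>(i, j). complex_of_real (X (xs ! i) (xs ! j)))) ^\<^sub>m k) $$ (i, j) =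
    complex_of_real (mpow (set xs) X k (xs ! i) (xs ! j))"
  using assms(2,3)
proof (induction k arbitrary: j)
  case 0
  then show ?case using xs by (auto simp: nth_eq_iff_index_eq)
next
  case (Suc k)
  let ?n = "length xs"
  let ?A = "Matrix.mat ?n ?n (\<lambda>(i, j). complex_of_real (X (xs ! i) (xs ! j)))"
  have "(?A ^\<^sub>m Suc k) $$ (i, j) = (\<Sum>l<?n. (?A ^\<^sub>m k) $$ (i, l) * ?A $$ (l, j))"
    unfolding pow_mat.simps using Suc.prems by (intro mult_mat_entry) auto
  also have "\<dots> = (\<Sum>l<?n. complex_of_real (mpow (set xs) X k (xs ! i) (xs ! l) * X (xs ! l) (xs ! j)))"
    using Suc by (intro sum.cong refl) simp
  also have "\<dots> = (\<Sum>U\<in>set xs. complex_of_real (mpow (set xs) X k (xs ! i) U * X U (xs ! j)))"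
    by (rule sum.reindex_bij_betw[OF bij_betw_nth[OF xs refl refl], of "\<lambda>U. complex_of_real (mpow (set xs) X k (xs ! i) U * X U (xs ! j))"])
  also have "\<dots> = complex_of_real (mpow (set xs) X (Suc k) (xs ! i) (xs ! j))"
    using Suc.prems by (subst mpow_Suc_right) auto
  finally show ?case .
qed

lemma empirical_eigenvalue_cdf_of_function:
  fixes X :: "'v \<Rightarrow> 'v \<Rightarrow> real"
  assumes xs: "distinct xs" and sym: "\<And>S T. S \<in> set xs \<Longrightarrow> T \<in> set xs \<Longrightarrow> X S T = X T S"
  defines "A \<equiv> Matrix.mat (length xs) (length xs) (\<lambda>(i, j). complex_of_real (X (xs ! i) (xs ! j)))"
  obtains es where "length es = length xs"
    "\<And>x. empirical_eigenvalue_cdf A x = (\<Sum>e\<leftarrow>es. of_bool (e < x)) / real (length xs)"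
    "\<And>k. mtrace (set xs) (mpow (set xs) X k) = (\<Sum>e\<leftarrow>es. e ^ k)"
proof -
  let ?n = "length xs"
  have A: "A \<in> carrier_mat ?n ?n" by (simp add: A_def)
  have herm: "A $$ (i, j) = cnj (A $$ (j, i))" if "i < ?n" "j < ?n" for i j
    using that sym by (simp add: A_def)
  obtain es where es: "length es = ?n" "char_poly A = (\<Prod>e\<leftarrow>es. [:- complex_of_real e, 1:])"
    "\<And>k. (\<Sum>i<?n. (A ^\<^sub>m k) $$ (i, i)) = complex_of_real (\<Sum>e\<leftarrow>es. e ^ k)"
    using hermitian_spectrum[OF A herm] by blast
  show thesis
  proof (rule that[OF es(1)])
    show "empirical_eigenvalue_cdf A x = (\<Sum>e\<leftarrow>es. of_bool (e < x)) / real ?n" for x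
      by (rule empirical_eigenvalue_cdf_eq[OF A es(2)])
    fix k
    have "complex_of_real (mtrace (set xs) (mpow (set xs) X k)) = (\<Sum>i<?n. complex_of_real (mpow (set xs) X k (xs ! i) (xs ! i)))"
      unfolding mtrace_def of_real_sum
      by (rule sum.reindex_bij_betw[OF bij_betw_nth[OF xs refl refl], symmetric])
    also have "\<dots> = (\<Sum>i<?n. (A ^\<^sub>m k) $$ (i, i))"
      unfolding A_def by (intro sum.cong refl pow_mat_of_function[OF xs, symmetric]) auto
    finally show "mtrace (set xs) (mpow (set xs) X k) = (\<Sum>e\<leftarrow>es. e ^ k)"
      unfolding es(3) by (simp only: of_real_eq_iff)
  qed
qed

section \<open>The method of moments for random hypergraphs\<close>

lemma card_supersets:
  assumes "finite X" "U \<subseteq> X" "card U \<le> r"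
  shows "card {e. e \<subseteq> X \<and> card e = r \<and> U \<subseteq> e} = (card X - card U) choose (r - card U)"
proof -
  have finU: "finite U" using assms finite_subset by blast
  have fin: "finite e" if "e \<subseteq> X" for e using that assms finite_subset by blast
  have "bij_betw (\<lambda>e. e - U) {e. e \<subseteq> X \<and> card e = r \<and> U \<subseteq> e} {f. f \<subseteq> X - U \<and> card f = r - card U}"
  proof (rule bij_betw_byWitness[where f' = "\<lambda>f. f \<union> U"])
    show "(\<lambda>e. e - U) ` {e. e \<subseteq> X \<and> card e = r \<and> U \<subseteq> e} \<subseteq> {f. f \<subseteq> X - U \<and> card f = r - card U}"
      using fin finU by (auto simp: card_Diff_subset)
    show "(\<lambda>f. f \<union> U) ` {f. f \<subseteq> X - U \<and> card f = r - card U} \<subseteq> {e. e \<subseteq> X \<and> card e = r \<and> U \<subseteq> e}"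
    proof clarify
      fix f assume f: "f \<subseteq> X - U" "card f = r - card U"
      have "finite f" using f(1) fin by blast
      then have "card (f \<union> U) = card f + card U"
        using f(1) finU by (intro card_Un_disjoint) auto
      then show "f \<union> U \<subseteq> X \<and> card (f \<union> U) = r \<and> U \<subseteq> f \<union> U"
        using f assms by auto
    qed
  qed auto
  then have "card {e. e \<subseteq> X \<and> card e = r \<and> U \<subseteq> e} = card {f. f \<subseteq> X - U \<and> card f = r - card U}"
    by (rule bij_betw_same_card)
  also have "\<dots> = (card (X - U)) choose (r - card U)"
    using assms by (intro n_subsets) auto
  also have "card (X - U) = card X - card U"
    using assms finU by (simp add: card_Diff_subset)
  finally show ?thesis .
qed

lemma binomial_le_power: "n choose k \<le> n ^ k"
proof (cases "k \<le> n")
  case True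
  then show ?thesis by (rule binomial_le_pow)
qed (simp add: binomial_eq_0)

text \<open>The shift \<open>a\<close> is arbitrary because the absorption identity used in the
  induction lowers the upper index by one.\<close>

lemma tendsto_binomial_over_power:
  "(\<lambda>n. real ((n - a) choose k) / real n ^ k) \<longlonglongrightarrow> 1 / fact k"
proof (induction k arbitrary: a)
  case 0
  then show ?case by simp
next
  case (Suc k)
  have "(\<lambda>n. 1 - real a * inverse (real n)) \<longlonglongrightarrow> 1 - real a * 0"
    by (intro tendsto_intros lim_inverse_n)
  then have "(\<lambda>n. (1 - real a * inverse (real n)) * (real ((n - Suc a) choose k) / real n ^ k) / real (Suc k))
      \<longlonglongrightarrow> (1 - real a * 0) * (1 / fact k) / real (Suc k)"
    by (intro tendsto_divide[OF tendsto_mult[OF _ Suc.IH] tendsto_const]) auto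
  moreover have "\<forall>\<^sub>F n in sequentially. (1 - real a * inverse (real n)) * (real ((n - Suc a) choose k) / real n ^ k) / real (Suc k)
      = real ((n - a) choose Suc k) / real n ^ Suc k"
    using eventually_gt_at_top[of a]
  proof eventually_elim
    case (elim n)
    then have eq: "n - a = Suc (n - Suc a)" by simp
    have "real (Suc k) * real ((n - a) choose Suc k) = real (n - a) * real ((n - Suc a) choose k)"
      unfolding eq of_nat_mult[symmetric] Suc_times_binomial ..
    then have "real ((n - a) choose Suc k) = (real n - real a) * real ((n - Suc a) choose k) / real (Suc k)"
      using elim by (simp add: field_simps of_nat_diff)
    moreover have "1 - real a * inverse (real n) = (real n - real a) / real n"
      using elim by (simp add: field_simps)
    ultimately show ?case by simp
  qed
  ultimately have "(\<lambda>n. real ((n - a) choose Suc k) / real n ^ Suc k) \<longlonglongrightarrow> (1 - real a * 0) * (1 / fact k) / real (Suc k)"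
    by (rule Lim_transform_eventually)
  then show ?case by (simp add: mult.commute)
qed

section \<open>From moments to the limit law\<close>

lemma moments_tendsto:
  fixes T :: "nat \<Rightarrow> nat \<Rightarrow> real"
  assumes "\<forall>\<^sub>F n in sequentially. T n 0 = 1" "\<forall>\<^sub>F n in sequentially. T n (Suc 0) = 0"
    and rec: "\<And>k. (\<lambda>n. T n (Suc (Suc k)) - (\<Sum>i\<le>k. T n i * T n (k - i))) \<longlonglongrightarrow> 0"
  shows "(\<lambda>n. T n k) \<longlonglongrightarrow> semicircle_moment k"
proof (induction k rule: less_induct)
  case (less k)
  consider "k = 0" | "k = Suc 0" | l where "k = Suc (Suc l)"
    by (metis nat.exhaust)
  then show ?case
  proof cases
    case 1
    then show ?thesis using assms(1) by (auto intro: tendsto_eventually)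
  next
    case 2
    then show ?thesis using assms(2) by (auto intro: tendsto_eventually)
  next
    case 3
    have "(\<lambda>n. (T n k - (\<Sum>i\<le>l. T n i * T n (l - i))) + (\<Sum>i\<le>l. T n i * T n (l - i))) \<longlonglongrightarrow>
        0 + (\<Sum>i\<le>l. semicircle_moment i * semicircle_moment (l - i))"
      using 3 rec[of l] by (intro tendsto_intros less.IH) auto
    then show ?thesis by (simp add: 3 semicircle_moment_recursion)
  qed
qed

text \<open>Chebyshev's inequality, with \<open>c\<close> as the limit of the means rather than the
  mean itself.\<close>

lemma prob_tendsto_of_second_moment:
  fixes X :: "nat \<Rightarrow> 'a \<Rightarrow> real"
  assumes fin: "\<And>n. finite (set_pmf (P n))" and "0 < \<epsilon>"
    and lim: "(\<lambda>n. measure_pmf.expectation (P n) (\<lambda>h. (X n h - c)\<^sup>2)) \<longlonglongrightarrow> 0"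
  shows "(\<lambda>n. measure_pmf.prob (P n) {h. \<epsilon> \<le> \<bar>X n h - c\<bar>}) \<longlonglongrightarrow> 0"
proof (rule tendsto_sandwich[OF _ _ tendsto_const])
  have "measure_pmf.prob (P n) {h. \<epsilon> \<le> \<bar>X n h - c\<bar>} \<le> measure_pmf.expectation (P n) (\<lambda>h. (X n h - c)\<^sup>2) / \<epsilon>\<^sup>2" for n
  proof -
    have int: "integrable (P n) f" for f :: "'a \<Rightarrow> real"
      by (rule integrable_measure_pmf_finite[OF fin])
    have "measure_pmf.prob (P n) {h. \<epsilon> \<le> \<bar>X n h - c\<bar>} = measure_pmf.prob (P n) {h. \<epsilon>\<^sup>2 \<le> (X n h - c)\<^sup>2}"
      using \<open>0 < \<epsilon>\<close> by (intro arg_cong[of _ _ "measure_pmf.prob (P n)"]) (auto simp: abs_le_square_iff[symmetric])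
    also have "\<dots> \<le> measure_pmf.expectation (P n) (\<lambda>h. (X n h - c)\<^sup>2) / \<epsilon>\<^sup>2"
      using integral_Markov_inequality_measure[of "P n" "\<lambda>h. (X n h - c)\<^sup>2" "{}" "\<epsilon>\<^sup>2"] int \<open>0 < \<epsilon>\<close> by simp
    finally show ?thesis .
  qed
  then show "\<forall>\<^sub>F n in sequentially. measure_pmf.prob (P n) {h. \<epsilon> \<le> \<bar>X n h - c\<bar>} \<le>
      measure_pmf.expectation (P n) (\<lambda>h. (X n h - c)\<^sup>2) / \<epsilon>\<^sup>2" by simp
  show "(\<lambda>n. measure_pmf.expectation (P n) (\<lambda>h. (X n h - c)\<^sup>2) / \<epsilon>\<^sup>2) \<longlonglongrightarrow> 0"
    using tendsto_divide[OF lim tendsto_const, of "\<epsilon>\<^sup>2"] \<open>0 < \<epsilon>\<close> by simp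
qed simp

lemma integral_semicircle_polynomial:
  "(\<integral>t. (\<Sum>i\<le>d. a i * t ^ i) \<partial>semicircle) = (\<Sum>i\<le>d. a i * (semicircle_moment i / 2 ^ i))"
proof -
  have "integrable semicircle (\<lambda>t. a i * t ^ i)" for i
    by (intro integrable_semicircle continuous_intros)
  then show ?thesis
    by (simp add: Bochner_Integration.integral_sum semicircle_moments)
qed

text \<open>The expected squared deviation expands into expectations of single moments and of
  products of two. As the limits of the latter factorise, it tends to
  \<open>c\<^sup>2 - 2 * c\<^sup>2 + c\<^sup>2 = 0\<close>, where \<open>c\<close> is the semicircle
  integral of the polynomial.\<close>

lemma polynomial_moments_in_probability:
  fixes \<tau> :: "nat \<Rightarrow> nat \<Rightarrow> 'a \<Rightarrow> real"
  assumes fin: "\<And>n. finite (set_pmf (P n))" and "0 < \<epsilon>"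
    and m: "\<And>k. (\<lambda>n. measure_pmf.expectation (P n) (\<tau> n k)) \<longlonglongrightarrow> semicircle_moment k"
    and cov: "\<And>k l. (\<lambda>n. measure_pmf.expectation (P n) (\<lambda>h. \<tau> n k h * \<tau> n l h)) \<longlonglongrightarrow>
        semicircle_moment k * semicircle_moment l"
  shows "(\<lambda>n. measure_pmf.prob (P n) {h. \<epsilon> \<le> \<bar>(\<Sum>i\<le>d. a i * (\<tau> n i h / 2 ^ i)) -
      (\<integral>t. (\<Sum>i\<le>d. a i * t ^ i) \<partial>semicircle)\<bar>}) \<longlonglongrightarrow> 0"
proof (rule prob_tendsto_of_second_moment[OF fin \<open>0 < \<epsilon>\<close>])
  define b where "b = (\<lambda>i. a i / 2 ^ i)"
  define c where "c = (\<Sum>i\<le>d. b i * semicircle_moment i)"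
  have int: "integrable (P n) f" for n and f :: "'a \<Rightarrow> real"
    by (rule integrable_measure_pmf_finite[OF fin])
  have c: "(\<integral>t. (\<Sum>i\<le>d. a i * t ^ i) \<partial>semicircle) = c"
    by (simp add: integral_semicircle_polynomial c_def b_def)
  have "(\<lambda>h. ((\<Sum>i\<le>d. a i * (\<tau> n i h / 2 ^ i)) - c)\<^sup>2) =
      (\<lambda>h. (\<Sum>i\<le>d. \<Sum>j\<le>d. b i * b j * (\<tau> n i h * \<tau> n j h)) - 2 * c * (\<Sum>i\<le>d. b i * \<tau> n i h) + c\<^sup>2)" for n
  proof
    fix h
    have "(\<Sum>i\<le>d. a i * (\<tau> n i h / 2 ^ i)) = (\<Sum>i\<le>d. b i * \<tau> n i h)" by (simp add: b_def)
    moreover have "(\<Sum>i\<le>d. b i * \<tau> n i h) * (\<Sum>i\<le>d. b i * \<tau> n i h) =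
        (\<Sum>i\<le>d. \<Sum>j\<le>d. b i * b j * (\<tau> n i h * \<tau> n j h))"
      by (simp add: sum_product mult_ac)
    ultimately show "((\<Sum>i\<le>d. a i * (\<tau> n i h / 2 ^ i)) - c)\<^sup>2 =
        (\<Sum>i\<le>d. \<Sum>j\<le>d. b i * b j * (\<tau> n i h * \<tau> n j h)) - 2 * c * (\<Sum>i\<le>d. b i * \<tau> n i h) + c\<^sup>2"
      by (simp add: power2_eq_square algebra_simps)
  qed
  then have E: "measure_pmf.expectation (P n) (\<lambda>h. ((\<Sum>i\<le>d. a i * (\<tau> n i h / 2 ^ i)) - c)\<^sup>2) =
      (\<Sum>i\<le>d. \<Sum>j\<le>d. b i * b j * measure_pmf.expectation (P n) (\<lambda>h. \<tau> n i h * \<tau> n j h)) -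
      2 * c * (\<Sum>i\<le>d. b i * measure_pmf.expectation (P n) (\<tau> n i)) + c\<^sup>2" for n
    by (simp add: int Bochner_Integration.integral_sum)
  have "(\<lambda>n. measure_pmf.expectation (P n) (\<lambda>h. ((\<Sum>i\<le>d. a i * (\<tau> n i h / 2 ^ i)) - c)\<^sup>2)) \<longlonglongrightarrow>
      (\<Sum>i\<le>d. \<Sum>j\<le>d. b i * b j * (semicircle_moment i * semicircle_moment j)) -
      2 * c * (\<Sum>i\<le>d. b i * semicircle_moment i) + c\<^sup>2"
    unfolding E by (intro tendsto_intros m cov)
  moreover have "(\<Sum>i\<le>d. \<Sum>j\<le>d. b i * b j * (semicircle_moment i * semicircle_moment j)) = c * c"
    unfolding c_def by (simp add: sum_product mult_ac)
  ultimately show "(\<lambda>n. measure_pmf.expectation (P n) (\<lambda>h. ((\<Sum>i\<le>d. a i * (\<tau> n i h / 2 ^ i)) -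
      (\<integral>t. (\<Sum>i\<le>d. a i * t ^ i) \<partial>semicircle))\<^sup>2)) \<longlonglongrightarrow> 0"
    unfolding c by (simp add: c_def[symmetric] power2_eq_square)
qed

text \<open>
  \<open>G n h\<close> stands for the empirical distribution function and \<open>es\<close> for the eigenvalues of the matrix
  normalised by the radius \<open>2 * sqrt \<rho>\<close>; \<open>\<tau>\<close> are the moments normalised by \<open>sqrt \<rho>\<close>, whence the factor \<open>2 ^ k\<close>.
\<close>

lemma semicircle_law_of_moments:
  fixes \<tau> :: "nat \<Rightarrow> nat \<Rightarrow> 'a \<Rightarrow> real" and G :: "nat \<Rightarrow> 'a \<Rightarrow> real \<Rightarrow> real"
  assumes fin: "\<And>n. finite (set_pmf (P n))" and "0 < \<epsilon>"
    and m: "\<And>k. (\<lambda>n. measure_pmf.expectation (P n) (\<tau> n k)) \<longlonglongrightarrow> semicircle_moment k"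
    and cov: "\<And>k l. (\<lambda>n. measure_pmf.expectation (P n) (\<lambda>h. \<tau> n k h * \<tau> n l h)) \<longlonglongrightarrow>
        semicircle_moment k * semicircle_moment l"
    and spec: "\<forall>\<^sub>F n in sequentially. \<forall>h\<in>set_pmf (P n). \<exists>es.
        (\<forall>x. G n h x = (\<Sum>e\<leftarrow>es. of_bool (e < x)) / N n) \<and>
        (\<forall>k. \<tau> n k h / 2 ^ k = (\<Sum>e\<leftarrow>es. e ^ k) / N n) \<and> 0 < N n"
  shows "(\<lambda>n. measure_pmf.prob (P n) {h. \<bar>G n h x - semicircle_cdf x\<bar> > \<epsilon>}) \<longlonglongrightarrow> 0"
proof -
  let ?\<epsilon> = "\<epsilon> / 2"
  have \<epsilon>: "0 < ?\<epsilon>" using \<open>0 < \<epsilon>\<close> by simp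
  obtain p where p: "real_polynomial_function p" "\<And>t. of_bool (t < x) \<le> p t"
    "integral\<^sup>L semicircle p \<le> semicircle_cdf x + ?\<epsilon>"
    using semicircle_cdf_upper_polynomial[OF \<epsilon>] by blast
  obtain a d where a: "p = (\<lambda>t. \<Sum>i\<le>d. a i * t ^ i)"
    using p(1) unfolding real_polynomial_function_iff_sum by blast
  obtain q where q: "real_polynomial_function q" "\<And>t. q t \<le> of_bool (t < x)"
    "semicircle_cdf x - ?\<epsilon> \<le> integral\<^sup>L semicircle q"
    using semicircle_cdf_lower_polynomial[OF \<epsilon>] by blast
  obtain b d' where b: "q = (\<lambda>t. \<Sum>i\<le>d'. b i * t ^ i)"
    using q(1) unfolding real_polynomial_function_iff_sum by blast
  note up = p(2,3)[unfolded a] and lo = q(2,3)[unfolded b]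
  let ?U = "\<lambda>n h. (\<Sum>i\<le>d. a i * (\<tau> n i h / 2 ^ i))" and ?u = "\<integral>t. (\<Sum>i\<le>d. a i * t ^ i) \<partial>semicircle"
  let ?L = "\<lambda>n h. (\<Sum>i\<le>d'. b i * (\<tau> n i h / 2 ^ i))" and ?l = "\<integral>t. (\<Sum>i\<le>d'. b i * t ^ i) \<partial>semicircle"
  \<comment> \<open>Outside these two events the spectral means of both polynomials are within
    \<open>\<epsilon> / 2\<close> of their semicircle integrals, which bound the distribution
    function up to another \<open>\<epsilon> / 2\<close>; the value of \<open>G\<close> lies between
    the two means.\<close>
  let ?A = "\<lambda>n. {h. ?\<epsilon> \<le> \<bar>?U n h - ?u\<bar>}" and ?B = "\<lambda>n. {h. ?\<epsilon> \<le> \<bar>?L n h - ?l\<bar>}"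
  have poly_eq: "(\<Sum>i\<le>D. c i * (\<tau> n i h / 2 ^ i)) = (\<Sum>e\<leftarrow>es. \<Sum>i\<le>D. c i * e ^ i) / N n"
    if "\<forall>k. \<tau> n k h / 2 ^ k = (\<Sum>e\<leftarrow>es. e ^ k) / N n" for D c n h es
  proof -
    have "(\<Sum>e\<leftarrow>es. \<Sum>i\<le>D. c i * e ^ i) = (\<Sum>i\<le>D. c i * (\<Sum>e\<leftarrow>es. e ^ i))"
      by (induction es) (simp_all add: sum.distrib distrib_left)
    then show ?thesis using that by (simp add: sum_divide_distrib)
  qed
  show ?thesis
  proof (rule tendsto_sandwich[OF _ _ tendsto_const])
    show "\<forall>\<^sub>F n in sequentially. measure_pmf.prob (P n) {h. \<bar>G n h x - semicircle_cdf x\<bar> > \<epsilon>} \<le>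
        measure_pmf.prob (P n) (?A n) + measure_pmf.prob (P n) (?B n)"
      using spec
    proof eventually_elim
      case (elim n)
      have "AE h in P n. h \<in> {h. \<bar>G n h x - semicircle_cdf x\<bar> > \<epsilon>} \<longrightarrow> h \<in> ?A n \<union> ?B n"
      proof (rule AE_pmfI, rule impI)
        fix h assume h: "h \<in> set_pmf (P n)" "h \<in> {h. \<bar>G n h x - semicircle_cdf x\<bar> > \<epsilon>}"
        obtain es where es: "G n h x = (\<Sum>e\<leftarrow>es. of_bool (e < x)) / N n"
          "\<forall>k. \<tau> n k h / 2 ^ k = (\<Sum>e\<leftarrow>es. e ^ k) / N n" "0 < N n"
          using elim h(1) by blast
        have "G n h x \<le> ?U n h"
          unfolding es(1) poly_eq[OF es(2)] using es(3) up(1)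
          by (intro divide_right_mono sum_list_mono) auto
        moreover have "?L n h \<le> G n h x"
          unfolding es(1) poly_eq[OF es(2)] using es(3) lo(1)
          by (intro divide_right_mono sum_list_mono) auto
        ultimately show "h \<in> ?A n \<union> ?B n"
          using h(2) up(2) lo(2) unfolding Un_iff mem_Collect_eq by linarith
      qed
      then have "measure_pmf.prob (P n) {h. \<bar>G n h x - semicircle_cdf x\<bar> > \<epsilon>} \<le> measure_pmf.prob (P n) (?A n \<union> ?B n)"
        by (intro measure_pmf.finite_measure_mono_AE) auto
      also have "\<dots> \<le> measure_pmf.prob (P n) (?A n) + measure_pmf.prob (P n) (?B n)"
        by (intro measure_Un_le) auto
      finally show ?case .
    qed
    show "(\<lambda>n. measure_pmf.prob (P n) (?A n) + measure_pmf.prob (P n) (?B n)) \<longlonglongrightarrow> 0"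
      using tendsto_add[OF polynomial_moments_in_probability[OF fin \<epsilon> m cov]
          polynomial_moments_in_probability[OF fin \<epsilon> m cov]] by simp
  qed simp
qed

lemma edge_matrix_moments_tendsto:
  fixes V :: "nat \<Rightarrow> 'v set" and Es :: "nat \<Rightarrow> 'e set" and A :: "'e \<Rightarrow> 'v \<Rightarrow> 'v \<Rightarrow> real" and B :: nat
    and p D D0 D2 \<delta> :: "nat \<Rightarrow> real"
  assumes L: "\<forall>\<^sub>F n in sequentially.
      mixing_edge_matrix (V n) (Es n) inc A (p n) (D n) B adj (D0 n) (D2 n) (\<delta> n)"
    and rho: "filterlim (\<lambda>n. p n * (1 - p n) * D n) at_top sequentially"
    and N: "filterlim (\<lambda>n. real (card (V n))) at_top sequentially"
    and g: "(\<lambda>n. D0 n * real (card (V n)) / D n) \<longlonglongrightarrow> 1"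
    and D2: "(\<lambda>n. D2 n / D n) \<longlonglongrightarrow> 0" "\<forall>\<^sub>F n in sequentially. 0 < D2 n"
    and \<delta>: "\<delta> \<longlonglongrightarrow> 0"
  defines "t \<equiv> \<lambda>n. mixing_edge_matrix.\<tau> (V n) (Es n) A (p n) (D n)"
    and "P \<equiv> \<lambda>n. Pi_pmf (Es n) False (\<lambda>_. bernoulli_pmf (p n))"
  shows "(\<lambda>n. measure_pmf.expectation (P n) (t n k)) \<longlonglongrightarrow> semicircle_moment k"
    and "(\<lambda>n. measure_pmf.expectation (P n) (\<lambda>h. t n k h * t n l h)) \<longlonglongrightarrow>
      semicircle_moment k * semicircle_moment l"
proof -
  define T where "T = (\<lambda>n k. measure_pmf.expectation (P n) (t n k))"
  \<comment> \<open>These constants depend on \<open>B\<close> but not on the remaining parameters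
    of the locale, so they are the same for all \<open>n\<close>.\<close>
  define wb where "wb = random_edge_matrix.walk_bound B"
  define cb where "cb = random_edge_matrix.cov_bound B"
  have cN: "(\<lambda>n. c / real (card (V n))) \<longlonglongrightarrow> 0" for c
    by (intro tendsto_divide_0[OF tendsto_const] filterlim_at_top_imp_at_infinity N)
  have "(\<lambda>n. T n (Suc (Suc k)) - (\<Sum>i\<le>k. T n i * T n (k - i))) \<longlonglongrightarrow> 0" for k
  proof (rule Lim_null_comparison)
    \<comment> \<open>The choice \<open>\<eta> = sqrt (D2 / D)\<close> equalises the terms
      \<open>D2 / D / \<eta>\<close> and \<open>\<eta>\<close>; this is why the same square root
      appears twice.\<close>
    let ?err = "\<lambda>n. real (k + 2) * wb (Suc (Suc k)) / sqrt (p n * (1 - p n) * D n) +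
        (\<Sum>i\<le>k. (real B ^ 2 * (sqrt (D2 n / D n) + sqrt (D2 n / D n)) + D0 n * real (card (V n)) / D n * \<delta> n) / 2 *
            (wb (i + i) + wb (k - i + (k - i))) +
          (\<bar>D0 n * real (card (V n)) / D n - 1\<bar> * (wb i * wb (k - i) + cb i (k - i) / real (card (V n))) +
           cb i (k - i) / real (card (V n))))"
    show "\<forall>\<^sub>F n in sequentially. norm (T n (Suc (Suc k)) - (\<Sum>i\<le>k. T n i * T n (k - i))) \<le> ?err n"
      using L D2(2)
    proof eventually_elim
      case (elim n)
      interpret mixing_edge_matrix "V n" "Es n" inc A "p n" "D n" B adj "D0 n" "D2 n" "\<delta> n"
        by (rule elim)
      have pos: "0 < D2 n / D n" using elim D_pos by simp
      then have \<eta>: "0 < sqrt (D2 n / D n)" by simp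
      have "D2 n / D n / sqrt (D2 n / D n) = sqrt (D2 n / D n)"
        using pos by (intro real_div_sqrt) simp
      then show ?case
        using moment_recursion_error[OF \<eta>, of k] unfolding form_error_def \<Omega>_def \<rho>_def
        by (simp add: T_def P_def t_def wb_def cb_def)
    qed
    have "(\<lambda>n. real (k + 2) * wb (Suc (Suc k)) / sqrt (p n * (1 - p n) * D n)) \<longlonglongrightarrow> 0"
      by (intro tendsto_divide_0[OF tendsto_const] filterlim_at_top_imp_at_infinity
          filterlim_compose[OF sqrt_at_top rho])
    then have "?err \<longlonglongrightarrow> 0 + (\<Sum>i\<le>k. (real B ^ 2 * (sqrt 0 + sqrt 0) + 1 * 0) / 2 * (wb (i + i) + wb (k - i + (k - i))) +
          (\<bar>1 - 1\<bar> * (wb i * wb (k - i) + 0) + 0))"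
      by (intro tendsto_add tendsto_sum tendsto_mult tendsto_divide tendsto_const tendsto_real_sqrt
          tendsto_rabs tendsto_diff cN g D2(1) \<delta>) auto
    then show "?err \<longlonglongrightarrow> 0" by simp
  qed
  moreover have "\<forall>\<^sub>F n in sequentially. T n 0 = 1" "\<forall>\<^sub>F n in sequentially. T n (Suc 0) = 0"
    using L by (eventually_elim, simp add: T_def P_def t_def mixing_edge_matrix.E_\<tau>_0 mixing_edge_matrix.E_\<tau>_1
        random_edge_matrix.\<Omega>_def[OF mixing_edge_matrix.axioms(1), symmetric])+
  ultimately have T: "(\<lambda>n. T n k) \<longlonglongrightarrow> semicircle_moment k" for k
    by (intro moments_tendsto)
  then show "(\<lambda>n. measure_pmf.expectation (P n) (t n k)) \<longlonglongrightarrow> semicircle_moment k"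
    by (simp add: T_def)
  have "(\<lambda>n. measure_pmf.expectation (P n) (\<lambda>h. t n k h * t n l h) - T n k * T n l) \<longlonglongrightarrow> 0"
  proof (rule Lim_null_comparison[OF _ cN[of "cb k l"]])
    show "\<forall>\<^sub>F n in sequentially. norm (measure_pmf.expectation (P n) (\<lambda>h. t n k h * t n l h) - T n k * T n l)
        \<le> cb k l / real (card (V n))"
      using L
    proof eventually_elim
      case (elim n)
      interpret mixing_edge_matrix "V n" "Es n" inc A "p n" "D n" B adj "D0 n" "D2 n" "\<delta> n"
        by (rule elim)
      show ?case
        using cov_\<tau>_le[of k l] unfolding \<Omega>_def by (simp add: T_def P_def t_def cb_def)
    qed
  qed
  from tendsto_add[OF this tendsto_mult[OF T[of k] T[of l]]]
  show "(\<lambda>n. measure_pmf.expectation (P n) (\<lambda>h. t n k h * t n l h)) \<longlonglongrightarrow>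
      semicircle_moment k * semicircle_moment l"
    by simp
qed

section \<open>The centred weight matrix of the random hypergraph\<close>

definition subsets_of_size :: "nat \<Rightarrow> nat \<Rightarrow> nat set set" where
  "subsets_of_size n k = {S. S \<subseteq> {1..n} \<and> card S = k}"

definition disjoint_in :: "nat set \<Rightarrow> nat set \<Rightarrow> nat set \<Rightarrow> real" where
  "disjoint_in e S T = of_bool (S \<inter> T = {} \<and> S \<union> T \<subseteq> e)"

lemma finite_subsets_of_size [simp]: "finite (subsets_of_size n k)"
  unfolding subsets_of_size_def by (rule finite_subset[of _ "Pow {1..n}"]) auto

lemma card_subsets_of_size: "card (subsets_of_size n k) = n choose k"
  using n_subsets[of "{1..n}" k] by (simp add: subsets_of_size_def)

lemma card_supersets_of_size:
  assumes "U \<subseteq> {1..n}" "card U \<le> r"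
  shows "card {e \<in> subsets_of_size n r. U \<subseteq> e} = (n - card U) choose (r - card U)"
  using card_supersets[OF _ assms] by (simp add: subsets_of_size_def conj_assoc)

text \<open>\<open>D\<close> counts the pairs of an edge containing \<open>S\<close> and a disjoint
  \<open>s\<close>-set inside it, and \<open>2 * s \<le> r\<close> makes it dominate the number of
  edges at \<open>S\<close>. Two distinct \<open>s\<close>-sets have at least \<open>s + 1\<close>
  elements in their union, leaving at most \<open>r - s - 1\<close> free ones;
  \<open>\<delta>\<close> is the proportion of \<open>s\<close>-sets that meet a given one.\<close>

lemma mixing_hypergraph:
  assumes s: "1 \<le> s" "2 * s \<le> r" and n: "r \<le> n" and p: "0 \<le> p" "p \<le> 1"
    and rho: "1 \<le> p * (1 - p) * (real ((r - s) choose s) * real ((n - s) choose (r - s)))"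
  shows "mixing_edge_matrix (subsets_of_size n s) (subsets_of_size n r) (\<subseteq>) disjoint_in p
    (real ((r - s) choose s) * real ((n - s) choose (r - s))) (r choose s) (\<lambda>S T. S \<inter> T = {})
    (real ((n - 2 * s) choose (r - 2 * s))) (real n ^ (r - s - 1))
    (1 - real ((n - s) choose s) / real (n choose s))"
proof
  fix e S T
  show "disjoint_in e S T = 0 \<or> disjoint_in e S T = 1" by (simp add: disjoint_in_def)
  show "disjoint_in e S T = disjoint_in e T S" by (auto simp: disjoint_in_def Int_commute Un_commute)
  show "disjoint_in e S T \<noteq> 0 \<Longrightarrow> S \<subseteq> e \<and> T \<subseteq> e" by (simp add: disjoint_in_def)
next
  fix e assume e: "e \<in> subsets_of_size n r"
  have "{S \<in> subsets_of_size n s. S \<subseteq> e} = {S. S \<subseteq> e \<and> card S = s}"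
    using e by (auto simp: subsets_of_size_def)
  then show "card {S \<in> subsets_of_size n s. S \<subseteq> e} \<le> r choose s"
    using e n_subsets[of e s] finite_subset[of e "{1..n}"] by (auto simp: subsets_of_size_def)
next
  fix S assume S: "S \<in> subsets_of_size n s"
  have "card {e \<in> subsets_of_size n r. S \<subseteq> e} = (n - s) choose (r - s)"
    using S s card_supersets_of_size[of S n r] by (simp add: subsets_of_size_def)
  moreover have "1 * real ((n - s) choose (r - s)) \<le> real ((r - s) choose s) * real ((n - s) choose (r - s))"
    using s by (intro mult_right_mono) (auto simp: Suc_le_eq)
  ultimately show "real (card {e \<in> subsets_of_size n r. S \<subseteq> e}) \<le> real ((r - s) choose s) * real ((n - s) choose (r - s))"
    by simp
next
  fix S T assume S: "S \<in> subsets_of_size n s" and T: "T \<in> subsets_of_size n s"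
  have fin: "finite S" "finite T"
    using S T finite_subset[of _ "{1..n}"] by (auto simp: subsets_of_size_def)
  show "(\<Sum>e\<in>subsets_of_size n r. disjoint_in e S T) = real ((n - 2 * s) choose (r - 2 * s)) * of_bool (S \<inter> T = {})"
  proof (cases "S \<inter> T = {}")
    case True
    then have c: "card (S \<union> T) = 2 * s"
      using S T fin by (simp add: card_Un_disjoint subsets_of_size_def)
    have "(\<Sum>e\<in>subsets_of_size n r. disjoint_in e S T) = real (card {e \<in> subsets_of_size n r. S \<union> T \<subseteq> e})"
      using True by (simp add: disjoint_in_def Int_def)
    also have "card {e \<in> subsets_of_size n r. S \<union> T \<subseteq> e} = (n - 2 * s) choose (r - 2 * s)"
      using S T s c card_supersets_of_size[of "S \<union> T" n r] by (simp add: subsets_of_size_def)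
    finally show ?thesis using True by simp
  qed (simp add: disjoint_in_def)
  assume "S \<noteq> T"
  then have "\<not> T \<subseteq> S"
    using S T fin card_subset_eq[of S T] by (auto simp: subsets_of_size_def)
  then have "card S < card (S \<union> T)"
    using fin by (intro psubset_card_mono) auto
  then have c: "s < card (S \<union> T)" using S by (simp add: subsets_of_size_def)
  have eq: "{e \<in> subsets_of_size n r. S \<subseteq> e \<and> T \<subseteq> e} = {e \<in> subsets_of_size n r. S \<union> T \<subseteq> e}"
    by auto
  \<comment> \<open>The case distinction is forced by truncated subtraction: when the union has more
    than \<open>r\<close> elements no edge contains it, but \<open>r - card (S \<union> T)\<close>
    would be 0.\<close>
  have "card {e \<in> subsets_of_size n r. S \<subseteq> e \<and> T \<subseteq> e} \<le> n ^ (r - s - 1)"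
  proof (cases "card (S \<union> T) \<le> r")
    case True
    have "card {e \<in> subsets_of_size n r. S \<subseteq> e \<and> T \<subseteq> e} = (n - card (S \<union> T)) choose (r - card (S \<union> T))"
      unfolding eq using S T True by (intro card_supersets_of_size) (auto simp: subsets_of_size_def)
    also have "\<dots> \<le> (n - card (S \<union> T)) ^ (r - card (S \<union> T))" by (rule binomial_le_power)
    also have "\<dots> \<le> n ^ (r - card (S \<union> T))" by (intro power_mono) auto
    also have "\<dots> \<le> n ^ (r - s - 1)" using c n s by (intro power_increasing) auto
    finally show ?thesis .
  next
    case False
    have empty: "{e \<in> subsets_of_size n r. S \<union> T \<subseteq> e} = {}"
    proof (rule ccontr)
      assume "{e \<in> subsets_of_size n r. S \<union> T \<subseteq> e} \<noteq> {}"
      then obtain e where e: "e \<subseteq> {1..n}" "card e = r" "S \<union> T \<subseteq> e"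
        by (auto simp: subsets_of_size_def)
      then have "card (S \<union> T) \<le> r" using card_mono[of e "S \<union> T"] finite_subset[of e "{1..n}"] by auto
      with False show False by simp
    qed
    show ?thesis unfolding eq empty by simp
  qed
  then show "real (card {e \<in> subsets_of_size n r. S \<subseteq> e \<and> T \<subseteq> e}) \<le> real n ^ (r - s - 1)"
    by (metis of_nat_le_iff of_nat_power)
next
  fix S assume S: "S \<in> subsets_of_size n s"
  then have fin: "finite S" using finite_subset[of _ "{1..n}"] by (auto simp: subsets_of_size_def)
  have "{T \<in> subsets_of_size n s. S \<inter> T = {}} = {T. T \<subseteq> {1..n} - S \<and> card T = s}"
    by (auto simp: subsets_of_size_def)
  also have "card \<dots> = (n - s) choose s"
    using S fin n_subsets[of "{1..n} - S" s] by (simp add: subsets_of_size_def card_Diff_subset)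
  finally have adj: "card {T \<in> subsets_of_size n s. S \<inter> T = {}} = (n - s) choose s" .
  have "card (subsets_of_size n s) = card {T \<in> subsets_of_size n s. S \<inter> T = {}} + card {T \<in> subsets_of_size n s. S \<inter> T \<noteq> {}}"
    by (subst card_Un_disjoint[symmetric]) (auto intro!: arg_cong[of _ _ card])
  then have "real (card {T \<in> subsets_of_size n s. S \<inter> T \<noteq> {}}) = real (n choose s) - real ((n - s) choose s)"
    unfolding adj card_subsets_of_size by simp
  moreover have "n choose s \<noteq> 0" using s n by simp
  then have "(1 - real ((n - s) choose s) / real (n choose s)) * real (card (subsets_of_size n s)) =
      real (n choose s) - real ((n - s) choose s)"
    by (simp add: card_subsets_of_size left_diff_distrib)
  ultimately show "real (card {T \<in> subsets_of_size n s. S \<inter> T \<noteq> {}}) \<le>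
      (1 - real ((n - s) choose s) / real (n choose s)) * real (card (subsets_of_size n s))"
    by simp
next
  show "subsets_of_size n s \<noteq> {}"
    using card_subsets_of_size[of n s] s n by (auto simp: card_eq_0_iff)
qed (use p rho in auto)

text \<open>Counting the edges that contain both sets is a sum of edge indicators, and by linearity
  centring the entry centres each indicator. This identifies the matrix with \<open>M\<close> of the
  locale.\<close>

lemma centred_weight_matrix_entry:
  assumes p: "0 \<le> p" "p \<le> 1" and h: "h \<in> set_pmf (Pi_pmf (subsets_of_size n r) False (\<lambda>_. bernoulli_pmf p))"
    and ij: "i < n choose s" "j < n choose s"
  shows "(weight_matrix s n {e. h e} - expected_weight_matrix r s n p) $$ (i, j) =
    complex_of_real (\<Sum>e\<in>subsets_of_size n r. disjoint_in e (s_subsets n s ! i) (s_subsets n s ! j) * (of_bool (h e) - p))"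
proof -
  let ?Es = "subsets_of_size n r"
  let ?P = "Pi_pmf ?Es False (\<lambda>_. bernoulli_pmf p)"
  let ?S = "s_subsets n s ! i" and ?T = "s_subsets n s ! j"
  have entry: "weight_matrix s n {e. h e} $$ (i, j) = complex_of_real (\<Sum>e\<in>?Es. disjoint_in e ?S ?T * of_bool (h e))"
    if "h \<in> set_pmf ?P" for h
  proof -
    \<comment> \<open>On the support \<open>h\<close> is \<open>False\<close> off the
      \<open>r\<close>-subsets, so the cardinality in \<open>aux_weight\<close> counts only genuine
      edges.\<close>
    have h: "e \<in> ?Es" if "h e" for e
      using that \<open>h \<in> set_pmf ?P\<close> set_Pi_pmf_subset[of ?Es False "\<lambda>_. bernoulli_pmf p"] by auto
    have "real (aux_weight {e. h e} ?S ?T) = (\<Sum>e\<in>?Es. disjoint_in e ?S ?T * of_bool (h e))"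
    proof (cases "?S \<inter> ?T = {}")
      case True
      have "{e \<in> {e. h e}. ?S \<union> ?T \<subseteq> e} = ?Es \<inter> {e. ?S \<union> ?T \<subseteq> e \<and> h e}"
        using h by auto
      then show ?thesis
        using True by (simp add: aux_weight_def disjoint_in_def of_bool_conj[symmetric] del: of_bool_conj)
    qed (simp add: aux_weight_def disjoint_in_def)
    moreover have "weight_matrix s n {e. h e} $$ (i, j) = complex_of_real (real (aux_weight {e. h e} ?S ?T))"
      using ij by (simp add: weight_matrix_def)
    ultimately show ?thesis by (simp only:)
  qed
  have fin: "finite (set_pmf ?P)" by (simp add: set_Pi_pmf finite_PiE_dflt)
  have marginal: "measure_pmf.expectation ?P (\<lambda>h. of_bool (h e)) = p" if "e \<in> ?Es" for e
  proof -
    have "measure_pmf.expectation ?P (\<lambda>h. of_bool (h e) :: real) =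
        measure_pmf.expectation (map_pmf (\<lambda>h. h e) ?P) of_bool"
      by simp
    also have "map_pmf (\<lambda>h. h e) ?P = bernoulli_pmf p"
      using that by (simp add: Pi_pmf_component)
    finally show ?thesis using p by simp
  qed
  have "expected_weight_matrix r s n p $$ (i, j) =
      measure_pmf.expectation ?P (\<lambda>h. weight_matrix s n {e. h e} $$ (i, j))"
    using ij by (simp add: expected_weight_matrix_def random_hypergraph_def subsets_of_size_def)
  also have "\<dots> = measure_pmf.expectation ?P (\<lambda>h. complex_of_real (\<Sum>e\<in>?Es. disjoint_in e ?S ?T * of_bool (h e)))"
    using entry by (intro integral_cong_AE AE_pmfI) auto
  also have "\<dots> = complex_of_real (measure_pmf.expectation ?P (\<lambda>h. \<Sum>e\<in>?Es. disjoint_in e ?S ?T * of_bool (h e)))"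
    by (rule integral_complex_of_real)
  also have "measure_pmf.expectation ?P (\<lambda>h. \<Sum>e\<in>?Es. disjoint_in e ?S ?T * of_bool (h e)) =
      (\<Sum>e\<in>?Es. measure_pmf.expectation ?P (\<lambda>h. disjoint_in e ?S ?T * of_bool (h e)))"
    by (intro Bochner_Integration.integral_sum integrable_measure_pmf_finite[OF fin])
  also have "\<dots> = (\<Sum>e\<in>?Es. disjoint_in e ?S ?T * p)"
    by (intro sum.cong refl) (simp add: marginal)
  finally have "expected_weight_matrix r s n p $$ (i, j) = complex_of_real (\<Sum>e\<in>?Es. disjoint_in e ?S ?T * p)" .
  moreover have "(weight_matrix s n {e. h e} - expected_weight_matrix r s n p) $$ (i, j) =
      weight_matrix s n {e. h e} $$ (i, j) - expected_weight_matrix r s n p $$ (i, j)"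
    using ij by (simp add: expected_weight_matrix_def)
  ultimately show ?thesis
    using entry[OF h] by (simp add: right_diff_distrib sum_subtractf)
qed


lemma hypergraph_spectrum:
  fixes r s n :: nat and p :: real and h :: "nat set \<Rightarrow> bool"
  defines "D \<equiv> real ((r - s) choose s) * real ((n - s) choose (r - s))"
  defines "R \<equiv> 2 * sqrt (real ((r - s) choose s) * real ((n - s) choose (r - s)) * p * (1 - p))"
    and "W \<equiv> weight_matrix s n {e. h e} - expected_weight_matrix r s n p"
  assumes s: "1 \<le> s" "2 * s \<le> r" and n: "r \<le> n" and p: "0 \<le> p" "p \<le> 1"
    and rho: "1 \<le> p * (1 - p) * D"
    and h: "h \<in> set_pmf (Pi_pmf (subsets_of_size n r) False (\<lambda>_. bernoulli_pmf p))"
  obtains es where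
    "\<And>x. empirical_eigenvalue_cdf (complex_of_real (1 / R) \<cdot>\<^sub>m (W - complex_of_real 0 \<cdot>\<^sub>m 1\<^sub>m (dim_row W))) x =
      (\<Sum>e\<leftarrow>es. of_bool (e < x)) / real (n choose s)"
    "\<And>k. mixing_edge_matrix.\<tau> (subsets_of_size n s) (subsets_of_size n r) disjoint_in p D k h / 2 ^ k =
      (\<Sum>e\<leftarrow>es. e ^ k) / real (n choose s)"
proof -
  interpret mixing_edge_matrix "subsets_of_size n s" "subsets_of_size n r" "(\<subseteq>)" disjoint_in p D
      "r choose s" "\<lambda>S T. S \<inter> T = {}" "real ((n - 2 * s) choose (r - 2 * s))" "real n ^ (r - s - 1)"
      "1 - real ((n - s) choose s) / real (n choose s)"
    unfolding D_def by (rule mixing_hypergraph[OF s n p rho[unfolded D_def]])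
  let ?xs = "s_subsets n s"
  \<comment> \<open>The radius is \<open>2 * sqrt \<rho>\<close> while \<open>\<tau>\<close> divides
    by \<open>sqrt \<rho>\<close>; the remaining factor 1/2 yields the \<open>2 ^ k\<close>.\<close>
  let ?X = "\<lambda>S T. 1 / 2 * (inverse (sqrt \<rho>) * M h S T)"
  have R: "R = 2 * sqrt \<rho>" unfolding R_def \<rho>_def by (simp add: D_def mult_ac)
  have V: "set ?xs = subsets_of_size n s" by (simp add: set_s_subsets subsets_of_size_def)
  have W: "complex_of_real (1 / R) \<cdot>\<^sub>m (W - complex_of_real 0 \<cdot>\<^sub>m 1\<^sub>m (dim_row W)) =
      Matrix.mat (length ?xs) (length ?xs) (\<lambda>(i, j). complex_of_real (?X (?xs ! i) (?xs ! j)))" (is "?L = ?R")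
  proof (rule eq_matI)
    have dim: "dim_row W = n choose s" "dim_col W = n choose s"
      by (simp_all add: W_def expected_weight_matrix_def)
    show "dim_row ?L = dim_row ?R" "dim_col ?L = dim_col ?R"
      by (simp_all add: dim length_s_subsets)
    fix i j assume "i < dim_row ?R" "j < dim_col ?R"
    then have ij: "i < n choose s" "j < n choose s" by (simp_all add: length_s_subsets)
    have "W $$ (i, j) = complex_of_real (M h (?xs ! i) (?xs ! j))"
      unfolding W_def centred_weight_matrix_entry[OF p h ij] M_def \<xi>_def ..
    then show "?L $$ (i, j) = ?R $$ (i, j)"
      using ij by (simp add: dim length_s_subsets R field_simps)
  qed
  have sym: "?X S T = ?X T S" for S T
    by (simp only: M_sym[of h S T])
  obtain es where es: "\<And>x. empirical_eigenvalue_cdf ?R x = (\<Sum>e\<leftarrow>es. of_bool (e < x)) / real (length ?xs)"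
    "\<And>k. mtrace (set ?xs) (mpow (set ?xs) ?X k) = (\<Sum>e\<leftarrow>es. e ^ k)"
    using empirical_eigenvalue_cdf_of_function[where X = ?X, OF distinct_s_subsets sym] by blast
  show thesis
  proof (rule that)
    show "empirical_eigenvalue_cdf ?L x = (\<Sum>e\<leftarrow>es. of_bool (e < x)) / real (n choose s)" for x
      unfolding W using es(1)[of x] by (simp only: length_s_subsets)
    show "\<tau> k h / 2 ^ k = (\<Sum>e\<leftarrow>es. e ^ k) / real (n choose s)" for k
      unfolding es(2)[symmetric] V \<tau>_def mpow_scale[of _ "1 / 2"] mtrace_def
      by (simp add: card_subsets_of_size power_one_over flip: sum_divide_distrib)
  qed
qed

lemma binomial_ratio_tendsto:
  "(\<lambda>n. real ((n - a) choose k) / real ((n - b) choose k)) \<longlonglongrightarrow> 1"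
proof -
  have "(\<lambda>n. (real ((n - a) choose k) / real n ^ k) / (real ((n - b) choose k) / real n ^ k)) \<longlonglongrightarrow>
      (1 / fact k) / (1 / fact k)"
    by (intro tendsto_divide tendsto_binomial_over_power) auto
  moreover have "\<forall>\<^sub>F n in sequentially. (real ((n - a) choose k) / real n ^ k) / (real ((n - b) choose k) / real n ^ k) =
      real ((n - a) choose k) / real ((n - b) choose k)"
    using eventually_gt_at_top[of 0] by eventually_elim simp
  ultimately show ?thesis
    by (simp add: Lim_transform_eventually)
qed

theorem theorem5:
  fixes r s :: nat and p :: "nat \<Rightarrow> real"
  assumes "1 \<le> s" and "2 * s \<le> r"
    and "\<And>n. 0 \<le> p n \<and> p n \<le> 1"
    and "filterlim (\<lambda>n. real n ^ (r - s) * p n * (1 - p n)) at_top sequentially"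
  shows "follows_semicircle_law
           (\<lambda>n. random_hypergraph r n (p n))
           (\<lambda>n E. weight_matrix s n E - expected_weight_matrix r s n (p n))
           (\<lambda>n. 0)
           (\<lambda>n. 2 * sqrt (real ((r - s) choose s) * real ((n - s) choose (r - s)) * p n * (1 - p n)))"
proof -
  \<comment> \<open>\<open>p n * (1 - p n) * D n\<close> is a quarter of the squared radius, and
    \<open>D n\<close> is asymptotically \<open>c * n ^ (r - s)\<close>, so the growth hypothesis
    says that this quantity tends to infinity.\<close>
  define D where "D = (\<lambda>n. real ((r - s) choose s) * real ((n - s) choose (r - s)))"
  define c where "c = real ((r - s) choose s) * (1 / fact (r - s))"
  have c: "0 < c" using assms(2) by (simp add: c_def zero_less_binomial)
  have D: "(\<lambda>n. D n / real n ^ (r - s)) \<longlonglongrightarrow> c"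
    unfolding D_def c_def times_divide_eq_right[symmetric]
    by (intro tendsto_mult tendsto_const tendsto_binomial_over_power)
  have "filterlim (\<lambda>n. D n / real n ^ (r - s) * (real n ^ (r - s) * p n * (1 - p n))) at_top sequentially"
    by (rule filterlim_tendsto_pos_mult_at_top[OF D c assms(4)])
  moreover have "\<forall>\<^sub>F n in sequentially. D n / real n ^ (r - s) * (real n ^ (r - s) * p n * (1 - p n)) = p n * (1 - p n) * D n"
    using eventually_gt_at_top[of 0] by eventually_elim simp
  ultimately have rho: "filterlim (\<lambda>n. p n * (1 - p n) * D n) at_top sequentially"
    using filterlim_cong[OF refl refl] by fast
  have good: "\<forall>\<^sub>F n in sequentially. r \<le> n \<and> 1 \<le> p n * (1 - p n) * D n"
    using eventually_ge_at_top[of r] filterlim_at_top[THEN iffD1, OF rho, rule_format, of 1]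
    by eventually_elim simp
  have card_V: "real (card (subsets_of_size n s)) = real (n choose s)" for n
    by (simp add: card_subsets_of_size)
  have N: "filterlim (\<lambda>n. real (card (subsets_of_size n s))) at_top sequentially"
  proof -
    have "filterlim (\<lambda>n. real ((n - 0) choose s) / real n ^ s * real n ^ s) at_top sequentially"
      using assms(1) by (intro filterlim_tendsto_pos_mult_at_top[OF tendsto_binomial_over_power]
          filterlim_pow_at_top filterlim_real_sequentially) auto
    moreover have "\<forall>\<^sub>F n in sequentially. real ((n - 0) choose s) / real n ^ s * real n ^ s = real (card (subsets_of_size n s))"
      using eventually_gt_at_top[of 0] by eventually_elim (simp add: card_V)
    ultimately show ?thesis using filterlim_cong[OF refl refl] by fast
  qed
  have g: "(\<lambda>n. real ((n - 2 * s) choose (r - 2 * s)) * real (card (subsets_of_size n s)) / D n) \<longlonglongrightarrow> 1"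
  proof (rule Lim_transform_eventually)
    show "(\<lambda>n. real ((n - 0) choose s) / real ((n - s) choose s)) \<longlonglongrightarrow> 1" by (rule binomial_ratio_tendsto)
    show "\<forall>\<^sub>F n in sequentially. real ((n - 0) choose s) / real ((n - s) choose s) =
        real ((n - 2 * s) choose (r - 2 * s)) * real (card (subsets_of_size n s)) / D n"
      using eventually_ge_at_top[of r]
    proof eventually_elim
      case (elim n)
      \<comment> \<open>For fixed \<open>S\<close>, pairs of an edge and a disjoint
        \<open>s\<close>-set inside it are counted by choosing the edge first or the
        \<open>s\<close>-set first. Hence \<open>D\<close> is \<open>D0\<close> times the number of
        neighbours of \<open>S\<close>, which is asymptotically the number of all vertices.\<close>
      have "((n - s) choose (r - s)) * ((r - s) choose s) = ((n - s) choose s) * ((n - s - s) choose (r - s - s))"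
        using elim assms by (intro choose_mult) auto
      then have "D n = real ((n - s) choose s) * real ((n - 2 * s) choose (r - 2 * s))"
        unfolding D_def by (metis diff_diff_left mult.commute mult_2 of_nat_mult)
      moreover have "(n - 2 * s) choose (r - 2 * s) \<noteq> 0" using elim by simp
      ultimately show ?case by (simp add: card_V)
    qed
  qed
  have D2: "(\<lambda>n. real n ^ (r - s - 1) / D n) \<longlonglongrightarrow> 0"
  proof (rule Lim_transform_eventually)
    have "(\<lambda>n. inverse (real n) / (D n / real n ^ (r - s))) \<longlonglongrightarrow> 0 / c"
      using c by (intro tendsto_divide lim_inverse_n D) auto
    then show "(\<lambda>n. inverse (real n) / (D n / real n ^ (r - s))) \<longlonglongrightarrow> 0" by simp
    show "\<forall>\<^sub>F n in sequentially. inverse (real n) / (D n / real n ^ (r - s)) = real n ^ (r - s - 1) / D n"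
      using eventually_gt_at_top[of 0]
    proof eventually_elim
      case (elim n)
      have "r - s = Suc (r - s - 1)" using assms(1,2) by simp
      then have "real n ^ (r - s) = real n * real n ^ (r - s - 1)" by (metis power_Suc)
      then show ?case using elim by simp
    qed
  qed
  have D2pos: "\<forall>\<^sub>F n in sequentially. 0 < real n ^ (r - s - 1)"
    using eventually_gt_at_top[of 0] by eventually_elim simp
  have \<delta>: "(\<lambda>n. 1 - real ((n - s) choose s) / real (n choose s)) \<longlonglongrightarrow> 0"
    using tendsto_diff[OF tendsto_const binomial_ratio_tendsto[of s s 0], of 1] by simp
  have L: "\<forall>\<^sub>F n in sequentially.
      mixing_edge_matrix (subsets_of_size n s) (subsets_of_size n r) (\<subseteq>) disjoint_in (p n) (D n) (r choose s)
        (\<lambda>S T. S \<inter> T = {}) (real ((n - 2 * s) choose (r - 2 * s))) (real n ^ (r - s - 1))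
        (1 - real ((n - s) choose s) / real (n choose s))"
    using good
  proof eventually_elim
    case (elim n)
    then show ?case
      using assms(3)[of n] unfolding D_def by (intro mixing_hypergraph assms(1,2)) auto
  qed
  note moments = edge_matrix_moments_tendsto[OF L rho N g D2 D2pos \<delta>]
  let ?R = "\<lambda>n. 2 * sqrt (real ((r - s) choose s) * real ((n - s) choose (r - s)) * p n * (1 - p n))"
  let ?W = "\<lambda>n E. weight_matrix s n E - expected_weight_matrix r s n (p n)"
  let ?P = "\<lambda>n. Pi_pmf (subsets_of_size n r) False (\<lambda>_. bernoulli_pmf (p n))"
  let ?G = "\<lambda>n h. empirical_eigenvalue_cdf (complex_of_real (1 / ?R n) \<cdot>\<^sub>m
      (?W n {e. h e} - complex_of_real 0 \<cdot>\<^sub>m 1\<^sub>m (dim_row (?W n {e. h e}))))"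
  have spec: "\<forall>\<^sub>F n in sequentially. \<forall>h\<in>set_pmf (?P n). \<exists>es.
      (\<forall>x. ?G n h x = (\<Sum>e\<leftarrow>es. of_bool (e < x)) / real (n choose s)) \<and>
      (\<forall>k. mixing_edge_matrix.\<tau> (subsets_of_size n s) (subsets_of_size n r) disjoint_in (p n) (D n) k h / 2 ^ k =
        (\<Sum>e\<leftarrow>es. e ^ k) / real (n choose s)) \<and> 0 < real (n choose s)"
    using good
  proof eventually_elim
    case (elim n)
    show ?case
    proof
      fix h assume h: "h \<in> set_pmf (?P n)"
      obtain es where "\<And>x. ?G n h x = (\<Sum>e\<leftarrow>es. of_bool (e < x)) / real (n choose s)"
        "\<And>k. mixing_edge_matrix.\<tau> (subsets_of_size n s) (subsets_of_size n r) disjoint_in (p n) (D n) k h / 2 ^ k =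
          (\<Sum>e\<leftarrow>es. e ^ k) / real (n choose s)"
        using hypergraph_spectrum[OF assms(1,2), of n "p n" h] elim assms(3)[of n] h unfolding D_def by blast
      moreover have "0 < real (n choose s)" using elim assms(2) by (simp add: zero_less_binomial)
      ultimately show "\<exists>es. (\<forall>x. ?G n h x = (\<Sum>e\<leftarrow>es. of_bool (e < x)) / real (n choose s)) \<and>
        (\<forall>k. mixing_edge_matrix.\<tau> (subsets_of_size n s) (subsets_of_size n r) disjoint_in (p n) (D n) k h / 2 ^ k =
          (\<Sum>e\<leftarrow>es. e ^ k) / real (n choose s)) \<and> 0 < real (n choose s)"
        by blast
    qed
  qed
  have fin: "finite (set_pmf (?P n))" for n by (simp add: set_Pi_pmf finite_PiE_dflt)
  show ?thesis
    unfolding follows_semicircle_law_def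
  proof (intro allI impI)
    fix x \<epsilon> :: real assume "0 < \<epsilon>"
    have "measure_pmf.prob (random_hypergraph r n (p n))
        {E. \<bar>empirical_eigenvalue_cdf (complex_of_real (1 / ?R n) \<cdot>\<^sub>m
          (?W n E - complex_of_real 0 \<cdot>\<^sub>m 1\<^sub>m (dim_row (?W n E)))) x - semicircle_cdf x\<bar> > \<epsilon>} =
        measure_pmf.prob (?P n) {h. \<bar>?G n h x - semicircle_cdf x\<bar> > \<epsilon>}" for n
      unfolding random_hypergraph_def subsets_of_size_def measure_map_pmf vimage_def mem_Collect_eq ..
    then show "(\<lambda>n. measure_pmf.prob (random_hypergraph r n (p n))
        {E. \<bar>empirical_eigenvalue_cdf (complex_of_real (1 / ?R n) \<cdot>\<^sub>m
          (?W n E - complex_of_real 0 \<cdot>\<^sub>m 1\<^sub>m (dim_row (?W n E)))) x - semicircle_cdf x\<bar> > \<epsilon>}) \<longlonglongrightarrow> 0"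
      using semicircle_law_of_moments[OF fin \<open>0 < \<epsilon>\<close> moments spec, of x] by (simp only:)
  qed
qed

end
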